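(* Let $p,u\ge1$, $q,r,v,s>0$, $0\le\theta\le1$, and $\alpha_1,\alpha_2,\alpha_3,\sigma\in\mathbb{R}$ satisfy $\frac np+\alpha_2>0$, $\frac nu+\alpha_3>0$, $\frac nq+\alpha_1>0$, $\sigma\le\alpha_2\le\sigma+1$, $\alpha_1=\theta\sigma+(1-\theta)\alpha_3$, $\frac nq+\alpha_1=\theta(\frac np+\alpha_2-1)+(\frac nu+\alpha_3)(1-\theta)$ and $\frac1r=\frac\theta s+\frac{1-\theta}v$. Then there is $c>0$ such that $$\|f\|_{\dot K_q^{\alpha_1,r}(\mathbb{R}^n)}\le c\,\|\nabla f\|_{\dot K_p^{\alpha_2,s}(\mathbb{R}^n)}^{\theta}\,\|f\|_{\dot K_u^{\alpha_3,v}(\mathbb{R}^n)}^{1-\theta}\quad\text{for all } f\in C^1(\mathbb{R}^n).$$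
   Context: For $k\in\mathbb{Z}$ let $C_k=\{x\in\mathbb{R}^n: 2^{k-1}\le |x|<2^k\}$ and $\chi_k$ its characteristic function. For $\alpha\in\mathbb{R}$ and $0<p,q\le\infty$, $\|f\|_{\dot K_p^{\alpha,q}(\mathbb{R}^n)}=\big(\sum_{k\in\mathbb{Z}}2^{k\alpha q}\|f\chi_k\|_{L^p}^q\big)^{1/q}$ (usual modification if $q=\infty$); for the gradient, $\|\nabla f\|_{\dot K_p^{\alpha,q}}$ means $\||\nabla f|\|_{\dot K_p^{\alpha,q}}$.
   Formalization: The inequality is proved for those f in C^1 for which both norms on the right-hand side are finite; without this it fails for nonzero constants when θ=1 and reads 0·∞ for them when 0<θ<1. Exponents are finite and f is real-valued. *)

theory Defs
  imports "HOL-Analysis.Analysis"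
begin

text \<open>Power of a nonnegative extended real with positive real exponent (\<infinity> to a positive power is \<infinity>).\<close>
definition epow :: "ennreal \<Rightarrow> real \<Rightarrow> ennreal" where
  "epow x a = (if x = \<infinity> then \<infinity> else ennreal (enn2real x powr a))"

definition rpow :: "real \<Rightarrow> real \<Rightarrow> real" where
  "rpow x a = (if a = 0 then 1 else x powr a)"

definition annulus :: "int \<Rightarrow> 'a::euclidean_space set" where
  "annulus k = {x. 2 powr (real_of_int k - 1) \<le> norm x \<and> norm x < 2 powr (real_of_int k)}"

definition Lp_norm_on :: "real \<Rightarrow> 'a::euclidean_space set \<Rightarrow> ('a \<Rightarrow> real) \<Rightarrow> ennreal" where
  "Lp_norm_on p A g = epow (\<integral>\<^sup>+ x \<in> A. ennreal (\<bar>g x\<bar> powr p) \<partial>lborel) (1 / p)"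

definition herz_norm :: "real \<Rightarrow> real \<Rightarrow> real \<Rightarrow> ('a::euclidean_space \<Rightarrow> real) \<Rightarrow> ennreal" where
  "herz_norm \<alpha> p q g = epow (\<integral>\<^sup>+ k. ennreal (2 powr (real_of_int k * \<alpha> * q)) *
       epow (Lp_norm_on p (annulus k) g) q \<partial>count_space UNIV) (1 / q)"

definition grad_norm :: "('a::euclidean_space \<Rightarrow> real) \<Rightarrow> 'a \<Rightarrow> real" where
  "grad_norm f x = norm (\<Sum>b\<in>Basis. frechet_derivative f (at x) b *\<^sub>R b)"

definition C1_fun :: "('a::euclidean_space \<Rightarrow> real) \<Rightarrow> bool" where
  "C1_fun f \<longleftrightarrow> (\<forall>x. f differentiable (at x)) \<and>
     (\<forall>b\<in>Basis. continuous_on UNIV (\<lambda>x. frechet_derivative f (at x) b))"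

end

theory Submission
  imports Defs
begin

text \<open>A Gagliardo--Nirenberg inequality on all of space, for compactly supported \<open>h\<close>, comes from truncation at dyadic
  levels: with \<open>m\<^sub>j = |{|h| > 2^j}|\<close>, translating by vectors shorter than \<open>\<rho> \<sim> m\<^sub>j^(1/n)\<close> gives
  \<open>2^j m\<^sub>j\<^sub>+\<^sub>1 \<le> C \<rho> \<integral> |\<nabla>h|\<close>, the integral being over the layer \<open>2^j < |h| \<le> 2^(j+1)\<close>. Since the layers are disjoint,
  Hoelder on sequences yields the inequality for all admissible exponents at once, including \<open>p = 1\<close> and \<open>p \<ge> n\<close>.

  On an annulus it is applied to \<open>f(x) - f(2x)\<close> times a cutoff, rather than to \<open>f\<close>: this increment is an integral of
  \<open>\<nabla>f\<close> along a ray, so the derivative of the cutoff is harmless and no sign of \<open>n/p + \<alpha>\<^sub>2 - 1\<close> is needed. Finally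
  \<open>f(x)\<close> is the sum of \<open>f(2^j x) - f(2^(j+1) x)\<close> over \<open>j \<ge> 0\<close>, because \<open>n/u + \<alpha>\<^sub>3 > 0\<close> forces \<open>f(2^j x) \<rightarrow> 0\<close> almost
  everywhere, and \<open>n/q + \<alpha>\<^sub>1 > 0\<close> makes this sum a discrete Hardy operator, bounded for every \<open>r > 0\<close>.\<close>

subsection \<open>Power inequalities and dyadic sums\<close>

text \<open>Put \<open>\<delta> = \<sigma> + 1 - \<alpha>2\<close>. The two bounds on \<alpha>2 say
  that \<delta> lies in [0,1], and substituting the formula for \<alpha>1 into the scaling relation
  leaves 1/q = \<theta> (1/p - \<delta>/n) + (1 - \<theta>)/u. For \<delta> = 1 this is the
  scale-invariant Gagliardo--Nirenberg relation. For \<delta> < 1 a power of the measure of the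
  level sets is given away, which costs a constant only if the support is bounded; this is why the
  inequality is used on one annulus at a time. The powers of 2^k produced by rescaling annuli are
  accounted for by the scaling relation. A recurring obstacle is that q, r, s, v may be below 1,
  where the triangle inequality fails. Sums are then controlled through their largest term and
  geometric weights. The positive gap n/q + \<alpha>1 is cut into halves: one pays for the pointwise
  sum over j, the other for the Hardy operator. The truncation bound passes from level j to level
  j+1, so after summation the unknown sum may reappear on the right; it is finite and its exponent
  there is below 1, so it can be absorbed.\<close>

lemma weighted_amgm3:
  fixes x y z a b c :: real
  assumes "0 < x" "0 < y" "0 < z" "0 \<le> a" "0 \<le> b" "0 \<le> c" "a + b + c = 1"
  shows "x powr a * y powr b * z powr c \<le> a * x + b * y + c * z"
proof -
  define m where "m = x powr a * y powr b * z powr c"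
  have m: "m > 0" using assms by (simp add: m_def)
  have ln_m: "ln m = a * ln x + b * ln y + c * ln z"
    using assms by (simp add: m_def ln_mult ln_powr)
  have tangent: "1 + ln t - ln m \<le> t / m" if "t > 0" for t
    using ln_le_minus_one[of "t / m"] that m by (simp add: ln_div)
  have "a * (1 + ln x - ln m) + b * (1 + ln y - ln m) + c * (1 + ln z - ln m)
      \<le> a * (x / m) + b * (y / m) + c * (z / m)"
    using tangent assms by (intro add_mono mult_left_mono) auto
  also have "a * (1 + ln x - ln m) + b * (1 + ln y - ln m) + c * (1 + ln z - ln m)
      = (a + b + c) * (1 - ln m) + ln m"
    by (simp add: ln_m algebra_simps)
  also have "\<dots> = 1" using assms by simp
  finally have "m \<le> a * x + b * y + c * z"
    using m by (simp add: field_simps)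
  then show ?thesis by (simp add: m_def)
qed

text \<open>For entries in (0,1] dividing the exponents by their sum, which is at least 1, only
  increases the product and reduces the claim to the weighted mean inequality. This is the embedding
  of l^1 into l^S in disguise.\<close>

lemma amgm3_superlinear:
  fixes x y z a b c :: real
  assumes "0 < x" "x \<le> 1" "0 < y" "y \<le> 1" "0 < z" "z \<le> 1"
    and "0 \<le> a" "0 \<le> b" "0 \<le> c" "1 \<le> a + b + c"
  shows "x powr a * y powr b * z powr c \<le> (a * x + b * y + c * z) / (a + b + c)"
proof -
  define S where "S = a + b + c"
  have S: "S \<ge> 1" using assms by (simp add: S_def)
  have mono: "t powr d \<le> t powr (d / S)" if "0 < t" "t \<le> 1" "0 \<le> d" for t d :: real
  proof (rule powr_mono')
    show "d / S \<le> d" using that S by (simp add: divide_le_eq mult_le_cancel_left1)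
  qed (use that in auto)
  have "x powr a * y powr b * z powr c \<le> x powr (a/S) * y powr (b/S) * z powr (c/S)"
    using assms by (intro mult_mono mono) auto
  also have "\<dots> \<le> a/S * x + b/S * y + c/S * z"
  proof (rule weighted_amgm3)
    show "a/S + b/S + c/S = 1" using S by (simp add: S_def add_divide_distrib[symmetric])
  qed (use assms S in auto)
  finally show ?thesis by (simp add: S_def add_divide_distrib)
qed

lemma nn_integral_count_space_zero:
  fixes x :: "'i \<Rightarrow> real"
  assumes "\<And>i. 0 \<le> x i" "(\<integral>\<^sup>+ i. ennreal (x i) \<partial>count_space UNIV) \<le> 0"
  shows "x i = 0"
proof -
  have "ennreal (x i) \<le> 0"
    using nn_integral_ge_point[of i UNIV "\<lambda>i. ennreal (x i)"] assms(2) by simp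
  then show ?thesis using assms(1)[of i] by (simp add: ennreal_eq_0_iff)
qed

text \<open>Here \<open>0 powr 0 = 0\<close>, so that the inequality remains true when one of the bounds vanishes.\<close>

lemma nn_integral_count_space_Holder3:
  fixes x y z :: "'i \<Rightarrow> real" and a b c X Y Z :: real
  assumes nonneg: "\<And>i. 0 \<le> x i" "\<And>i. 0 \<le> y i" "\<And>i. 0 \<le> z i"
    and X: "(\<integral>\<^sup>+ i. ennreal (x i) \<partial>count_space UNIV) \<le> ennreal X" "0 \<le> X"
    and Y: "(\<integral>\<^sup>+ i. ennreal (y i) \<partial>count_space UNIV) \<le> ennreal Y" "0 \<le> Y"
    and Z: "(\<integral>\<^sup>+ i. ennreal (z i) \<partial>count_space UNIV) \<le> ennreal Z" "0 \<le> Z"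
    and exps: "0 \<le> a" "0 \<le> b" "0 \<le> c" "1 \<le> a + b + c"
  shows "(\<integral>\<^sup>+ i. ennreal (x i powr a * y i powr b * z i powr c) \<partial>count_space UNIV)
      \<le> ennreal (X powr a * Y powr b * Z powr c)"
proof (cases "X = 0 \<or> Y = 0 \<or> Z = 0")
  case True
  then have "x i powr a * y i powr b * z i powr c = 0" for i
    using nn_integral_count_space_zero[of x] nn_integral_count_space_zero[of y]
      nn_integral_count_space_zero[of z] nonneg X Y Z by (metis ennreal_0 mult_zero_left mult_zero_right powr_0)
  then show ?thesis by (simp only:) simp
next
  case False
  then have pos: "X > 0" "Y > 0" "Z > 0" using X Y Z by auto
  define S where "S = a + b + c"
  have S: "S \<ge> 1" using exps by (simp add: S_def)
  define W where "W = X powr a * Y powr b * Z powr c"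
  have W: "W > 0" using pos by (simp add: W_def)
  \<comment> \<open>For the counting measure every term is bounded by the whole sum, so after
    division by X, Y, Z all entries are at most 1, the range in which exponents with sum above 1 are
    allowed.\<close>
  have le: "w i \<le> V" if "(\<integral>\<^sup>+ i. ennreal (w i) \<partial>count_space UNIV) \<le> ennreal V" "V > 0"
    for w :: "'i \<Rightarrow> real" and V i
  proof -
    have "ennreal (w i) \<le> ennreal V"
      by (rule order_trans[OF nn_integral_ge_point[of i UNIV "\<lambda>i. ennreal (w i)"] that(1)]) simp
    then show ?thesis using that by (simp add: ennreal_le_iff)
  qed
  have pt: "x i powr a * y i powr b * z i powr c
      \<le> W * a / (S * X) * x i + W * b / (S * Y) * y i + W * c / (S * Z) * z i" for i
  proof (cases "x i = 0 \<or> y i = 0 \<or> z i = 0")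
    case True
    then have "x i powr a * y i powr b * z i powr c = 0" by auto
    moreover have "0 \<le> W * a / (S * X) * x i + W * b / (S * Y) * y i + W * c / (S * Z) * z i"
      using nonneg pos W S exps by simp
    ultimately show ?thesis by (simp only:)
  next
    case False
    then have p: "x i > 0" "y i > 0" "z i > 0" using nonneg[of i] by auto
    have "(x i / X) powr a * (y i / Y) powr b * (z i / Z) powr c
        \<le> (a * (x i / X) + b * (y i / Y) + c * (z i / Z)) / (a + b + c)"
      using p pos exps le[OF X(1) pos(1)] le[OF Y(1) pos(2)] le[OF Z(1) pos(3)]
      by (intro amgm3_superlinear) auto
    also have "(x i / X) powr a * (y i / Y) powr b * (z i / Z) powr c
        = (x i powr a * y i powr b * z i powr c) / W"
      using p pos by (simp add: powr_divide W_def)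
    finally have "x i powr a * y i powr b * z i powr c
        \<le> W * ((a * (x i / X) + b * (y i / Y) + c * (z i / Z)) / S)"
      using W by (simp add: S_def pos_divide_le_eq mult.commute)
    also have "\<dots> = W * a / (S * X) * x i + W * b / (S * Y) * y i + W * c / (S * Z) * z i"
      by (simp add: add_divide_distrib distrib_left ac_simps)
    finally show ?thesis .
  qed
  define A B C where "A = W * a / (S * X)" and "B = W * b / (S * Y)" and "C = W * c / (S * Z)"
  have cof: "0 \<le> A" "0 \<le> B" "0 \<le> C"
    using W S pos exps by (auto simp: A_def B_def C_def)
  have "(\<integral>\<^sup>+ i. ennreal (x i powr a * y i powr b * z i powr c) \<partial>count_space UNIV)
     \<le> (\<integral>\<^sup>+ i. ennreal (A * x i + B * y i + C * z i) \<partial>count_space UNIV)"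
    using pt unfolding A_def B_def C_def by (intro nn_integral_mono ennreal_leI)
  also have "\<dots> = (\<integral>\<^sup>+ i. ennreal A * ennreal (x i) + ennreal B * ennreal (y i)
          + ennreal C * ennreal (z i) \<partial>count_space UNIV)"
    using cof nonneg by (simp add: ennreal_mult)
  also have "\<dots> = ennreal A * (\<integral>\<^sup>+ i. ennreal (x i) \<partial>count_space UNIV)
      + ennreal B * (\<integral>\<^sup>+ i. ennreal (y i) \<partial>count_space UNIV)
      + ennreal C * (\<integral>\<^sup>+ i. ennreal (z i) \<partial>count_space UNIV)"
    by (simp add: nn_integral_add nn_integral_cmult)
  also have "\<dots> \<le> ennreal A * ennreal X + ennreal B * ennreal Y + ennreal C * ennreal Z"
    using X Y Z by (intro add_mono mult_left_mono) auto
  also have "\<dots> = ennreal (A * X + B * Y + C * Z)"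
    using cof pos by (simp add: ennreal_mult)
  also have "A * X + B * Y + C * Z = W * (a + b + c) / S"
    using pos S by (simp add: A_def B_def C_def distrib_left add_divide_distrib)
  also have "\<dots> = W" using S by (simp add: S_def)
  finally show ?thesis by (simp add: W_def)
qed

section \<open>Dilation and translation of Lebesgue integrals, and the quasi-triangle
  inequality\<close>

lemma nn_integral_lborel_scale:
  fixes f :: "'a::euclidean_space \<Rightarrow> ennreal"
  assumes [measurable]: "f \<in> borel_measurable borel" and c: "c > 0"
  shows "(\<integral>\<^sup>+ x. f (c *\<^sub>R x) \<partial>lborel) = ennreal (1 / c ^ DIM('a)) * (\<integral>\<^sup>+ x. f x \<partial>lborel)"
proof -
  have "(\<integral>\<^sup>+ x. f x \<partial>lborel) = ennreal (c ^ DIM('a)) * (\<integral>\<^sup>+ x. f (c *\<^sub>R x) \<partial>lborel)"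
    using c by (subst lborel_affine[of c 0])
      (simp_all add: nn_integral_density nn_integral_distr nn_integral_cmult)
  then show ?thesis using c
    by (simp add: mult.assoc[symmetric] ennreal_mult[symmetric])
qed

lemma nn_integral_lborel_shift:
  fixes f :: "'a::euclidean_space \<Rightarrow> ennreal"
  assumes [measurable]: "f \<in> borel_measurable borel"
  shows "(\<integral>\<^sup>+ x. f (x + c) \<partial>lborel) = (\<integral>\<^sup>+ x. f x \<partial>lborel)"
proof -
  have "(\<integral>\<^sup>+ x. f x \<partial>lborel) = (\<integral>\<^sup>+ x. f x \<partial>distr lborel borel ((+) c))"
    by (simp add: lborel_distr_plus)
  also have "\<dots> = (\<integral>\<^sup>+ x. f (x + c) \<partial>lborel)"
    by (subst nn_integral_distr) (auto simp: add.commute)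
  finally show ?thesis by simp
qed

text \<open>Bounding the sum by twice the maximum works for every exponent, above and below 1; the
  constant is not sharp.\<close>

lemma powr_add_le_two_powr:
  fixes a b :: real
  assumes "0 \<le> a" "0 \<le> b" "0 \<le> p"
  shows "(a + b) powr p \<le> 2 powr p * (a powr p + b powr p)"
proof -
  have "(a + b) powr p \<le> (2 * max a b) powr p"
    using assms by (intro powr_mono2) auto
  also have "\<dots> = 2 powr p * max a b powr p" using assms by (simp add: powr_mult)
  also have "\<dots> \<le> 2 powr p * (a powr p + b powr p)"
    by (intro mult_left_mono) (auto simp: max_def)
  finally show ?thesis .
qed

section \<open>Powers of a number compared with sums over the dyadic levels below it\<close>

lemma dyadic_bracket:
  fixes t :: real assumes "t > 0"
  obtains j :: int where "2 powr (real_of_int j) < t" "t \<le> 2 powr (real_of_int j + 1)"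
proof
  have "real_of_int (\<lceil>log 2 t\<rceil> - 1) < log 2 t" "log 2 t \<le> real_of_int (\<lceil>log 2 t\<rceil> - 1) + 1" by linarith+
  then show "2 powr real_of_int (\<lceil>log 2 t\<rceil> - 1) < t" "t \<le> 2 powr (real_of_int (\<lceil>log 2 t\<rceil> - 1) + 1)"
    using assms by (simp_all only: less_log_iff log_le_iff one_less_numeral_iff semiring_norm)
qed

text \<open>The largest dyadic level below t suffices: it is at least t/2, whence the factor
  2^q.\<close>

lemma dyadic_sum_lower:
  fixes t q :: real
  assumes "q > 0" "t \<ge> 0"
  shows "ennreal (t powr q) \<le> ennreal (2 powr q) *
    (\<integral>\<^sup>+ j. ennreal (2 powr (real_of_int j * q)) * indicator {j. 2 powr (real_of_int j) < t} j \<partial>count_space UNIV)"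
proof (cases "t = 0")
  case False
  then have "t > 0" using assms by simp
  then obtain j :: int where j: "2 powr (real_of_int j) < t" "t \<le> 2 powr (real_of_int j + 1)" by (rule dyadic_bracket)
  have "t powr q \<le> (2 powr (real_of_int j + 1)) powr q" using j assms \<open>t > 0\<close> by (intro powr_mono2) auto
  also have "\<dots> = 2 powr q * 2 powr (real_of_int j * q)"
    by (simp add: powr_powr powr_add[symmetric] algebra_simps)
  finally have "ennreal (t powr q) \<le> ennreal (2 powr q) * ennreal (2 powr (real_of_int j * q))"
    by (simp add: ennreal_mult[symmetric] ennreal_leI)
  also have "\<dots> \<le> ennreal (2 powr q) * (\<integral>\<^sup>+ j. ennreal (2 powr (real_of_int j * q)) * indicator {j. 2 powr (real_of_int j) < t} j \<partial>count_space UNIV)"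
    using nn_integral_ge_point[of j UNIV "\<lambda>j. ennreal (2 powr (real_of_int j * q)) * indicator {j. 2 powr (real_of_int j) < t} j"] j
    by (intro mult_left_mono) auto
  finally show ?thesis .
qed simp

text \<open>All levels below t lie at or below the bracketing index j0, so the sum is a geometric
  series running downwards from 2^(j0 q), which is at most t^q.\<close>

lemma dyadic_sum_upper:
  fixes t q :: real
  assumes "q > 0" "t \<ge> 0"
  shows "(\<integral>\<^sup>+ j. ennreal (2 powr (real_of_int j * q)) * indicator {j. 2 powr (real_of_int j) < t} j \<partial>count_space UNIV)
    \<le> ennreal (1 / (1 - 2 powr (- q)) * t powr q)"
proof (cases "t = 0")
  case False
  then have "t > 0" using assms by simp
  then obtain j0 :: int where j0: "2 powr (real_of_int j0) < t" "t \<le> 2 powr (real_of_int j0 + 1)" by (rule dyadic_bracket)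
  have "{j. 2 powr (real_of_int j) < t} \<subseteq> {..j0}"
  proof clarsimp
    fix j :: int assume "2 powr (real_of_int j) < t"
    then have "2 powr (real_of_int j) < 2 powr (real_of_int j0 + 1)" using j0(2) by (rule less_le_trans)
    then show "j \<le> j0" by simp
  qed
  then have "(\<integral>\<^sup>+ j. ennreal (2 powr (real_of_int j * q)) * indicator {j. 2 powr (real_of_int j) < t} j \<partial>count_space UNIV)
     \<le> (\<integral>\<^sup>+ j. ennreal (2 powr (real_of_int j * q)) * indicator {..j0} j \<partial>count_space UNIV)"
    by (intro nn_integral_mono mult_left_mono) (auto simp: indicator_def)
  also have "\<dots> = (\<integral>\<^sup>+ j. ennreal (2 powr (real_of_int j * q)) \<partial>count_space {..j0})"
    by (simp add: nn_integral_count_space_indicator)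
  also have "\<dots> = (\<integral>\<^sup>+ i. ennreal (2 powr (real_of_int (j0 - int i) * q)) \<partial>count_space (UNIV::nat set))"
  proof (rule nn_integral_bij_count_space[symmetric, where g="\<lambda>i. j0 - int i"])
    show "bij_betw (\<lambda>i. j0 - int i) UNIV {..j0}"
      by (rule bij_betw_byWitness[where f'="\<lambda>j. nat (j0 - j)"]) auto
  qed
  also have "\<dots> = (\<Sum>i. ennreal (2 powr (real_of_int j0 * q) * (2 powr (- q)) ^ i))"
    by (simp add: nn_integral_count_space_nat powr_realpow[symmetric] powr_powr powr_add[symmetric] algebra_simps)
  also have "\<dots> = ennreal (2 powr (real_of_int j0 * q) * (1 / (1 - 2 powr (- q))))"
  proof (rule suminf_ennreal_eq)
    show "(\<lambda>i. 2 powr (real_of_int j0 * q) * (2 powr (- q)) ^ i) sums (2 powr (real_of_int j0 * q) * (1 / (1 - 2 powr (- q))))"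
      using assms by (intro sums_mult geometric_sums) (simp add: powr_less_one)
  qed auto
  also have "\<dots> \<le> ennreal (1 / (1 - 2 powr (- q)) * t powr q)"
  proof (rule ennreal_leI)
    have "2 powr (real_of_int j0 * q) = (2 powr real_of_int j0) powr q" by (simp add: powr_powr)
    also have "\<dots> \<le> t powr q" using j0 assms by (intro powr_mono2) auto
    finally show "2 powr (real_of_int j0 * q) * (1 / (1 - 2 powr (- q))) \<le> 1 / (1 - 2 powr (- q)) * t powr q"
      using powr_less_one[of 2 "-q"] assms by (simp add: divide_right_mono)
  qed
  finally show ?thesis .
qed simp

subsection \<open>Level sets and the gradient\<close>

lemma FTC_abs_le_nn_integral:
  fixes F F' :: "real \<Rightarrow> real"
  assumes "a \<le> b" and F: "\<And>t. (F has_vector_derivative F' t) (at t)" and F': "continuous_on UNIV F'"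
  shows "ennreal \<bar>F b - F a\<bar> \<le> (\<integral>\<^sup>+ t. ennreal \<bar>F' t\<bar> * indicator {a..b} t \<partial>lborel)"
proof -
  have cont: "continuous_on {a..b} F'" using F' continuous_on_subset by blast
  have "(LINT t|lborel. indicator {a..b} t *\<^sub>R F' t) = F b - F a"
    by (rule integral_FTC_atLeastAtMost[OF \<open>a \<le> b\<close> _ cont])
      (use F has_vector_derivative_at_within in blast)
  moreover have "integrable lborel (\<lambda>t. indicator {a..b} t *\<^sub>R F' t)"
    using borel_integrable_compact[OF compact_Icc cont] by (simp add: indicator_def if_distrib cong: if_cong)
  ultimately have "ennreal \<bar>F b - F a\<bar> \<le> (\<integral>\<^sup>+ t. ennreal (norm (indicator {a..b} t *\<^sub>R F' t)) \<partial>lborel)"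
    by (metis integral_norm_bound_ennreal real_norm_def)
  also have "\<dots> = (\<integral>\<^sup>+ t. ennreal \<bar>F' t\<bar> * indicator {a..b} t \<partial>lborel)"
    by (intro nn_integral_cong) (simp add: indicator_def)
  finally show ?thesis .
qed

text \<open>Let t0 be the last time in [0,1] with |F| at least 2 \<mu>, and t1 the first time from
  t0 on with |F| at most \<mu>. Between them F stays in the layer but changes by at least \<mu>, so
  the fundamental theorem on [t0, t1] gives the bound. Keeping the layer in the integrand is what
  later makes the contributions of different levels disjoint.\<close>

lemma level_crossing:
  fixes F F' :: "real \<Rightarrow> real"
  assumes F: "\<And>t. (F has_vector_derivative F' t) (at t)" and F': "continuous_on UNIV F'"
    and "\<mu> > 0" "\<bar>F 0\<bar> > 2 * \<mu>" "\<bar>F 1\<bar> \<le> \<mu>"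
  shows "ennreal \<mu> \<le> (\<integral>\<^sup>+ t. ennreal \<bar>F' t\<bar> * indicator {t. \<mu> < \<bar>F t\<bar> \<and> \<bar>F t\<bar> \<le> 2 * \<mu>} t * indicator {0..1} t \<partial>lborel)"
proof -
  have contF: "continuous_on A F" for A
    using F has_vector_derivative_continuous continuous_at_imp_continuous_on by blast
  have "compact ({0..1} \<inter> {t. 2 * \<mu> \<le> \<bar>F t\<bar>})"
    by (intro compact_Int_closed compact_Icc closed_Collect_le continuous_intros contF)
  moreover have "0 \<in> {0..1} \<inter> {t. 2 * \<mu> \<le> \<bar>F t\<bar>}" using assms by simp
  ultimately obtain t0 where t0: "t0 \<in> {0..1}" "2 * \<mu> \<le> \<bar>F t0\<bar>"
    and t0_max: "\<And>t. t \<in> {0..1} \<Longrightarrow> 2 * \<mu> \<le> \<bar>F t\<bar> \<Longrightarrow> t \<le> t0"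
    using compact_attains_sup[of "{0..1} \<inter> {t. 2 * \<mu> \<le> \<bar>F t\<bar>}"] by blast
  have "compact ({t0..1} \<inter> {t. \<bar>F t\<bar> \<le> \<mu>})"
    by (intro compact_Int_closed compact_Icc closed_Collect_le continuous_intros contF)
  moreover have "1 \<in> {t0..1} \<inter> {t. \<bar>F t\<bar> \<le> \<mu>}" using assms t0 by simp
  ultimately obtain t1 where t1: "t1 \<in> {t0..1}" "\<bar>F t1\<bar> \<le> \<mu>"
    and t1_min: "\<And>t. t \<in> {t0..1} \<Longrightarrow> \<bar>F t\<bar> \<le> \<mu> \<Longrightarrow> t1 \<le> t"
    using compact_attains_inf[of "{t0..1} \<inter> {t. \<bar>F t\<bar> \<le> \<mu>}"] by blast
  have between: "\<mu> < \<bar>F t\<bar> \<and> \<bar>F t\<bar> \<le> 2 * \<mu>" if "t0 < t" "t < t1" for t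
    using t0_max[of t] t1_min[of t] that t0 t1 by fastforce
  have "\<mu> \<le> \<bar>F t1 - F t0\<bar>" using t0 t1 by linarith
  then have "ennreal \<mu> \<le> ennreal \<bar>F t1 - F t0\<bar>" by (rule ennreal_leI)
  also have "\<dots> \<le> (\<integral>\<^sup>+ t. ennreal \<bar>F' t\<bar> * indicator {t0..t1} t \<partial>lborel)"
    using t1 by (intro FTC_abs_le_nn_integral F F') auto
  also have "\<dots> \<le> (\<integral>\<^sup>+ t. ennreal \<bar>F' t\<bar> * indicator {t. \<mu> < \<bar>F t\<bar> \<and> \<bar>F t\<bar> \<le> 2 * \<mu>} t * indicator {0..1} t \<partial>lborel)"
  proof (rule nn_integral_mono_AE)
    \<comment> \<open>The layer inequalities are known only strictly between t0 and t1; the two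
      endpoints form a null set.\<close>
    have "AE t in lborel. t \<noteq> t0" "AE t in lborel. t \<noteq> t1"
      by (auto intro: AE_lborel_singleton)
    then show "AE t in lborel. ennreal \<bar>F' t\<bar> * indicator {t0..t1} t
        \<le> ennreal \<bar>F' t\<bar> * indicator {t. \<mu> < \<bar>F t\<bar> \<and> \<bar>F t\<bar> \<le> 2 * \<mu>} t * indicator {0..1} t"
    proof eventually_elim
      case (elim t)
      show ?case
      proof (cases "t \<in> {t0..t1}")
        case True
        then have "t0 < t" "t < t1" "t \<in> {0..1}" using elim t0 t1 by auto
        then show ?thesis using between[of t] by simp
      qed simp
    qed
  qed
  finally show ?thesis .
qed

text \<open>The radius is chosen so that at least half of every ball \<open>B(x, \<rho>)\<close> lies in \<open>|h| \<le> \<mu>\<close>; a segment from \<open>x\<close> with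
  \<open>|h x| > 2 \<mu>\<close> into that half crosses the layer \<open>\<mu> < |h| \<le> 2 \<mu>\<close>.\<close>

lemma superlevel_measure_le_layer_gradient:
  fixes h :: "'a::euclidean_space \<Rightarrow> real" and h' :: "'a \<Rightarrow> 'a \<Rightarrow> real" and G :: "'a \<Rightarrow> real"
  assumes der: "\<And>x. (h has_derivative h' x) (at x)"
    and cont: "\<And>y. continuous_on UNIV (\<lambda>x. h' x y)"
    and bound: "\<And>x y. \<bar>h' x y\<bar> \<le> G x * norm y"
    and G: "\<And>x. 0 \<le> G x" and [measurable]: "G \<in> borel_measurable borel"
    and \<mu>: "\<mu> > 0" and m: "emeasure lborel {x. \<mu> < \<bar>h x\<bar>} = ennreal m" "0 \<le> m"
  shows "ennreal \<mu> * emeasure lborel {x. 2 * \<mu> < \<bar>h x\<bar>}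
    \<le> ennreal (2 * (2 * m / unit_ball_vol (real DIM('a))) powr (1 / real DIM('a)))
       * (\<integral>\<^sup>+ x. ennreal (G x) * indicator {x. \<mu> < \<bar>h x\<bar> \<and> \<bar>h x\<bar> \<le> 2 * \<mu>} x \<partial>lborel)"
proof (cases "m = 0")
  have conth: "continuous_on UNIV h"
    using der has_derivative_continuous continuous_at_imp_continuous_on by blast
  have [measurable]: "h \<in> borel_measurable borel"
    using conth by (rule borel_measurable_continuous_onI)
  {
    case True
    have "emeasure lborel {x. 2 * \<mu> < \<bar>h x\<bar>} \<le> emeasure lborel {x. \<mu> < \<bar>h x\<bar>}"
      using \<mu> by (intro emeasure_mono) auto
    then show ?thesis using m True by simp
  next
    case False
    then have mpos: "m > 0" using m by simp
    define n where "n = real DIM('a)"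
    define \<omega> where "\<omega> = unit_ball_vol n"
    have n: "n > 0" by (simp add: n_def)
    have \<omega>: "\<omega> > 0" by (simp add: \<omega>_def n_def)
    \<comment> \<open>The radius of a ball whose measure is exactly 2 m, twice that of the
      superlevel set.\<close>
    define \<rho> where "\<rho> = (2 * m / \<omega>) powr (1 / n)"
    have \<rho>: "\<rho> > 0" using mpos \<omega> by (simp add: \<rho>_def)
    have "\<rho> ^ DIM('a) = 2 * m / \<omega>"
      using mpos \<omega> n by (simp add: \<rho>_def powr_realpow[symmetric] powr_powr n_def)
    then have ball: "emeasure lborel (ball (0::'a) \<rho>) = ennreal (2 * m)"
      using \<rho> \<omega> by (simp add: emeasure_ball \<omega>_def[unfolded n_def, symmetric])
    have [measurable]: "ball (0::'a) \<rho> \<in> sets borel" by simp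
    define A where "A = {x. \<mu> < \<bar>h x\<bar> \<and> \<bar>h x\<bar> \<le> 2 * \<mu>}"
    have [measurable]: "A \<in> sets borel" unfolding A_def by measurable
    define g where "g = (\<lambda>x. ennreal (G x) * indicator A x)"
    have [measurable]: "g \<in> borel_measurable borel" unfolding g_def by measurable
    define I where "I = (\<integral>\<^sup>+ x. g x \<partial>lborel)"
    define E where "E = {x. 2 * \<mu> < \<bar>h x\<bar>}"
    have [measurable]: "E \<in> sets borel" unfolding E_def by measurable
    \<comment> \<open>Every translate of the superlevel set has measure m, so it fills at most half
      of the ball, uniformly in x.\<close>
    have half: "ennreal m \<le> emeasure lborel {y. norm y < \<rho> \<and> \<bar>h (x + y)\<bar> \<le> \<mu>}" for x
    proof -
      let ?N = "{y. norm y < \<rho> \<and> \<bar>h (x + y)\<bar> \<le> \<mu>}"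
      have sh: "emeasure lborel {y. \<mu> < \<bar>h (x + y)\<bar>} = ennreal m"
      proof -
        have "emeasure lborel {y. \<mu> < \<bar>h (x + y)\<bar>} = (\<integral>\<^sup>+ y. indicator {x. \<mu> < \<bar>h x\<bar>} (y + x) \<partial>lborel)"
        proof -
          have "(\<integral>\<^sup>+ y. indicator {x. \<mu> < \<bar>h x\<bar>} (y + x) \<partial>lborel)
              = (\<integral>\<^sup>+ y. indicator {y. \<mu> < \<bar>h (x + y)\<bar>} y \<partial>lborel)"
            by (intro nn_integral_cong) (simp add: indicator_def add.commute)
          then show ?thesis by simp
        qed
        also have "\<dots> = (\<integral>\<^sup>+ y. indicator {x. \<mu> < \<bar>h x\<bar>} y \<partial>lborel)"
          by (rule nn_integral_lborel_shift) measurable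
        finally show ?thesis using m by simp
      qed
      have "ennreal (2 * m) \<le> emeasure lborel (?N \<union> {y. \<mu> < \<bar>h (x + y)\<bar>})"
        unfolding ball[symmetric] by (intro emeasure_mono) auto
      also have "\<dots> \<le> emeasure lborel ?N + emeasure lborel {y. \<mu> < \<bar>h (x + y)\<bar>}"
        by (intro emeasure_subadditive) auto
      also have "\<dots> = emeasure lborel ?N + ennreal m" using sh by simp
      finally have *: "ennreal m + ennreal m \<le> emeasure lborel ?N + ennreal m"
        using mpos by (simp add: ennreal_plus[symmetric] del: ennreal_plus)
      then show ?thesis by (simp add: ennreal_add_left_cancel_le add.commute)
    qed
    \<comment> \<open>\<open>K x y\<close> integrates the layer gradient along the segment from x to
      x + y. Its integral over x is \<open>I\<close> for every y, since each t in [0,1] contributes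
      a translate of g.\<close>
    define K where "K = (\<lambda>x y. \<integral>\<^sup>+ t. g (x + t *\<^sub>R y) * indicator {0..1::real} t \<partial>lborel)"
    have cross: "ennreal \<mu> \<le> ennreal \<rho> * K x y" if "x \<in> E" "norm y < \<rho>" "\<bar>h (x + y)\<bar> \<le> \<mu>" for x y
    proof -
      have "ennreal \<mu> \<le> (\<integral>\<^sup>+ t. ennreal \<bar>h' (x + t *\<^sub>R y) y\<bar> *
          indicator {t. \<mu> < \<bar>h (x + t *\<^sub>R y)\<bar> \<and> \<bar>h (x + t *\<^sub>R y)\<bar> \<le> 2 * \<mu>} t * indicator {0..1} t \<partial>lborel)"
      proof (rule level_crossing)
        fix t
        have "((\<lambda>t. x + t *\<^sub>R y) has_derivative (\<lambda>t. t *\<^sub>R y)) (at t)"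
          by (auto intro!: derivative_eq_intros)
        then have "((\<lambda>t. h (x + t *\<^sub>R y)) has_derivative (\<lambda>s. h' (x + t *\<^sub>R y) (s *\<^sub>R y))) (at t)"
          using has_derivative_compose der by blast
        moreover have "h' (x + t *\<^sub>R y) (s *\<^sub>R y) = s *\<^sub>R h' (x + t *\<^sub>R y) y" for s
          using der has_derivative_linear linear_scale by blast
        ultimately show "((\<lambda>t. h (x + t *\<^sub>R y)) has_vector_derivative h' (x + t *\<^sub>R y) y) (at t)"
          by (simp add: has_vector_derivative_def)
      next
        show "continuous_on UNIV (\<lambda>t. h' (x + t *\<^sub>R y) y)"
          by (intro continuous_on_compose2[OF cont] continuous_intros) auto
      qed (use that \<mu> in \<open>auto simp: E_def\<close>)
      also have "\<dots> \<le> (\<integral>\<^sup>+ t. ennreal \<rho> * (g (x + t *\<^sub>R y) * indicator {0..1::real} t) \<partial>lborel)"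
      proof (rule nn_integral_mono)
        fix t
        have "\<bar>h' (x + t *\<^sub>R y) y\<bar> \<le> \<rho> * G (x + t *\<^sub>R y)"
          using bound[of "x + t *\<^sub>R y" y] mult_left_mono[of "norm y" \<rho> "G (x + t *\<^sub>R y)"] G that
          by (smt (verit) mult.commute)
        then have "ennreal \<bar>h' (x + t *\<^sub>R y) y\<bar> \<le> ennreal \<rho> * ennreal (G (x + t *\<^sub>R y))"
          using \<rho> G by (simp add: ennreal_mult[symmetric] ennreal_leI)
        then show "ennreal \<bar>h' (x + t *\<^sub>R y) y\<bar> *
          indicator {t. \<mu> < \<bar>h (x + t *\<^sub>R y)\<bar> \<and> \<bar>h (x + t *\<^sub>R y)\<bar> \<le> 2 * \<mu>} t * indicator {0..1} t
          \<le> ennreal \<rho> * (g (x + t *\<^sub>R y) * indicator {0..1::real} t)"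
          by (auto simp: g_def A_def indicator_def)
      qed
      also have "\<dots> = ennreal \<rho> * K x y"
        unfolding K_def by (rule nn_integral_cmult) measurable
      finally show ?thesis .
    qed
    have Kmeas[measurable]: "(\<lambda>(x, y). K x y) \<in> borel_measurable (borel \<Otimes>\<^sub>M borel)"
      unfolding K_def by measurable
    have swap: "(\<integral>\<^sup>+ x. K x y \<partial>lborel) = I" for y
    proof -
      have "(\<integral>\<^sup>+ x. K x y \<partial>lborel) = (\<integral>\<^sup>+ t. (\<integral>\<^sup>+ x. g (x + t *\<^sub>R y) * indicator {0..1::real} t \<partial>lborel) \<partial>lborel)"
        unfolding K_def by (rule lborel_pair.Fubini'[symmetric]) measurable
      also have "\<dots> = (\<integral>\<^sup>+ t. I * indicator {0..1::real} t \<partial>lborel)"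
        by (simp add: nn_integral_multc nn_integral_lborel_shift I_def)
      also have "\<dots> = I" by (simp add: nn_integral_cmult)
      finally show ?thesis .
    qed
    \<comment> \<open>The pairs (x, y) are counted twice. From below, every x in E admits good y of
      measure at least m; from above, y runs over a ball of measure 2 m. The factor m cancels and 2
      \<rho> remains.\<close>
    have "ennreal m * (ennreal \<mu> * emeasure lborel E) = (\<integral>\<^sup>+ x. ennreal \<mu> * ennreal m * indicator E x \<partial>lborel)"
      by (simp add: nn_integral_cmult ac_simps)
    also have "\<dots> \<le> (\<integral>\<^sup>+ x. (\<integral>\<^sup>+ y. ennreal \<rho> * K x y * indicator (ball 0 \<rho>) y \<partial>lborel) \<partial>lborel)"
    proof (rule nn_integral_mono)
      fix x
      show "ennreal \<mu> * ennreal m * indicator E x \<le> (\<integral>\<^sup>+ y. ennreal \<rho> * K x y * indicator (ball 0 \<rho>) y \<partial>lborel)"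
      proof (cases "x \<in> E")
        case True
        have "ennreal \<mu> * ennreal m \<le> ennreal \<mu> * emeasure lborel {y. norm y < \<rho> \<and> \<bar>h (x + y)\<bar> \<le> \<mu>}"
          using half by (intro mult_left_mono) auto
        also have "\<dots> = (\<integral>\<^sup>+ y. ennreal \<mu> * indicator {y. norm y < \<rho> \<and> \<bar>h (x + y)\<bar> \<le> \<mu>} y \<partial>lborel)"
          by (simp add: nn_integral_cmult)
        also have "\<dots> \<le> (\<integral>\<^sup>+ y. ennreal \<rho> * K x y * indicator (ball 0 \<rho>) y \<partial>lborel)"
          using cross[OF True] by (intro nn_integral_mono) (auto simp: indicator_def)
        finally show ?thesis using True by simp
      qed simp
    qed
    also have "\<dots> = (\<integral>\<^sup>+ y. (\<integral>\<^sup>+ x. ennreal \<rho> * K x y * indicator (ball 0 \<rho>) y \<partial>lborel) \<partial>lborel)"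
      by (rule lborel_pair.Fubini'[symmetric]) measurable
    also have "\<dots> = (\<integral>\<^sup>+ y. ennreal \<rho> * I * indicator (ball (0::'a) \<rho>) y \<partial>lborel)"
    proof -
      have [measurable]: "(\<lambda>x. K x y) \<in> borel_measurable borel" for y
        unfolding K_def by measurable
      show ?thesis by (simp add: nn_integral_multc nn_integral_cmult swap)
    qed
    also have "\<dots> = ennreal \<rho> * I * ennreal (2 * m)"
      by (simp add: nn_integral_cmult ball)
    also have "\<dots> = ennreal m * (ennreal (2 * \<rho>) * I)"
      using mpos \<rho> by (simp add: ennreal_mult ac_simps)
    finally have "ennreal \<mu> * emeasure lborel E \<le> ennreal (2 * \<rho>) * I"
      using mpos by (simp add: ennreal_mult_le_mult_iff)
    then show ?thesis by (simp add: E_def \<rho>_def \<omega>_def n_def I_def g_def A_def)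
  }
qed

subsection \<open>The Gagliardo--Nirenberg inequality\<close>

text \<open>Splitting at G = \<kappa> gives G \<le> \<kappa> + \<kappa>^(1-p) G^p, and integrating
  over A yields Hoelder with constant 2, uniformly down to p = 1. If m or D is 0, the right side is
  0 even for p = 1, because \<open>0 powr 0 = 0\<close>; the left side then vanishes too.\<close>

lemma nn_integral_le_two_Holder:
  fixes G :: "'a \<Rightarrow> real"
  assumes [measurable]: "G \<in> borel_measurable M" "A \<in> sets M" and G: "\<And>x. 0 \<le> G x"
    and p: "p \<ge> 1" and D: "(\<integral>\<^sup>+ x. ennreal (G x powr p) * indicator A x \<partial>M) \<le> ennreal D" "0 \<le> D"
    and m: "emeasure M A \<le> ennreal m" "0 \<le> m"
  shows "(\<integral>\<^sup>+ x. ennreal (G x) * indicator A x \<partial>M) \<le> ennreal (2 * D powr (1 / p) * m powr (1 - 1 / p))"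
proof (cases "m = 0 \<or> D = 0")
  case True
  then show ?thesis
  proof
    assume "m = 0"
    then have "A \<in> null_sets M" using m by (intro null_setsI) auto
    then show ?thesis by (simp add: nn_integral_null_set)
  next
    assume "D = 0"
    then have "AE x in M. ennreal (G x powr p) * indicator A x = 0"
      using D by (subst nn_integral_0_iff_AE[symmetric]) auto
    then have "AE x in M. ennreal (G x) * indicator A x = 0"
      by eventually_elim (auto simp: indicator_def ennreal_eq_0_iff split: if_splits)
    then have "(\<integral>\<^sup>+ x. ennreal (G x) * indicator A x \<partial>M) = 0"
      by (subst nn_integral_0_iff_AE) auto
    then show ?thesis by simp
  qed
next
  case False
  then have pos: "m > 0" "D > 0" using m D by auto
  \<comment> \<open>The level at which the two resulting terms, \<open>\<kappa> * m\<close> and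
    \<open>\<kappa> powr (1 - p) * D\<close>, are equal.\<close>
  define \<kappa> where "\<kappa> = (D / m) powr (1 / p)"
  have \<kappa>: "\<kappa> > 0" using pos by (simp add: \<kappa>_def)
  have pt: "G x \<le> \<kappa> + \<kappa> powr (1 - p) * G x powr p" for x
  proof (cases "G x \<le> \<kappa>")
    case True
    then show ?thesis using \<kappa> by (simp add: add_increasing2)
  next
    case False
    then have "G x > 0" using \<kappa> by simp
    have "G x = G x powr (1 - p) * G x powr p" using \<open>G x > 0\<close> by (simp add: powr_add[symmetric])
    also have "\<dots> \<le> \<kappa> powr (1 - p) * G x powr p"
      using False \<kappa> p by (intro mult_right_mono powr_mono2') auto
    finally show ?thesis using \<kappa> by simp
  qed
  have "(\<integral>\<^sup>+ x. ennreal (G x) * indicator A x \<partial>M)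
     \<le> (\<integral>\<^sup>+ x. ennreal \<kappa> * indicator A x + ennreal (\<kappa> powr (1 - p)) * (ennreal (G x powr p) * indicator A x) \<partial>M)"
  proof (rule nn_integral_mono)
    fix x
    have "ennreal (G x) \<le> ennreal \<kappa> + ennreal (\<kappa> powr (1 - p)) * ennreal (G x powr p)"
      using pt[of x] \<kappa> by (simp add: ennreal_mult[symmetric] ennreal_plus[symmetric] ennreal_leI del: ennreal_plus)
    then show "ennreal (G x) * indicator A x \<le> ennreal \<kappa> * indicator A x + ennreal (\<kappa> powr (1 - p)) * (ennreal (G x powr p) * indicator A x)"
      by (auto simp: indicator_def)
  qed
  also have "\<dots> = ennreal \<kappa> * emeasure M A + ennreal (\<kappa> powr (1 - p)) * (\<integral>\<^sup>+ x. ennreal (G x powr p) * indicator A x \<partial>M)"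
    by (subst nn_integral_add) (auto simp: nn_integral_cmult)
  also have "\<dots> \<le> ennreal \<kappa> * ennreal m + ennreal (\<kappa> powr (1 - p)) * ennreal D"
    using m D by (intro add_mono mult_left_mono) auto
  also have "\<dots> = ennreal (\<kappa> * m + \<kappa> powr (1 - p) * D)"
    using \<kappa> pos by (simp add: ennreal_mult)
  also have "\<kappa> * m = D powr (1 / p) * m powr (1 - 1 / p)"
    using pos by (simp add: \<kappa>_def powr_divide powr_diff field_simps)
  also have "\<kappa> powr (1 - p) * D = D powr (1 / p) * m powr (1 - 1 / p)"
  proof -
    have e: "(1 - p) / p = 1 / p - 1" using p by (simp add: field_simps)
    have "\<kappa> powr (1 - p) = D powr (1/p - 1) / m powr (1/p - 1)"
      using pos by (simp add: \<kappa>_def powr_powr powr_divide e)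
    also have "\<dots> * D = D powr (1 / p) * m powr (1 - 1 / p)"
      using pos by (simp add: powr_diff)
    finally show ?thesis .
  qed
  finally show ?thesis by (simp add: algebra_simps)
qed

text \<open>Here m j stands for the measure of a superlevel set and D j for the gradient energy of
  its layer. The recursion \<open>step\<close> is used to the power lam and plain monotonicity of m
  to the power 1 - lam; Hoelder over j then splits the product among the sums bounded by P, U and Q
  itself. The choice of lam meets two constraints: lam \<le> 1 for monotonicity to enter with a
  nonnegative power, and lam \<le> \<theta> q for the exponent of Q to be nonnegative.\<close>

lemma discrete_gagliardo_nirenberg:
  fixes m D :: "int \<Rightarrow> real"
  assumes nonneg: "\<And>j. 0 \<le> m j" "\<And>j. 0 \<le> D j" and mono: "\<And>j. m (j + 1) \<le> m j"
    and p: "p \<ge> 1" and u: "u > 0" and q: "q > 0" and \<theta>: "0 < \<theta>" "\<theta> \<le> 1" and d: "0 \<le> d" and K: "0 \<le> K"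
    and balance: "1 / q = \<theta> * (1 / p - d) + (1 - \<theta>) / u"
    and step: "\<And>j. m (j + 1) \<le> K * 2 powr (- real_of_int j) * D j powr (1 / p) * m j powr (1 - (1 / p - d))"
    and X: "(\<integral>\<^sup>+ j. ennreal (D j) \<partial>count_space UNIV) \<le> ennreal (P powr p)" "0 \<le> P"
    and Y: "(\<integral>\<^sup>+ j. ennreal (2 powr (real_of_int j * u) * m j) \<partial>count_space UNIV) \<le> ennreal (L * U powr u)" "0 \<le> L" "0 \<le> U"
    and Q: "(\<integral>\<^sup>+ j. ennreal (2 powr (real_of_int j * q) * m j) \<partial>count_space UNIV) = ennreal Q" "0 \<le> Q"
    and lam: "lam = min 1 (\<theta> * q)"
  shows "Q \<le> (2 powr q * K powr lam * L powr ((1 - \<theta>) * lam / (u * \<theta>))) powr (\<theta> * q / lam)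
      * P powr (\<theta> * q) * U powr ((1 - \<theta>) * q)"
proof (cases "Q = 0")
  case False
  then have Qpos: "Q > 0" using Q by simp
  \<comment> \<open>x and y, the shares of the U-sum and the Q-sum, solve two linear equations:
    \<open>e1\<close> matches the powers of 2^j and \<open>e2\<close> the powers of m j. That the
    D-share is then lam / p is where \<open>balance\<close> enters.\<close>
  define x where "x = (1 - \<theta>) * lam / (u * \<theta>)"
  define y where "y = 1 - lam / (\<theta> * q)"
  have lam_pos: "lam > 0" "lam \<le> 1" "lam \<le> \<theta> * q" using \<theta> q by (auto simp: lam)
  have x: "x \<ge> 0" using \<theta> u lam_pos by (simp add: x_def)
  have y: "y \<ge> 0" "y < 1" using \<theta> q lam_pos by (auto simp: y_def)
  have e1: "u * x + q * y = q - lam"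
    using u q \<theta> by (simp add: x_def y_def field_simps)
  have e2: "x + y = 1 - lam * (1 / p - d)"
  proof -
    have "x + y = 1 - (lam / \<theta>) * (1 / q - (1 - \<theta>) / u)"
      using u q \<theta> by (simp add: x_def y_def field_simps)
    also have "1 / q - (1 - \<theta>) / u = \<theta> * (1 / p - d)" using balance by simp
    finally show ?thesis using \<theta> by simp
  qed
  have termwise: "2 powr (real_of_int j * q) * m (j + 1) \<le> K powr lam *
      (D j powr (lam / p) * (2 powr (real_of_int j * u) * m j) powr x * (2 powr (real_of_int j * q) * m j) powr y)" for j
  proof (cases "m (j + 1) = 0")
    case True then show ?thesis by simp
  next
    case False
    then have pos: "m (j + 1) > 0" "m j > 0" using nonneg[of j] nonneg[of "j+1"] mono[of j] by auto
    have "m (j + 1) = m (j + 1) powr lam * m (j + 1) powr (1 - lam)"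
      using pos by (simp add: powr_add[symmetric])
    also have "\<dots> \<le> (K * 2 powr (- real_of_int j) * D j powr (1 / p) * m j powr (1 - (1 / p - d))) powr lam * m j powr (1 - lam)"
      using step[of j] mono[of j] pos lam_pos by (intro mult_mono powr_mono2) auto
    also have "\<dots> = K powr lam * 2 powr (- real_of_int j * lam) * D j powr (lam / p) * (m j powr ((1 - (1 / p - d)) * lam) * m j powr (1 - lam))"
      using K nonneg by (simp add: powr_mult powr_powr)
    also have "m j powr ((1 - (1 / p - d)) * lam) * m j powr (1 - lam) = m j powr (x + y)"
      unfolding e2 by (simp add: powr_add[symmetric] algebra_simps)
    finally have "2 powr (real_of_int j * q) * m (j + 1)
        \<le> 2 powr (real_of_int j * q) * (K powr lam * 2 powr (- real_of_int j * lam) * D j powr (lam / p) * m j powr (x + y))"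
      by (intro mult_left_mono) auto
    also have "\<dots> = K powr lam * (D j powr (lam / p) * m j powr (x + y) * (2 powr (real_of_int j * q) * 2 powr (- real_of_int j * lam)))"
      by (simp only: mult_ac)
    also have "2 powr (real_of_int j * q) * 2 powr (- real_of_int j * lam) = 2 powr (real_of_int j * (u * x + q * y))"
      unfolding e1 by (simp add: powr_add[symmetric] algebra_simps)
    also have "D j powr (lam / p) * m j powr (x + y) * 2 powr (real_of_int j * (u * x + q * y))
       = D j powr (lam / p) * (2 powr (real_of_int j * u) * m j) powr x * (2 powr (real_of_int j * q) * m j) powr y"
      using pos by (simp add: powr_mult powr_powr powr_add distrib_left mult_ac)
    finally show ?thesis .
  qed
  \<comment> \<open>The recursion bounds m at level j + 1, while the weights belong to level j;
    reindexing costs 2^(-q).\<close>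
  have shift: "ennreal (2 powr (- q) * Q) = (\<integral>\<^sup>+ j. ennreal (2 powr (real_of_int j * q) * m (j + 1)) \<partial>count_space UNIV)"
  proof -
    have "ennreal Q = (\<integral>\<^sup>+ j. ennreal (2 powr (real_of_int (j + 1) * q) * m (j + 1)) \<partial>count_space UNIV)"
      unfolding Q(1)[symmetric]
      by (rule nn_integral_bij_count_space[symmetric, where g="\<lambda>j. j + 1"])
        (auto intro!: bij_betw_byWitness[where f'="\<lambda>j. j - 1"])
    then have "ennreal (2 powr (- q)) * ennreal Q = (\<integral>\<^sup>+ j. ennreal (2 powr (- q)) * ennreal (2 powr (real_of_int (j + 1) * q) * m (j + 1)) \<partial>count_space UNIV)"
      by (simp add: nn_integral_cmult)
    also have "\<dots> = (\<integral>\<^sup>+ j. ennreal (2 powr (real_of_int j * q) * m (j + 1)) \<partial>count_space UNIV)"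
    proof (rule nn_integral_cong)
      fix j
      have "2 powr (- q) * 2 powr (real_of_int (j + 1) * q) = 2 powr (real_of_int j * q)"
        by (simp add: powr_add[symmetric] algebra_simps)
      then show "ennreal (2 powr (- q)) * ennreal (2 powr (real_of_int (j + 1) * q) * m (j + 1))
          = ennreal (2 powr (real_of_int j * q) * m (j + 1))"
        using nonneg by (metis ennreal_mult' mult.assoc powr_ge_zero)
    qed
    finally show ?thesis using Q by (simp add: ennreal_mult)
  qed
  have "ennreal (2 powr (- q) * Q) \<le> (\<integral>\<^sup>+ j. ennreal (K powr lam) * ennreal (D j powr (lam / p) *
      (2 powr (real_of_int j * u) * m j) powr x * (2 powr (real_of_int j * q) * m j) powr y) \<partial>count_space UNIV)"
    unfolding shift using termwise
    by (intro nn_integral_mono) (simp add: ennreal_mult[symmetric] ennreal_leI)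
  also have "\<dots> = ennreal (K powr lam) * (\<integral>\<^sup>+ j. ennreal (D j powr (lam / p) *
      (2 powr (real_of_int j * u) * m j) powr x * (2 powr (real_of_int j * q) * m j) powr y) \<partial>count_space UNIV)"
    by (simp add: nn_integral_cmult)
  also have "\<dots> \<le> ennreal (K powr lam) * ennreal ((P powr p) powr (lam / p) * (L * U powr u) powr x * Q powr y)"
  proof (intro mult_left_mono nn_integral_count_space_Holder3)
    \<comment> \<open>The exponents exceed a total of 1 by lam * d, so ordinary Hoelder does not fit
      unless d = 0; the superlinear version on sequences does.\<close>
    have "lam / p + x + y = 1 + lam * d" using e2 by (simp add: algebra_simps)
    then show "1 \<le> lam / p + x + y" using lam_pos d by simp
  qed (use nonneg X Y Q lam_pos x y p in auto)
  finally have "2 powr (- q) * Q \<le> K powr lam * ((P powr p) powr (lam / p) * (L * U powr u) powr x * Q powr y)"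
    by (simp add: ennreal_mult[symmetric])
  also have "(P powr p) powr (lam / p) = P powr lam" using p by (simp add: powr_powr)
  also have "(L * U powr u) powr x = L powr x * U powr (u * x)" using Y by (simp add: powr_mult powr_powr)
  finally have "2 powr (- q) * Q \<le> K powr lam * (P powr lam * (L powr x * U powr (u * x)) * Q powr y)" .
  then have "Q \<le> 2 powr q * (K powr lam * (P powr lam * (L powr x * U powr (u * x)) * Q powr y))"
    by (simp add: powr_minus field_simps)
  also have "\<dots> = (2 powr q * K powr lam * L powr x * P powr lam * U powr (u * x)) * Q powr y"
    by (simp only: mult_ac)
  \<comment> \<open>Absorption: Q is a positive real and y < 1, so Q powr y moves to the left. Since
    1 - y = lam / (\<theta> q), raising to the power \<theta> q / lam isolates Q.\<close>
  finally have "Q powr (1 - y) \<le> 2 powr q * K powr lam * L powr x * P powr lam * U powr (u * x)"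
    using Qpos by (simp add: powr_diff pos_divide_le_eq)
  then have "(Q powr (1 - y)) powr (\<theta> * q / lam) \<le> (2 powr q * K powr lam * L powr x * P powr lam * U powr (u * x)) powr (\<theta> * q / lam)"
    using \<theta> q lam_pos by (intro powr_mono2) auto
  also have "(Q powr (1 - y)) powr (\<theta> * q / lam) = Q"
    using Qpos lam_pos \<theta> q by (simp add: powr_powr y_def)
  also have "(2 powr q * K powr lam * L powr x * P powr lam * U powr (u * x)) powr (\<theta> * q / lam)
     = (2 powr q * K powr lam * L powr x) powr (\<theta> * q / lam) * P powr (lam * (\<theta> * q / lam)) * U powr (u * x * (\<theta> * q / lam))"
    by (simp add: powr_mult powr_powr)
  also have "lam * (\<theta> * q / lam) = \<theta> * q" using lam_pos by simp
  also have "u * x * (\<theta> * q / lam) = (1 - \<theta>) * q" using lam_pos u \<theta> by (simp add: x_def)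
  finally show ?thesis by (simp add: x_def)
qed (use assms in simp)

section \<open>Superlevel sets and layers at dyadic heights\<close>

lemma dyadic_layer_cake:
  fixes h :: "'a::euclidean_space \<Rightarrow> real" and w :: "int \<Rightarrow> ennreal"
  assumes [measurable]: "h \<in> borel_measurable borel"
  shows "(\<integral>\<^sup>+ j. w j * emeasure lborel {x. 2 powr (real_of_int j) < \<bar>h x\<bar>} \<partial>count_space UNIV)
    = (\<integral>\<^sup>+ x. (\<integral>\<^sup>+ j. w j * indicator {j. 2 powr (real_of_int j) < \<bar>h x\<bar>} j \<partial>count_space UNIV) \<partial>lborel)"
proof -
  have "(\<integral>\<^sup>+ x. (\<integral>\<^sup>+ j. w j * indicator {j. 2 powr (real_of_int j) < \<bar>h x\<bar>} j \<partial>count_space UNIV) \<partial>lborel)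
    = (\<integral>\<^sup>+ x. (\<integral>\<^sup>+ j. w j * indicator {x. 2 powr (real_of_int j) < \<bar>h x\<bar>} x \<partial>count_space UNIV) \<partial>lborel)"
    by (intro nn_integral_cong) (simp add: indicator_def)
  also have "\<dots> = (\<integral>\<^sup>+ j. (\<integral>\<^sup>+ x. w j * indicator {x. 2 powr (real_of_int j) < \<bar>h x\<bar>} x \<partial>lborel) \<partial>count_space UNIV)"
    by (rule nn_integral_count_space_nn_integral) auto
  also have "\<dots> = (\<integral>\<^sup>+ j. w j * emeasure lborel {x. 2 powr (real_of_int j) < \<bar>h x\<bar>} \<partial>count_space UNIV)"
    by (intro nn_integral_cong) (simp add: nn_integral_cmult)
  finally show ?thesis by simp
qed

text \<open>Two levels whose layers both contain t would each be less than the other plus one, so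
  they coincide.\<close>

lemma dyadic_layers_overlap:
  fixes t :: real
  shows "(\<integral>\<^sup>+ j. indicator {j. 2 powr (real_of_int j) < t \<and> t \<le> 2 * 2 powr (real_of_int j)} j \<partial>count_space (UNIV::int set)) \<le> 1"
proof -
  let ?S = "{j::int. 2 powr (real_of_int j) < t \<and> t \<le> 2 * 2 powr (real_of_int j)}"
  have le: "i \<le> j" if "i \<in> ?S" "j \<in> ?S" for i j
  proof -
    have "2 powr (real_of_int i) < 2 * 2 powr (real_of_int j)" using that by auto
    also have "\<dots> = 2 powr (real_of_int j + 1)" by (simp add: powr_add)
    finally have "real_of_int i < real_of_int j + 1" by (subst (asm) powr_less_cancel_iff) auto
    then show ?thesis by linarith
  qed
  have "?S = {} \<or> (\<exists>i. ?S = {i})" using le by (blast intro: antisym)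
  then have "emeasure (count_space UNIV) ?S \<le> 1"
  proof
    assume "\<exists>i. ?S = {i}"
    then obtain i where "?S = {i}" by blast
    then show ?thesis by (simp only:) simp
  qed (simp only: emeasure_empty zero_le)
  then show ?thesis by (subst nn_integral_indicator) auto
qed

text \<open>Truncation yields the factor \<open>m j powr (1 / n)\<close>. It is written as
  \<open>m j powr ((1 - \<delta>) / n) * m j powr (\<delta> / n)\<close>, and the first part is
  bounded by the volume V of the supporting ball. This gives the discrete recursion with d =
  \<delta> / n and a constant depending on R but not on h. G, P and U are majorants rather than
  exact quantities, so that the gradient of a product can be estimated crudely before the inequality
  is applied.\<close>

theorem gagliardo_nirenberg_bounded_support:
  fixes R p q u \<theta> \<delta> :: real
  assumes p: "p \<ge> 1" and u: "u > 0" and q: "q > 0" and \<theta>: "0 < \<theta>" "\<theta> \<le> 1" and \<delta>: "0 \<le> \<delta>" "\<delta> \<le> 1" and R: "R > 0"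
    and balance: "1 / q = \<theta> * (1 / p - \<delta> / real DIM('a::euclidean_space)) + (1 - \<theta>) / u"
  shows "\<exists>C\<ge>0. \<forall>(h :: 'a \<Rightarrow> real) h' G P U. (\<forall>x. (h has_derivative h' x) (at x)) \<longrightarrow>
     (\<forall>y. continuous_on UNIV (\<lambda>x. h' x y)) \<longrightarrow> (\<forall>x y. \<bar>h' x y\<bar> \<le> G x * norm y) \<longrightarrow> (\<forall>x. 0 \<le> G x) \<longrightarrow>
     G \<in> borel_measurable borel \<longrightarrow> (\<forall>x. R \<le> norm x \<longrightarrow> h x = 0) \<longrightarrow> 0 \<le> P \<longrightarrow> 0 \<le> U \<longrightarrow>
     (\<integral>\<^sup>+ x. ennreal (G x powr p) \<partial>lborel) \<le> ennreal (P powr p) \<longrightarrow>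
     (\<integral>\<^sup>+ x. ennreal (\<bar>h x\<bar> powr u) \<partial>lborel) \<le> ennreal (U powr u) \<longrightarrow>
     (\<integral>\<^sup>+ x. ennreal (\<bar>h x\<bar> powr q) \<partial>lborel) \<le> ennreal (C * P powr (\<theta> * q) * U powr ((1 - \<theta>) * q))"
proof -
  define n where "n = real DIM('a)"
  have n: "n > 0" by (simp add: n_def)
  define \<omega> where "\<omega> = unit_ball_vol n"
  have \<omega>: "\<omega> > 0" by (simp add: \<omega>_def n_def)
  define V where "V = \<omega> * R ^ DIM('a)"
  have V: "V > 0" using \<omega> R by (simp add: V_def)
  \<comment> \<open>4 is the 2 of the radius estimate times the 2 of the Hoelder estimate; (2 /
    \<omega>)^(1/n) comes from the radius, and the power of V from giving up (1 - \<delta>) /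
    n.\<close>
  define K where "K = 4 * (2 / \<omega>) powr (1 / n) * V powr ((1 - \<delta>) / n)"
  have K: "K \<ge> 0" by (simp add: K_def)
  define L where "L = 1 / (1 - 2 powr (- u))"
  have L: "L \<ge> 0" using u powr_less_one[of 2 "-u"] by (simp add: L_def)
  define lam where "lam = min 1 (\<theta> * q)"
  define C0 where "C0 = (2 powr q * K powr lam * L powr ((1 - \<theta>) * lam / (u * \<theta>))) powr (\<theta> * q / lam)"
  show ?thesis
  proof (intro exI[of _ "2 powr q * C0"] conjI allI impI)
    show "0 \<le> 2 powr q * C0" by (simp add: C0_def)
    fix h :: "'a \<Rightarrow> real" and h' :: "'a \<Rightarrow> 'a \<Rightarrow> real" and G :: "'a \<Rightarrow> real" and P U :: real
    assume der: "\<forall>x. (h has_derivative h' x) (at x)" and cont: "\<forall>y. continuous_on UNIV (\<lambda>x. h' x y)"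
      and bound: "\<forall>x y. \<bar>h' x y\<bar> \<le> G x * norm y" and G: "\<forall>x. 0 \<le> G x"
      and [measurable]: "G \<in> borel_measurable borel" and supp: "\<forall>x. R \<le> norm x \<longrightarrow> h x = 0"
      and P: "0 \<le> P" and U: "0 \<le> U"
      and GP: "(\<integral>\<^sup>+ x. ennreal (G x powr p) \<partial>lborel) \<le> ennreal (P powr p)"
      and hU: "(\<integral>\<^sup>+ x. ennreal (\<bar>h x\<bar> powr u) \<partial>lborel) \<le> ennreal (U powr u)"
    have conth: "continuous_on A h" for A
      using der has_derivative_continuous continuous_at_imp_continuous_on by blast
    have [measurable]: "h \<in> borel_measurable borel"
      using conth by (rule borel_measurable_continuous_onI)
    have emV: "emeasure lborel (ball (0::'a) R) = ennreal V"
      using R by (simp add: emeasure_ball V_def \<omega>_def n_def)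
    define E where "E j = {x. 2 powr (real_of_int j) < \<bar>h x\<bar>}" for j
    have E[measurable]: "E j \<in> sets borel" for j unfolding E_def by measurable
    have EV: "emeasure lborel (E j) \<le> ennreal V" for j
      unfolding emV[symmetric] E_def using supp by (intro emeasure_mono) (auto simp: not_le[symmetric])
    define m where "m j = enn2real (emeasure lborel (E j))" for j
    have m: "emeasure lborel (E j) = ennreal (m j)" "0 \<le> m j" "m j \<le> V" for j
    proof -
      show *: "emeasure lborel (E j) = ennreal (m j)"
        using EV[of j] unfolding m_def by (metis ennreal_enn2real ennreal_less_top le_less_trans)
      show "0 \<le> m j" by (simp add: m_def)
      show "m j \<le> V" using EV[of j] V unfolding * by (simp add: ennreal_le_iff)
    qed
    have mono: "m (j + 1) \<le> m j" for j
    proof -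
      have "2 powr real_of_int j \<le> 2 powr real_of_int (j + 1)" by simp
      then have "emeasure lborel (E (j + 1)) \<le> emeasure lborel (E j)"
        by (intro emeasure_mono) (auto simp: E_def simp del: powr_le_cancel_iff)
      then show ?thesis using m by (simp add: ennreal_le_iff)
    qed
    define A where "A j = {x. 2 powr (real_of_int j) < \<bar>h x\<bar> \<and> \<bar>h x\<bar> \<le> 2 * 2 powr (real_of_int j)}" for j
    have A[measurable]: "A j \<in> sets borel" for j unfolding A_def by measurable
    define D where "D j = enn2real (\<integral>\<^sup>+ x. ennreal (G x powr p) * indicator (A j) x \<partial>lborel)" for j
    have D: "(\<integral>\<^sup>+ x. ennreal (G x powr p) * indicator (A j) x \<partial>lborel) = ennreal (D j)" "0 \<le> D j" for j
    proof -
      have "(\<integral>\<^sup>+ x. ennreal (G x powr p) * indicator (A j) x \<partial>lborel) \<le> (\<integral>\<^sup>+ x. ennreal (G x powr p) \<partial>lborel)"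
        by (intro nn_integral_mono) (auto simp: indicator_def)
      also have "\<dots> < top" using GP by (simp add: le_less_trans)
      finally show "(\<integral>\<^sup>+ x. ennreal (G x powr p) * indicator (A j) x \<partial>lborel) = ennreal (D j)"
        by (simp add: D_def)
    qed (simp add: D_def)
    have step: "m (j + 1) \<le> K * 2 powr (- real_of_int j) * D j powr (1 / p) * m j powr (1 - (1 / p - \<delta> / n))" for j
    proof (cases "m j = 0")
      case True
      then show ?thesis using mono[of j] by simp
    next
      case False
      then have mj: "m j > 0" using m(2)[of j] by simp
      have two: "2 powr real_of_int (j + 1) = 2 * 2 powr real_of_int j" by (simp add: powr_add)
      have "ennreal (2 powr (real_of_int j)) * emeasure lborel {x. 2 * 2 powr (real_of_int j) < \<bar>h x\<bar>}
        \<le> ennreal (2 * (2 * m j / unit_ball_vol (real DIM('a))) powr (1 / real DIM('a)))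
           * (\<integral>\<^sup>+ x. ennreal (G x) * indicator {x. 2 powr (real_of_int j) < \<bar>h x\<bar> \<and> \<bar>h x\<bar> \<le> 2 * 2 powr (real_of_int j)} x \<partial>lborel)"
        using der cont bound G m(1,2)[of j] by (intro superlevel_measure_le_layer_gradient[where h'=h']) (auto simp: E_def)
      also have "{x. 2 * 2 powr (real_of_int j) < \<bar>h x\<bar>} = E (j + 1)" unfolding E_def two ..
      also have "(\<integral>\<^sup>+ x. ennreal (G x) * indicator {x. 2 powr (real_of_int j) < \<bar>h x\<bar> \<and> \<bar>h x\<bar> \<le> 2 * 2 powr (real_of_int j)} x \<partial>lborel)
          \<le> ennreal (2 * D j powr (1 / p) * m j powr (1 - 1 / p))"
      proof (fold A_def, rule nn_integral_le_two_Holder)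
        have "emeasure lborel (A j) \<le> emeasure lborel (E j)"
          by (intro emeasure_mono) (auto simp: A_def E_def)
        then show "emeasure lborel (A j) \<le> ennreal (m j)" by (simp add: m)
      qed (use G D p m in auto)
      finally have "ennreal (2 powr (real_of_int j)) * ennreal (m (j + 1))
        \<le> ennreal (2 * (2 * m j / \<omega>) powr (1 / n)) * ennreal (2 * D j powr (1 / p) * m j powr (1 - 1 / p))"
        by (simp add: m mult_left_mono n_def \<omega>_def)
      then have "2 powr (real_of_int j) * m (j + 1) \<le> 2 * (2 * m j / \<omega>) powr (1 / n) * (2 * D j powr (1 / p) * m j powr (1 - 1 / p))"
        using m by (simp add: ennreal_mult[symmetric] ennreal_le_iff)
      also have "(2 * m j / \<omega>) powr (1 / n) = (2 / \<omega>) powr (1 / n) * (m j powr ((1 - \<delta>) / n) * m j powr (\<delta> / n))"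
      proof -
        have "(2 * m j / \<omega>) powr (1 / n) = (2 / \<omega> * m j) powr (1 / n)" by simp
        also have "\<dots> = (2 / \<omega>) powr (1 / n) * m j powr (1 / n)" using \<omega> mj by (subst powr_mult) auto
        also have "m j powr (1 / n) = m j powr ((1 - \<delta>) / n) * m j powr (\<delta> / n)"
          using mj by (simp add: powr_add[symmetric] add_divide_distrib[symmetric])
        finally show ?thesis .
      qed
      also have "2 * ((2 / \<omega>) powr (1 / n) * (m j powr ((1 - \<delta>) / n) * m j powr (\<delta> / n))) * (2 * D j powr (1 / p) * m j powr (1 - 1 / p))
         \<le> 2 * ((2 / \<omega>) powr (1 / n) * (V powr ((1 - \<delta>) / n) * m j powr (\<delta> / n))) * (2 * D j powr (1 / p) * m j powr (1 - 1 / p))"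
        using m(3)[of j] mj \<delta> n by (intro mult_right_mono mult_left_mono powr_mono2) auto
      also have "\<dots> = K * D j powr (1 / p) * (m j powr (\<delta> / n) * m j powr (1 - 1 / p))"
        unfolding K_def by (simp add: mult_ac)
      also have "m j powr (\<delta> / n) * m j powr (1 - 1 / p) = m j powr (1 - (1 / p - \<delta> / n))"
        using mj by (simp add: powr_add[symmetric] algebra_simps)
      finally show ?thesis by (simp add: powr_minus field_simps)
    qed
    have X: "(\<integral>\<^sup>+ j. ennreal (D j) \<partial>count_space UNIV) \<le> ennreal (P powr p)"
    proof -
      have "(\<integral>\<^sup>+ j. ennreal (D j) \<partial>count_space UNIV)
         = (\<integral>\<^sup>+ x. (\<integral>\<^sup>+ j. ennreal (G x powr p) * indicator (A j) x \<partial>count_space UNIV) \<partial>lborel)"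
        unfolding D(1)[symmetric] by (rule nn_integral_count_space_nn_integral[symmetric]) auto
      also have "\<dots> \<le> (\<integral>\<^sup>+ x. ennreal (G x powr p) \<partial>lborel)"
      proof (rule nn_integral_mono)
        fix x
        have "(\<integral>\<^sup>+ j. indicator (A j) x \<partial>count_space UNIV)
           = (\<integral>\<^sup>+ j. indicator {j. 2 powr (real_of_int j) < \<bar>h x\<bar> \<and> \<bar>h x\<bar> \<le> 2 * 2 powr (real_of_int j)} j \<partial>count_space UNIV)"
          by (intro nn_integral_cong) (simp add: A_def indicator_def)
        also have "\<dots> \<le> 1" by (rule dyadic_layers_overlap)
        finally show "(\<integral>\<^sup>+ j. ennreal (G x powr p) * indicator (A j) x \<partial>count_space UNIV) \<le> ennreal (G x powr p)"
          using mult_left_mono[of "\<integral>\<^sup>+ j. indicator (A j) x \<partial>count_space UNIV" 1 "ennreal (G x powr p)"]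
          by (simp add: nn_integral_cmult)
      qed
      finally show ?thesis using GP by simp
    qed
    have layers: "(\<integral>\<^sup>+ j. ennreal (2 powr (real_of_int j * a) * m j) \<partial>count_space UNIV)
       = (\<integral>\<^sup>+ x. (\<integral>\<^sup>+ j. ennreal (2 powr (real_of_int j * a)) * indicator {j. 2 powr (real_of_int j) < \<bar>h x\<bar>} j \<partial>count_space UNIV) \<partial>lborel)" for a
      by (subst dyadic_layer_cake[symmetric]) (auto simp: ennreal_mult m E_def[symmetric])
    have layers_le: "(\<integral>\<^sup>+ j. ennreal (2 powr (real_of_int j * a) * m j) \<partial>count_space UNIV)
       \<le> ennreal (1 / (1 - 2 powr (- a))) * (\<integral>\<^sup>+ x. ennreal (\<bar>h x\<bar> powr a) \<partial>lborel)" if "a > 0" for a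
    proof -
      have "2 powr (- a) \<le> 1" using powr_less_one[of 2 "-a"] that by simp
      then show ?thesis
        unfolding layers using dyadic_sum_upper[OF that abs_ge_zero]
        by (subst nn_integral_cmult[symmetric]) (auto intro!: nn_integral_mono simp: ennreal_mult[symmetric])
    qed
    have Y: "(\<integral>\<^sup>+ j. ennreal (2 powr (real_of_int j * u) * m j) \<partial>count_space UNIV) \<le> ennreal (L * U powr u)"
    proof -
      have "(\<integral>\<^sup>+ j. ennreal (2 powr (real_of_int j * u) * m j) \<partial>count_space UNIV) \<le> ennreal L * ennreal (U powr u)"
        using layers_le[OF u] hU unfolding L_def by (meson mult_left_mono order_trans zero_le)
      then show ?thesis using L by (simp add: ennreal_mult)
    qed
    \<comment> \<open>Finiteness makes the absorption legitimate. The bound B for |h| is purely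
      qualitative and does not enter the final constant.\<close>
    have fin: "(\<integral>\<^sup>+ j. ennreal (2 powr (real_of_int j * q) * m j) \<partial>count_space UNIV) < top"
    proof -
      have "bounded (h ` cball 0 R)" using conth by (intro compact_imp_bounded compact_continuous_image) auto
      then obtain B where B: "\<And>x. x \<in> cball 0 R \<Longrightarrow> \<bar>h x\<bar> \<le> B" unfolding bounded_iff by (metis imageI real_norm_def)
      have "(\<integral>\<^sup>+ x. ennreal (\<bar>h x\<bar> powr q) \<partial>lborel) \<le> (\<integral>\<^sup>+ x. ennreal (B powr q) * indicator (ball (0::'a) R) x \<partial>lborel)"
      proof (rule nn_integral_mono)
        fix x
        show "ennreal (\<bar>h x\<bar> powr q) \<le> ennreal (B powr q) * indicator (ball (0::'a) R) x"
          using B[of x] supp q by (cases "R \<le> norm x") (auto intro!: ennreal_leI powr_mono2)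
      qed
      also have "\<dots> = ennreal (B powr q) * ennreal V" by (subst nn_integral_cmult_indicator) (simp_all add: emV)
      also have "\<dots> < top" by (simp add: ennreal_mult_less_top)
      finally show ?thesis
        using layers_le[OF q] by (simp add: ennreal_mult_less_top le_less_trans)
    qed
    define Q where "Q = enn2real (\<integral>\<^sup>+ j. ennreal (2 powr (real_of_int j * q) * m j) \<partial>count_space UNIV)"
    have Q: "(\<integral>\<^sup>+ j. ennreal (2 powr (real_of_int j * q) * m j) \<partial>count_space UNIV) = ennreal Q" "0 \<le> Q"
      unfolding Q_def using fin by (simp_all only: ennreal_enn2real enn2real_nonneg)
    have "Q \<le> C0 * P powr (\<theta> * q) * U powr ((1 - \<theta>) * q)"
      unfolding C0_def
    proof (rule discrete_gagliardo_nirenberg[OF m(2) D(2) mono p u q \<theta> _ K _ step X P Y L U Q lam_def])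
      show "0 \<le> \<delta> / n" using \<delta> n by simp
      show "1 / q = \<theta> * (1 / p - \<delta> / n) + (1 - \<theta>) / u" using balance by (simp add: n_def)
    qed
    then have "2 powr q * Q \<le> 2 powr q * C0 * P powr (\<theta> * q) * U powr ((1 - \<theta>) * q)"
      by (simp add: mult.assoc)
    moreover have "(\<integral>\<^sup>+ x. ennreal (\<bar>h x\<bar> powr q) \<partial>lborel) \<le> ennreal (2 powr q * Q)"
    proof -
      \<comment> \<open>The way back from level sets to the integral costs the factor 2^q of the
        dyadic lower bound.\<close>
      have "(\<integral>\<^sup>+ x. ennreal (\<bar>h x\<bar> powr q) \<partial>lborel) \<le> (\<integral>\<^sup>+ x. ennreal (2 powr q) *
          (\<integral>\<^sup>+ j. ennreal (2 powr (real_of_int j * q)) * indicator {j. 2 powr (real_of_int j) < \<bar>h x\<bar>} j \<partial>count_space UNIV) \<partial>lborel)"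
        by (intro nn_integral_mono dyadic_sum_lower q) auto
      also have "\<dots> = (\<integral>\<^sup>+ x. (\<integral>\<^sup>+ j. ennreal (2 powr q) * ennreal (2 powr (real_of_int j * q))
          * indicator {j. 2 powr (real_of_int j) < \<bar>h x\<bar>} j \<partial>count_space UNIV) \<partial>lborel)"
        by (simp add: nn_integral_cmult mult.assoc)
      also have "\<dots> = (\<integral>\<^sup>+ j. ennreal (2 powr q) * ennreal (2 powr (real_of_int j * q) * m j) \<partial>count_space UNIV)"
        by (subst dyadic_layer_cake[symmetric]) (auto simp: ennreal_mult m E_def[symmetric] mult.assoc)
      also have "\<dots> = ennreal (2 powr q * Q)"
        using Q(2) by (subst nn_integral_cmult) (simp_all add: Q(1) ennreal_mult)
      finally show ?thesis .
    qed
    ultimately show "(\<integral>\<^sup>+ x. ennreal (\<bar>h x\<bar> powr q) \<partial>lborel) \<le> ennreal (2 powr q * C0 * P powr (\<theta> * q) * U powr ((1 - \<theta>) * q))"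
      by (meson ennreal_leI order_trans)
  qed
qed

subsection \<open>The increment between consecutive annuli\<close>

text \<open>Squaring smooths the corner of the positive part. This permits an explicit C^1 cutoff
  made from a polynomial.\<close>

lemma DERIV_max_zero_squared: "((\<lambda>s::real. (max 0 s)\<^sup>2) has_real_derivative 2 * max 0 s) (at s)"
proof -
  consider "s > 0" | "s < 0" | "s = 0" by linarith
  then show ?thesis
  proof cases
    case 1
    have "((\<lambda>s::real. s\<^sup>2) has_real_derivative 2 * s) (at s)" by (auto intro!: derivative_eq_intros)
    then have "((\<lambda>s::real. (max 0 s)\<^sup>2) has_real_derivative 2 * s) (at s)"
      by (rule has_field_derivative_transform_within_open[of _ _ _ "{0<..}"]) (use 1 in auto)
    then show ?thesis using 1 by simp
  next
    case 2
    have "((\<lambda>s::real. 0) has_real_derivative 0) (at s)" by simp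
    then have "((\<lambda>s::real. (max 0 s)\<^sup>2) has_real_derivative 0) (at s)"
      by (rule has_field_derivative_transform_within_open[of _ _ _ "{..<0}"]) (use 2 in auto)
    then show ?thesis using 2 by simp
  next
    case 3
    have "(\<lambda>h::real. (max 0 h)\<^sup>2 / h) \<midarrow>0\<rightarrow> 0"
    proof (rule Lim_null_comparison)
      show "\<forall>\<^sub>F h::real in at 0. norm ((max 0 h)\<^sup>2 / h) \<le> \<bar>h\<bar>"
        by (auto simp: max_def power2_eq_square intro!: always_eventually)
      show "((\<lambda>h::real. \<bar>h\<bar>) \<longlongrightarrow> 0) (at 0)" by (rule tendsto_eq_intros | simp)+
    qed
    then show ?thesis using 3 by (simp add: DERIV_def)
  qed
qed

text \<open>Jensen's inequality on the unit interval, with the constant 2^p inherited from the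
  Hoelder estimate at m = 1.\<close>

lemma powr_le_two_powr_nn_integral_powr:
  fixes a :: "real \<Rightarrow> real"
  assumes [measurable]: "a \<in> borel_measurable borel" and a: "\<And>t. 0 \<le> a t" and p: "p \<ge> 1" and c: "0 \<le> c"
    and le: "ennreal c \<le> (\<integral>\<^sup>+ t. ennreal (a t) * indicator {0..1} t \<partial>lborel)"
  shows "ennreal (c powr p) \<le> ennreal (2 powr p) * (\<integral>\<^sup>+ t. ennreal (a t powr p) * indicator {0..1} t \<partial>lborel)"
proof (cases "(\<integral>\<^sup>+ t. ennreal (a t powr p) * indicator {0..1} t \<partial>lborel)" rule: ennreal_cases)
  case (real D)
  have "ennreal c \<le> ennreal (2 * D powr (1 / p) * 1 powr (1 - 1 / p))"
    by (rule order_trans[OF le nn_integral_le_two_Holder]) (use real p a in auto)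
  then have "c \<le> 2 * D powr (1 / p)" by (simp add: ennreal_le_iff)
  then have "c powr p \<le> (2 * D powr (1 / p)) powr p" using c p by (intro powr_mono2) auto
  also have "\<dots> = 2 powr p * D" using p real by (simp add: powr_mult powr_powr)
  finally show ?thesis using real by (simp add: ennreal_mult[symmetric] ennreal_leI)
qed (simp add: ennreal_mult_top)

text \<open>Dilation by c in [1,2] carries the inner shell into the outer one, and the Jacobian
  factor c^(-n) is at most 1. Both shells are fixed, so the bound is uniform in c.\<close>

lemma nn_integral_dilated_shell_le:
  fixes F :: "'a::euclidean_space \<Rightarrow> ennreal"
  assumes [measurable]: "F \<in> borel_measurable borel" and c: "1 \<le> c" "c \<le> 2"
  shows "(\<integral>\<^sup>+ x. F (c *\<^sub>R x) * indicator {x. 1/4 < norm x \<and> norm x < 2} x \<partial>lborel)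
    \<le> (\<integral>\<^sup>+ x. F x * indicator {x. 1/4 \<le> norm x \<and> norm x < 4} x \<partial>lborel)"
proof -
  have "(\<integral>\<^sup>+ x. F (c *\<^sub>R x) * indicator {x. 1/4 < norm x \<and> norm x < 2} x \<partial>lborel)
     \<le> (\<integral>\<^sup>+ x. F (c *\<^sub>R x) * indicator {x. 1/4 \<le> norm x \<and> norm x < 4} (c *\<^sub>R x) \<partial>lborel)"
  proof (rule nn_integral_mono)
    fix x :: 'a
    have "1/4 \<le> c * norm x \<and> c * norm x < 4" if "1/4 < norm x" "norm x < 2"
    proof
      show "1/4 \<le> c * norm x" using mult_mono[of 1 c "1/4" "norm x"] c that by simp
      have "c * norm x \<le> 2 * norm x" using c by (intro mult_right_mono) auto
      then show "c * norm x < 4" using that by linarith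
    qed
    then show "F (c *\<^sub>R x) * indicator {x. 1/4 < norm x \<and> norm x < 2} x
        \<le> F (c *\<^sub>R x) * indicator {x. 1/4 \<le> norm x \<and> norm x < 4} (c *\<^sub>R x)"
      using c by (auto simp: indicator_def)
  qed
  also have "\<dots> = ennreal (1 / c ^ DIM('a)) * (\<integral>\<^sup>+ x. F x * indicator {x. 1/4 \<le> norm x \<and> norm x < 4} x \<partial>lborel)"
    using c by (intro nn_integral_lborel_scale[where f="\<lambda>x. F x * indicator {x. 1/4 \<le> norm x \<and> norm x < 4} x"]) auto
  also have "\<dots> \<le> 1 * (\<integral>\<^sup>+ x. F x * indicator {x. 1/4 \<le> norm x \<and> norm x < 4} x \<partial>lborel)"
    using c by (intro mult_right_mono) (auto simp: ennreal_1[symmetric] simp del: ennreal_1 intro!: ennreal_leI divide_le_eq_1_pos[THEN iffD2])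
  finally show ?thesis by simp
qed

text \<open>A Poincare inequality for the increment: f is differentiated along the ray t \<mapsto>
  (1 + t) x. One factor 2^p is the bound |x| < 2 and the other is Jensen's; after Tonelli each t is
  a dilation of the shell.\<close>

lemma nn_integral_dyadic_increment_le:
  fixes f :: "'a::euclidean_space \<Rightarrow> real" and gr :: "'a \<Rightarrow> 'a"
  assumes der: "\<And>x. (f has_derivative (\<lambda>y. gr x \<bullet> y)) (at x)" and cont: "continuous_on UNIV gr" and p: "p \<ge> 1"
  shows "(\<integral>\<^sup>+ x. ennreal (\<bar>f x - f (2 *\<^sub>R x)\<bar> powr p) * indicator {x. 1/4 < norm x \<and> norm x < 2} x \<partial>lborel)
    \<le> ennreal (4 powr p) * (\<integral>\<^sup>+ x. ennreal (norm (gr x) powr p) * indicator {x. 1/4 \<le> norm x \<and> norm x < 4} x \<partial>lborel)"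
    (is "?L \<le> ennreal (4 powr p) * ?I")
proof -
  let ?S = "{x::'a. 1/4 < norm x \<and> norm x < 2}"
  have [measurable]: "gr \<in> borel_measurable borel"
    using cont by (rule borel_measurable_continuous_onI)
  have "?L \<le> (\<integral>\<^sup>+ x. (\<integral>\<^sup>+ t. ennreal (4 powr p) * (ennreal (norm (gr ((1 + t) *\<^sub>R x)) powr p) * indicator {0..1} t * indicator ?S x) \<partial>lborel) \<partial>lborel)"
  proof (rule nn_integral_mono)
    fix x :: 'a
    show "ennreal (\<bar>f x - f (2 *\<^sub>R x)\<bar> powr p) * indicator ?S x
      \<le> (\<integral>\<^sup>+ t. ennreal (4 powr p) * (ennreal (norm (gr ((1 + t) *\<^sub>R x)) powr p) * indicator {0..1} t * indicator ?S x) \<partial>lborel)"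
    proof (cases "x \<in> ?S")
      case True
      have "ennreal \<bar>f ((1 + 1) *\<^sub>R x) - f ((1 + 0) *\<^sub>R x)\<bar> \<le> (\<integral>\<^sup>+ t. ennreal \<bar>gr ((1 + t) *\<^sub>R x) \<bullet> x\<bar> * indicator {0..1} t \<partial>lborel)"
      proof (rule FTC_abs_le_nn_integral)
        fix t :: real
        have "((\<lambda>t. (1 + t) *\<^sub>R x) has_derivative (\<lambda>s. s *\<^sub>R x)) (at t)"
          by (auto intro!: derivative_eq_intros)
        then have "((\<lambda>t. f ((1 + t) *\<^sub>R x)) has_derivative (\<lambda>s. gr ((1 + t) *\<^sub>R x) \<bullet> (s *\<^sub>R x))) (at t)"
          using has_derivative_compose der by blast
        then show "((\<lambda>t. f ((1 + t) *\<^sub>R x)) has_vector_derivative gr ((1 + t) *\<^sub>R x) \<bullet> x) (at t)"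
          by (simp add: has_vector_derivative_def)
      next
        show "continuous_on UNIV (\<lambda>t. gr ((1 + t) *\<^sub>R x) \<bullet> x)"
          by (intro continuous_on_inner continuous_on_compose2[OF cont] continuous_intros) auto
      qed simp
      also have "\<dots> \<le> (\<integral>\<^sup>+ t. ennreal (2 * norm (gr ((1 + t) *\<^sub>R x))) * indicator {0..1} t \<partial>lborel)"
      proof (intro nn_integral_mono mult_right_mono ennreal_leI)
        fix t
        have "\<bar>gr ((1 + t) *\<^sub>R x) \<bullet> x\<bar> \<le> norm (gr ((1 + t) *\<^sub>R x)) * norm x" by (rule Cauchy_Schwarz_ineq2)
        also have "\<dots> \<le> norm (gr ((1 + t) *\<^sub>R x)) * 2" using True by (intro mult_left_mono) auto
        finally show "\<bar>gr ((1 + t) *\<^sub>R x) \<bullet> x\<bar> \<le> 2 * norm (gr ((1 + t) *\<^sub>R x))" by simp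
      qed simp
      finally have "ennreal \<bar>f x - f (2 *\<^sub>R x)\<bar> \<le> (\<integral>\<^sup>+ t. ennreal (2 * norm (gr ((1 + t) *\<^sub>R x))) * indicator {0..1} t \<partial>lborel)"
        by (simp add: abs_minus_commute)
      then have "ennreal (\<bar>f x - f (2 *\<^sub>R x)\<bar> powr p)
          \<le> ennreal (2 powr p) * (\<integral>\<^sup>+ t. ennreal ((2 * norm (gr ((1 + t) *\<^sub>R x))) powr p) * indicator {0..1} t \<partial>lborel)"
        using p by (intro powr_le_two_powr_nn_integral_powr) auto
      also have "\<dots> = (\<integral>\<^sup>+ t. ennreal (2 powr p) * (ennreal ((2 * norm (gr ((1 + t) *\<^sub>R x))) powr p) * indicator {0..1} t) \<partial>lborel)"
        by (rule nn_integral_cmult[symmetric]) measurable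
      also have "\<dots> = (\<integral>\<^sup>+ t. ennreal (4 powr p) * (ennreal (norm (gr ((1 + t) *\<^sub>R x)) powr p) * indicator {0..1} t * indicator ?S x) \<partial>lborel)"
      proof (rule nn_integral_cong)
        fix t
        have "2 powr p * (2 * norm (gr ((1 + t) *\<^sub>R x))) powr p = 4 powr p * norm (gr ((1 + t) *\<^sub>R x)) powr p"
          by (simp add: powr_mult mult.assoc[symmetric]) (simp add: powr_mult[symmetric])
        then show "ennreal (2 powr p) * (ennreal ((2 * norm (gr ((1 + t) *\<^sub>R x))) powr p) * indicator {0..1} t)
          = ennreal (4 powr p) * (ennreal (norm (gr ((1 + t) *\<^sub>R x)) powr p) * indicator {0..1} t * indicator ?S x)"
          using True by (simp add: mult.assoc[symmetric] ennreal_mult[symmetric])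
      qed
      finally show ?thesis using True by simp
    qed simp
  qed
  also have "\<dots> = (\<integral>\<^sup>+ t. (\<integral>\<^sup>+ x. ennreal (4 powr p) * (ennreal (norm (gr ((1 + t) *\<^sub>R x)) powr p) * indicator {0..1} t * indicator ?S x) \<partial>lborel) \<partial>lborel)"
    by (rule lborel_pair.Fubini'[symmetric]) measurable
  also have "\<dots> \<le> (\<integral>\<^sup>+ t. ennreal (4 powr p) * ?I * indicator {0..1::real} t \<partial>lborel)"
  proof (rule nn_integral_mono)
    fix t :: real
    show "(\<integral>\<^sup>+ x. ennreal (4 powr p) * (ennreal (norm (gr ((1 + t) *\<^sub>R x)) powr p) * indicator {0..1} t * indicator ?S x) \<partial>lborel)
        \<le> ennreal (4 powr p) * ?I * indicator {0..1} t"
    proof (cases "t \<in> {0..1}")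
      case True
      then have "(\<integral>\<^sup>+ x. ennreal (norm (gr ((1 + t) *\<^sub>R x)) powr p) * indicator ?S x \<partial>lborel) \<le> ?I"
        by (intro nn_integral_dilated_shell_le[where F="\<lambda>x. ennreal (norm (gr x) powr p)"]) auto
      then show ?thesis using True
        by (simp add: nn_integral_cmult mult_left_mono)
    qed simp
  qed
  also have "\<dots> = ennreal (4 powr p) * ?I" by (simp add: nn_integral_cmult_indicator)
  finally show ?thesis .
qed

section \<open>The cutoff argument on the unit annulus\<close>

lemma annulus_measurable[measurable]: "annulus k \<in> sets borel"
  unfolding annulus_def by measurable

lemma powr_inverse_powr: "(c powr (1 / a)) powr a = c" if "0 \<le> c" "a \<noteq> 0" for a c :: real
  using that by (simp add: powr_powr)

text \<open>Gagliardo--Nirenberg for the increment \<open>f x - f (2 x)\<close> times a cutoff: the increment, unlike \<open>f\<close>, is itself controlled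
  by the gradient, so that differentiating the cutoff causes no lower order term.\<close>

lemma local_gagliardo_nirenberg_increment:
  fixes p q u \<theta> \<delta> :: real
  assumes p: "p \<ge> 1" and u: "u > 0" and q: "q > 0" and \<theta>: "0 < \<theta>" "\<theta> \<le> 1" and \<delta>: "0 \<le> \<delta>" "\<delta> \<le> 1"
    and balance: "1 / q = \<theta> * (1 / p - \<delta> / real DIM('a::euclidean_space)) + (1 - \<theta>) / u"
  shows "\<exists>C\<ge>0. \<forall>(f :: 'a \<Rightarrow> real) gr P U. (\<forall>x. (f has_derivative (\<lambda>y. gr x \<bullet> y)) (at x)) \<longrightarrow>
     continuous_on UNIV gr \<longrightarrow> 0 \<le> P \<longrightarrow> 0 \<le> U \<longrightarrow>
     (\<integral>\<^sup>+ x. ennreal (norm (gr x) powr p) * indicator {x. 1/4 \<le> norm x \<and> norm x < 4} x \<partial>lborel) \<le> ennreal (P powr p) \<longrightarrow>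
     (\<integral>\<^sup>+ x. ennreal (\<bar>f x\<bar> powr u) * indicator {x. 1/4 \<le> norm x \<and> norm x < 4} x \<partial>lborel) \<le> ennreal (U powr u) \<longrightarrow>
     (\<integral>\<^sup>+ x. ennreal (\<bar>f x - f (2 *\<^sub>R x)\<bar> powr q) * indicator (annulus 0) x \<partial>lborel)
       \<le> ennreal (C * P powr (\<theta> * q) * U powr ((1 - \<theta>) * q))"
proof -
  obtain C0 where C0: "C0 \<ge> 0" and GN: "\<And>(h :: 'a \<Rightarrow> real) h' G P U. (\<forall>x. (h has_derivative h' x) (at x)) \<Longrightarrow>
     (\<forall>y. continuous_on UNIV (\<lambda>x. h' x y)) \<Longrightarrow> (\<forall>x y. \<bar>h' x y\<bar> \<le> G x * norm y) \<Longrightarrow> (\<forall>x. 0 \<le> G x) \<Longrightarrow>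
     G \<in> borel_measurable borel \<Longrightarrow> (\<forall>x. 2 \<le> norm x \<longrightarrow> h x = 0) \<Longrightarrow> 0 \<le> P \<Longrightarrow> 0 \<le> U \<Longrightarrow>
     (\<integral>\<^sup>+ x. ennreal (G x powr p) \<partial>lborel) \<le> ennreal (P powr p) \<Longrightarrow>
     (\<integral>\<^sup>+ x. ennreal (\<bar>h x\<bar> powr u) \<partial>lborel) \<le> ennreal (U powr u) \<Longrightarrow>
     (\<integral>\<^sup>+ x. ennreal (\<bar>h x\<bar> powr q) \<partial>lborel) \<le> ennreal (C0 * P powr (\<theta> * q) * U powr ((1 - \<theta>) * q))"
    using gagliardo_nirenberg_bounded_support[OF p u q \<theta> \<delta> _ balance, of 2] by auto
  \<comment> \<open>A polynomial in |x|^2, positive exactly on the open shell 1/4 < |x| < 2. Its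
    positive part squared is the cutoff \<phi>, whose gradient is \<psi>(x) x; the constant 65/16 =
    4 + 1/16 arises from differentiating w with respect to |x|^2.\<close>
  define w where "w x = (x \<bullet> x - 1/16) * (4 - x \<bullet> x)" for x :: 'a
  define \<phi> where "\<phi> x = (max 0 (w x))\<^sup>2" for x :: 'a
  define \<psi> where "\<psi> x = 4 * max 0 (w x) * (65/16 - 2 * (x \<bullet> x))" for x :: 'a
  define S where "S = {x :: 'a. 1/4 < norm x \<and> norm x < 2}"
  have [measurable]: "S \<in> sets borel" unfolding S_def by measurable
  define S1 where "S1 = {x :: 'a. 1/4 \<le> norm x \<and> norm x < 4}"
  have S_iff: "x \<in> S \<longleftrightarrow> 1/16 < x \<bullet> x \<and> x \<bullet> x < 4" for x
  proof -
    have iff: "a < b \<longleftrightarrow> a\<^sup>2 < b\<^sup>2" if "0 \<le> a" "0 \<le> b" for a b :: real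
      using that by (metis less_le_not_le power2_le_imp_le power_mono)
    have "1/4 < norm x \<longleftrightarrow> (1/4)\<^sup>2 < x \<bullet> x" unfolding power2_norm_eq_inner[symmetric] by (rule iff) auto
    moreover have "norm x < 2 \<longleftrightarrow> x \<bullet> x < 2\<^sup>2" unfolding power2_norm_eq_inner[symmetric] by (rule iff) auto
    ultimately show ?thesis by (simp add: S_def power_divide)
  qed
  have w_out: "max 0 (w x) = 0" if out: "x \<notin> S" for x
  proof -
    consider "x \<bullet> x \<le> 1/16" | "4 \<le> x \<bullet> x" using out S_iff[of x] by linarith
    then have "w x \<le> 0"
    proof cases
      case 1
      then show ?thesis unfolding w_def by (intro mult_nonpos_nonneg) linarith+
    next
      case 2
      then show ?thesis unfolding w_def by (intro mult_nonneg_nonpos) linarith+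
    qed
    then show ?thesis by simp
  qed
  have w_in: "0 \<le> max 0 (w x) \<and> max 0 (w x) \<le> 16" if "x \<in> S" for x
  proof -
    have "w x \<le> 4 * 4" unfolding w_def using that S_iff[of x] by (intro mult_mono) simp_all
    then show ?thesis by simp
  qed
  have \<phi>_out: "\<phi> x = 0" "\<psi> x = 0" if "x \<notin> S" for x
    using w_out[OF that] by (simp_all add: \<phi>_def \<psi>_def)
  have \<phi>_in: "0 \<le> \<phi> x" "\<phi> x \<le> 256" "\<bar>\<psi> x\<bar> \<le> 320" if "x \<in> S" for x
  proof -
    show "0 \<le> \<phi> x" by (simp add: \<phi>_def)
    have "(max 0 (w x))\<^sup>2 \<le> 16\<^sup>2" using w_in[OF that] by (intro power_mono) auto
    then show "\<phi> x \<le> 256" by (simp add: \<phi>_def)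
    have "\<bar>\<psi> x\<bar> = 4 * max 0 (w x) * \<bar>65/16 - 2 * (x \<bullet> x)\<bar>" by (simp add: \<psi>_def abs_mult)
    also have "\<dots> \<le> 4 * 16 * 5" using w_in[OF that] that S_iff[of x] by (intro mult_mono) auto
    finally show "\<bar>\<psi> x\<bar> \<le> 320" by simp
  qed
  have \<phi>_annulus: "1/4 \<le> \<phi> x" if "x \<in> annulus 0" for x
  proof -
    have nx: "1/2 \<le> norm x" "norm x < 1" using that by (auto simp: annulus_def powr_minus)
    have "(1/2)\<^sup>2 \<le> (norm x)\<^sup>2" using nx by (intro power_mono) auto
    then have a: "1/4 \<le> x \<bullet> x" by (simp add: power2_norm_eq_inner power_divide)
    have "(norm x)\<^sup>2 \<le> 1\<^sup>2" using nx by (intro power_mono) auto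
    then have b: "x \<bullet> x \<le> 1" by (simp add: power2_norm_eq_inner)
    \<comment> \<open>On the unit annulus |x|^2 lies in [1/4, 1], so the two factors of w are at
      least 3/16 and 3.\<close>
    have "1/2 \<le> (3/16) * (3::real)" by simp
    also have "\<dots> \<le> w x" unfolding w_def using a b by (intro mult_mono) auto
    finally have "(1/2)\<^sup>2 \<le> (max 0 (w x))\<^sup>2" by (intro power_mono) auto
    then show ?thesis by (simp add: \<phi>_def power_divide)
  qed
  have \<phi>_der: "(\<phi> has_derivative (\<lambda>y. \<psi> x * (x \<bullet> y))) (at x)" for x
  proof -
    have "(w has_derivative (\<lambda>y. (x \<bullet> y + y \<bullet> x) * (4 - x \<bullet> x) + (x \<bullet> x - 1/16) * (- (x \<bullet> y + y \<bullet> x)))) (at x)"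
    proof -
      have sq: "((\<lambda>x. x \<bullet> x) has_derivative (\<lambda>y. x \<bullet> y + y \<bullet> x)) (at x)"
        by (auto intro!: derivative_eq_intros)
      show ?thesis unfolding w_def[abs_def]
        using has_derivative_mult[OF has_derivative_diff[OF sq has_derivative_const[of "1/16"]]
          has_derivative_diff[OF has_derivative_const[of 4] sq]]
        by (simp add: add.commute)
    qed
    then have "((\<lambda>x. (max 0 (w x))\<^sup>2) has_derivative
        (\<lambda>y. 2 * max 0 (w x) * ((x \<bullet> y + y \<bullet> x) * (4 - x \<bullet> x) + (x \<bullet> x - 1/16) * (- (x \<bullet> y + y \<bullet> x))))) (at x)"
      by (rule has_derivative_compose[where f=w and g="\<lambda>s. (max 0 s)\<^sup>2" and g'="\<lambda>s. 2 * max 0 (w x) * s"])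
        (use DERIV_max_zero_squared[of "w x"] in \<open>simp add: has_field_derivative_def\<close>)
    moreover have "2 * max 0 (w x) * ((x \<bullet> y + y \<bullet> x) * (4 - x \<bullet> x) + (x \<bullet> x - 1/16) * (- (x \<bullet> y + y \<bullet> x))) = \<psi> x * (x \<bullet> y)" for y
      unfolding \<psi>_def by (simp add: inner_commute[of y x] algebra_simps)
    ultimately show ?thesis by (simp add: \<phi>_def[abs_def])
  qed
  have \<psi>_cont: "continuous_on UNIV \<psi>"
    unfolding \<psi>_def w_def by (intro continuous_intros)
  have \<phi>_cont: "continuous_on UNIV \<phi>"
    unfolding \<phi>_def w_def by (intro continuous_intros)
  \<comment> \<open>MP collects the bound for G: 640 is its coefficient, the two outer factors 2^p
    are quasi-triangle inequalities, 4^p belongs to the increment, and the last 2 counts the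
    gradients at x and 2x. Likewise MU has 256 from \<phi>, 2^u from the quasi-triangle inequality
    and 2 for the two values of f.\<close>
  define MP where "MP = (640 powr p * (2 powr p * (4 powr p + 2 powr p * 2))) powr (1 / p)"
  define MU where "MU = (256 powr u * (2 powr u * 2)) powr (1 / u)"
  have MP: "MP \<ge> 0" "640 powr p * (2 powr p * (4 powr p + 2 powr p * 2)) = MP powr p"
    unfolding MP_def using p by (simp, intro powr_inverse_powr[symmetric]) auto
  have MU: "MU \<ge> 0" "256 powr u * (2 powr u * 2) = MU powr u"
    unfolding MU_def using u by (simp, intro powr_inverse_powr[symmetric]) auto
  show ?thesis
  proof (intro exI[of _ "4 powr q * (C0 * MP powr (\<theta> * q) * MU powr ((1 - \<theta>) * q))"] conjI allI impI)
    show "0 \<le> 4 powr q * (C0 * MP powr (\<theta> * q) * MU powr ((1 - \<theta>) * q))" using C0 by simp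
    fix f :: "'a \<Rightarrow> real" and gr :: "'a \<Rightarrow> 'a" and P U :: real
    assume der: "\<forall>x. (f has_derivative (\<lambda>y. gr x \<bullet> y)) (at x)" and cont: "continuous_on UNIV gr"
      and P: "0 \<le> P" and U: "0 \<le> U"
      and IP': "(\<integral>\<^sup>+ x. ennreal (norm (gr x) powr p) * indicator {x. 1/4 \<le> norm x \<and> norm x < 4} x \<partial>lborel) \<le> ennreal (P powr p)"
      and IU': "(\<integral>\<^sup>+ x. ennreal (\<bar>f x\<bar> powr u) * indicator {x. 1/4 \<le> norm x \<and> norm x < 4} x \<partial>lborel) \<le> ennreal (U powr u)"
    have contf: "continuous_on UNIV f"
      using der has_derivative_continuous continuous_at_imp_continuous_on by blast
    have [measurable]: "f \<in> borel_measurable borel" "gr \<in> borel_measurable borel"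
      using contf cont by (auto intro: borel_measurable_continuous_onI)
    define g where "g x = f x - f (2 *\<^sub>R x)" for x
    have [measurable]: "g \<in> borel_measurable borel" unfolding g_def by measurable
    have contg: "continuous_on UNIV g"
      unfolding g_def by (intro continuous_intros contf continuous_on_compose2[OF contf]) auto
    have g_der: "(g has_derivative (\<lambda>y. gr x \<bullet> y - gr (2 *\<^sub>R x) \<bullet> (2 *\<^sub>R y))) (at x)" for x
    proof -
      have "((\<lambda>x. 2 *\<^sub>R x) has_derivative (\<lambda>y. 2 *\<^sub>R y)) (at x)" for x :: 'a
        by (auto intro!: derivative_eq_intros)
      then have "((\<lambda>x. f (2 *\<^sub>R x)) has_derivative (\<lambda>y. gr (2 *\<^sub>R x) \<bullet> (2 *\<^sub>R y))) (at x)"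
        using has_derivative_compose der by blast
      then show ?thesis unfolding g_def using der by (intro has_derivative_diff) auto
    qed
    define h where "h x = \<phi> x * g x" for x
    define h' where "h' x y = \<phi> x * (gr x \<bullet> y - gr (2 *\<^sub>R x) \<bullet> (2 *\<^sub>R y)) + \<psi> x * (x \<bullet> y) * g x" for x y
    \<comment> \<open>640 = 320 * 2 covers the term with \<psi> and |x| < 2; it also dominates 256 *
      2, where the 2 is the chain rule factor of f (2 x). The undifferentiated increment in G is
      later bounded by the gradient.\<close>
    define G where "G x = 640 * (\<bar>g x\<bar> + (norm (gr x) + norm (gr (2 *\<^sub>R x)))) * indicator S x" for x
    have h_der: "(h has_derivative h' x) (at x)" for x
      unfolding h_def h'_def[abs_def] by (rule has_derivative_mult[OF \<phi>_der g_der])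
    have h'_cont: "continuous_on UNIV (\<lambda>x. h' x y)" for y
      unfolding h'_def
      by (intro continuous_intros \<phi>_cont \<psi>_cont contg cont continuous_on_compose2[OF cont]) auto
    have h'_bound: "\<bar>h' x y\<bar> \<le> G x * norm y" for x y
    proof (cases "x \<in> S")
      case True
      have a: "\<bar>gr x \<bullet> y\<bar> \<le> norm (gr x) * norm y" by (rule Cauchy_Schwarz_ineq2)
      have b: "\<bar>gr (2 *\<^sub>R x) \<bullet> (2 *\<^sub>R y)\<bar> \<le> 2 * (norm (gr (2 *\<^sub>R x)) * norm y)"
        using Cauchy_Schwarz_ineq2[of "gr (2 *\<^sub>R x)" "2 *\<^sub>R y"] by simp
      have "\<bar>x \<bullet> y\<bar> \<le> norm x * norm y" by (rule Cauchy_Schwarz_ineq2)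
      also have "\<dots> \<le> 2 * norm y" using True by (intro mult_right_mono) (auto simp: S_def)
      finally have c: "\<bar>x \<bullet> y\<bar> \<le> 2 * norm y" .
      have "\<bar>h' x y\<bar> \<le> \<bar>\<phi> x * (gr x \<bullet> y - gr (2 *\<^sub>R x) \<bullet> (2 *\<^sub>R y))\<bar> + \<bar>\<psi> x * (x \<bullet> y) * g x\<bar>"
        unfolding h'_def by (rule abs_triangle_ineq)
      also have "\<dots> \<le> 256 * (norm (gr x) * norm y + 2 * (norm (gr (2 *\<^sub>R x)) * norm y)) + 320 * (2 * norm y) * \<bar>g x\<bar>"
        unfolding abs_mult using a b c \<phi>_in[OF True] by (intro add_mono mult_mono) auto
      also have "\<dots> \<le> 640 * (\<bar>g x\<bar> + (norm (gr x) + norm (gr (2 *\<^sub>R x)))) * norm y"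
      proof -
        have "0 \<le> norm (gr x) * norm y" "0 \<le> norm (gr (2 *\<^sub>R x)) * norm y" by auto
        then show ?thesis by (simp add: algebra_simps)
      qed
      finally show ?thesis using True by (simp add: G_def)
    next
      case False
      then show ?thesis using \<phi>_out[OF False] by (simp add: h'_def G_def)
    qed
    have supp: "h x = 0" if "2 \<le> norm x" for x
      using \<phi>_out[of x] that by (simp add: h_def S_def)
    have IP: "(\<integral>\<^sup>+ x. ennreal (norm (gr x) powr p) * indicator S1 x \<partial>lborel) \<le> ennreal (P powr p)"
      using IP' by (simp add: S1_def)
    have IU: "(\<integral>\<^sup>+ x. ennreal (\<bar>f x\<bar> powr u) * indicator S1 x \<partial>lborel) \<le> ennreal (U powr u)"
      using IU' by (simp add: S1_def)
    have GP: "(\<integral>\<^sup>+ x. ennreal (G x powr p) \<partial>lborel) \<le> ennreal ((MP * P) powr p)"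
    proof -
      \<comment> \<open>The argument is written \<open>1 *\<^sub>R x\<close> so that the dilation
        estimate for shells applies to both gradients, with c = 1 and c = 2.\<close>
      have pt: "G x powr p \<le> 640 powr p * (2 powr p * (\<bar>g x\<bar> powr p * indicator S x
          + 2 powr p * (norm (gr (1 *\<^sub>R x)) powr p * indicator S x + norm (gr (2 *\<^sub>R x)) powr p * indicator S x)))" for x
      proof (cases "x \<in> S")
        case True
        have "G x powr p = 640 powr p * (\<bar>g x\<bar> + (norm (gr x) + norm (gr (2 *\<^sub>R x)))) powr p"
          using True by (simp add: G_def powr_mult del: distrib_left_numeral)
        also have "\<dots> \<le> 640 powr p * (2 powr p * (\<bar>g x\<bar> powr p + (norm (gr x) + norm (gr (2 *\<^sub>R x))) powr p))"
          using p by (intro mult_left_mono powr_add_le_two_powr) auto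
        also have "\<dots> \<le> 640 powr p * (2 powr p * (\<bar>g x\<bar> powr p + 2 powr p * (norm (gr x) powr p + norm (gr (2 *\<^sub>R x)) powr p)))"
          using p by (intro mult_left_mono add_left_mono powr_add_le_two_powr) auto
        finally show ?thesis using True by simp
      qed (simp add: G_def)
      have "(\<integral>\<^sup>+ x. ennreal (G x powr p) \<partial>lborel) \<le>
          (\<integral>\<^sup>+ x. ennreal (640 powr p) * (ennreal (2 powr p) * (ennreal (\<bar>g x\<bar> powr p) * indicator S x
          + ennreal (2 powr p) * (ennreal (norm (gr (1 *\<^sub>R x)) powr p) * indicator S x + ennreal (norm (gr (2 *\<^sub>R x)) powr p) * indicator S x))) \<partial>lborel)"
      proof (rule nn_integral_mono)
        fix x
        show "ennreal (G x powr p) \<le> ennreal (640 powr p) * (ennreal (2 powr p) * (ennreal (\<bar>g x\<bar> powr p) * indicator S x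
          + ennreal (2 powr p) * (ennreal (norm (gr (1 *\<^sub>R x)) powr p) * indicator S x + ennreal (norm (gr (2 *\<^sub>R x)) powr p) * indicator S x)))"
          using ennreal_leI[OF pt[of x]] by (cases "x \<in> S") (simp_all add: ennreal_mult)
      qed
      also have "\<dots> = ennreal (640 powr p) * (ennreal (2 powr p) * ((\<integral>\<^sup>+ x. ennreal (\<bar>g x\<bar> powr p) * indicator S x \<partial>lborel)
          + ennreal (2 powr p) * ((\<integral>\<^sup>+ x. ennreal (norm (gr (1 *\<^sub>R x)) powr p) * indicator S x \<partial>lborel)
             + (\<integral>\<^sup>+ x. ennreal (norm (gr (2 *\<^sub>R x)) powr p) * indicator S x \<partial>lborel))))"
        by (simp add: nn_integral_cmult nn_integral_add)
      also have "\<dots> \<le> ennreal (640 powr p) * (ennreal (2 powr p) * (ennreal (4 powr p) * ennreal (P powr p)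
          + ennreal (2 powr p) * (ennreal (P powr p) + ennreal (P powr p))))"
      proof (intro mult_left_mono add_mono)
        show "(\<integral>\<^sup>+ x. ennreal (\<bar>g x\<bar> powr p) * indicator S x \<partial>lborel) \<le> ennreal (4 powr p) * ennreal (P powr p)"
          unfolding g_def S_def
          by (rule order_trans[OF nn_integral_dyadic_increment_le[where gr=gr]])
            (use der cont p IP' in \<open>auto intro: mult_left_mono\<close>)
        show "(\<integral>\<^sup>+ x. ennreal (norm (gr (1 *\<^sub>R x)) powr p) * indicator S x \<partial>lborel) \<le> ennreal (P powr p)"
          unfolding S_def
          by (rule order_trans[OF nn_integral_dilated_shell_le[where F="\<lambda>x. ennreal (norm (gr x) powr p)"] IP']) auto
        show "(\<integral>\<^sup>+ x. ennreal (norm (gr (2 *\<^sub>R x)) powr p) * indicator S x \<partial>lborel) \<le> ennreal (P powr p)"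
          unfolding S_def
          by (rule order_trans[OF nn_integral_dilated_shell_le[where F="\<lambda>x. ennreal (norm (gr x) powr p)"] IP']) auto
      qed auto
      also have "\<dots> = ennreal (640 powr p * (2 powr p * (4 powr p * P powr p + 2 powr p * (P powr p + P powr p))))"
        by (simp only: ennreal_mult ennreal_plus powr_ge_zero mult_nonneg_nonneg add_nonneg_nonneg)
      also have "640 powr p * (2 powr p * (4 powr p * P powr p + 2 powr p * (P powr p + P powr p)))
          = (640 powr p * (2 powr p * (4 powr p + 2 powr p * 2))) * P powr p"
        by (simp add: algebra_simps)
      also have "\<dots> = (MP * P) powr p" using P MP by (simp add: powr_mult)
      finally show ?thesis .
    qed
    have hU: "(\<integral>\<^sup>+ x. ennreal (\<bar>h x\<bar> powr u) \<partial>lborel) \<le> ennreal ((MU * U) powr u)"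
    proof -
      have pt: "\<bar>h x\<bar> powr u \<le> 256 powr u * (2 powr u * (\<bar>f (1 *\<^sub>R x)\<bar> powr u * indicator S x + \<bar>f (2 *\<^sub>R x)\<bar> powr u * indicator S x))" for x
      proof (cases "x \<in> S")
        case True
        have "\<bar>h x\<bar> \<le> 256 * (\<bar>f x\<bar> + \<bar>f (2 *\<^sub>R x)\<bar>)"
          unfolding h_def abs_mult g_def using \<phi>_in[OF True] by (intro mult_mono) auto
        then have "\<bar>h x\<bar> powr u \<le> (256 * (\<bar>f x\<bar> + \<bar>f (2 *\<^sub>R x)\<bar>)) powr u"
          using u by (intro powr_mono2) auto
        also have "\<dots> = 256 powr u * (\<bar>f x\<bar> + \<bar>f (2 *\<^sub>R x)\<bar>) powr u"
          by (simp add: powr_mult del: distrib_left_numeral)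
        also have "\<dots> \<le> 256 powr u * (2 powr u * (\<bar>f x\<bar> powr u + \<bar>f (2 *\<^sub>R x)\<bar> powr u))"
          using u by (intro mult_left_mono powr_add_le_two_powr) auto
        finally show ?thesis using True by simp
      qed (simp add: h_def \<phi>_out)
      have "(\<integral>\<^sup>+ x. ennreal (\<bar>h x\<bar> powr u) \<partial>lborel) \<le>
          (\<integral>\<^sup>+ x. ennreal (256 powr u) * (ennreal (2 powr u) * (ennreal (\<bar>f (1 *\<^sub>R x)\<bar> powr u) * indicator S x + ennreal (\<bar>f (2 *\<^sub>R x)\<bar> powr u) * indicator S x)) \<partial>lborel)"
      proof (rule nn_integral_mono)
        fix x
        show "ennreal (\<bar>h x\<bar> powr u) \<le> ennreal (256 powr u) * (ennreal (2 powr u) * (ennreal (\<bar>f (1 *\<^sub>R x)\<bar> powr u) * indicator S x + ennreal (\<bar>f (2 *\<^sub>R x)\<bar> powr u) * indicator S x))"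
          using ennreal_leI[OF pt[of x]] by (cases "x \<in> S") (simp_all add: ennreal_mult)
      qed
      also have "\<dots> = ennreal (256 powr u) * (ennreal (2 powr u) * ((\<integral>\<^sup>+ x. ennreal (\<bar>f (1 *\<^sub>R x)\<bar> powr u) * indicator S x \<partial>lborel)
             + (\<integral>\<^sup>+ x. ennreal (\<bar>f (2 *\<^sub>R x)\<bar> powr u) * indicator S x \<partial>lborel)))"
        by (simp add: nn_integral_cmult nn_integral_add)
      also have "\<dots> \<le> ennreal (256 powr u) * (ennreal (2 powr u) * (ennreal (U powr u) + ennreal (U powr u)))"
        unfolding S_def
        by (intro mult_left_mono add_mono order_trans[OF nn_integral_dilated_shell_le[where F="\<lambda>x. ennreal (\<bar>f x\<bar> powr u)"] IU']) auto
      also have "\<dots> = ennreal (256 powr u * (2 powr u * (U powr u + U powr u)))"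
        by (simp only: ennreal_mult ennreal_plus powr_ge_zero mult_nonneg_nonneg add_nonneg_nonneg)
      also have "256 powr u * (2 powr u * (U powr u + U powr u)) = (256 powr u * (2 powr u * 2)) * U powr u"
        by (simp add: algebra_simps)
      also have "\<dots> = (MU * U) powr u" using U MU by (simp add: powr_mult)
      finally show ?thesis .
    qed
    \<comment> \<open>On the unit annulus the cutoff is at least 1/4, so the increment is at most 4
      |h| there.\<close>
    have "(\<integral>\<^sup>+ x. ennreal (\<bar>f x - f (2 *\<^sub>R x)\<bar> powr q) * indicator (annulus 0) x \<partial>lborel)
       \<le> (\<integral>\<^sup>+ x. ennreal (4 powr q) * ennreal (\<bar>h x\<bar> powr q) \<partial>lborel)"
    proof (rule nn_integral_mono)
      fix x :: 'a
      show "ennreal (\<bar>f x - f (2 *\<^sub>R x)\<bar> powr q) * indicator (annulus 0) x \<le> ennreal (4 powr q) * ennreal (\<bar>h x\<bar> powr q)"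
      proof (cases "x \<in> annulus 0")
        case True
        have "\<bar>g x\<bar> * (1/4) \<le> \<bar>h x\<bar>"
          using mult_left_mono[OF \<phi>_annulus[OF True], of "\<bar>g x\<bar>"] \<phi>_annulus[OF True] by (simp add: h_def abs_mult mult.commute)
        then have "\<bar>g x\<bar> powr q \<le> (4 * \<bar>h x\<bar>) powr q" using q by (intro powr_mono2) auto
        then show ?thesis using True by (simp add: g_def powr_mult ennreal_mult[symmetric] ennreal_leI)
      qed simp
    qed
    also have "\<dots> = ennreal (4 powr q) * (\<integral>\<^sup>+ x. ennreal (\<bar>h x\<bar> powr q) \<partial>lborel)"
    proof -
      have [measurable]: "h \<in> borel_measurable borel"
        using h_der has_derivative_continuous continuous_at_imp_continuous_on
        by (metis borel_measurable_continuous_onI)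
      show ?thesis by (rule nn_integral_cmult) measurable
    qed
    also have "\<dots> \<le> ennreal (4 powr q) * ennreal (C0 * (MP * P) powr (\<theta> * q) * (MU * U) powr ((1 - \<theta>) * q))"
    proof (intro mult_left_mono GN[where h=h and h'=h' and G=G])
      show "G \<in> borel_measurable borel" unfolding G_def by measurable
    qed (use h_der h'_cont h'_bound supp GP hU P U in \<open>auto simp: G_def MP_def MU_def\<close>)
    also have "\<dots> = ennreal (4 powr q * (C0 * MP powr (\<theta> * q) * MU powr ((1 - \<theta>) * q)) * P powr (\<theta> * q) * U powr ((1 - \<theta>) * q))"
      using C0 P U by (simp add: MP_def MU_def powr_mult ennreal_mult[symmetric] mult_ac)
    finally show "(\<integral>\<^sup>+ x. ennreal (\<bar>f x - f (2 *\<^sub>R x)\<bar> powr q) * indicator (annulus 0) x \<partial>lborel)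
       \<le> ennreal (4 powr q * (C0 * MP powr (\<theta> * q) * MU powr ((1 - \<theta>) * q)) * P powr (\<theta> * q) * U powr ((1 - \<theta>) * q))" .
  qed
qed

subsection \<open>Scaling of annuli and decay at infinity\<close>

lemma annulus_scale: "2 powr (real_of_int j) *\<^sub>R x \<in> annulus (k + j) \<longleftrightarrow> x \<in> annulus k"
proof -
  have "2 powr (real_of_int (k + j) - 1) = 2 powr (real_of_int j) * 2 powr (real_of_int k - 1)"
    "2 powr (real_of_int (k + j)) = 2 powr (real_of_int j) * 2 powr (real_of_int k)"
    by (simp_all add: powr_add[symmetric] algebra_simps)
  then show ?thesis by (simp add: annulus_def)
qed

lemma nn_integral_annulus_scale:
  fixes F :: "'a::euclidean_space \<Rightarrow> ennreal"
  assumes [measurable]: "F \<in> borel_measurable borel"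
  shows "(\<integral>\<^sup>+ x. F (2 powr (real_of_int j) *\<^sub>R x) * indicator (annulus k) x \<partial>lborel)
    = ennreal (2 powr (- real_of_int j * real DIM('a))) * (\<integral>\<^sup>+ x. F x * indicator (annulus (k + j)) x \<partial>lborel)"
proof -
  have "(\<integral>\<^sup>+ x. F (2 powr (real_of_int j) *\<^sub>R x) * indicator (annulus k) x \<partial>lborel)
    = (\<integral>\<^sup>+ x. F (2 powr (real_of_int j) *\<^sub>R x) * indicator (annulus (k + j)) (2 powr (real_of_int j) *\<^sub>R x) \<partial>lborel)"
    by (simp add: indicator_def annulus_scale)
  also have "\<dots> = ennreal (1 / (2 powr (real_of_int j)) ^ DIM('a)) * (\<integral>\<^sup>+ x. F x * indicator (annulus (k + j)) x \<partial>lborel)"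
    by (rule nn_integral_lborel_scale[where f="\<lambda>x. F x * indicator (annulus (k + j)) x"]) auto
  also have "1 / (2 powr (real_of_int j)) ^ DIM('a) = 2 powr (- real_of_int j * real DIM('a))"
    by (simp add: powr_realpow[symmetric] powr_powr powr_minus_divide)
  finally show ?thesis .
qed

text \<open>The window is asymmetric because the shell 1/4 \<le> |x| < 4, blown up by 2^k, is the
  union of the annuli with indices k - 1 to k + 2: the increment looks outward to 2x.\<close>

definition neighbour_sum :: "(int \<Rightarrow> real) \<Rightarrow> int \<Rightarrow> real" where
  "neighbour_sum w k = w (k - 1) + w k + w (k + 1) + w (k + 2)"

lemma neighbour_sum_nonneg: "(\<And>k. 0 \<le> w k) \<Longrightarrow> 0 \<le> neighbour_sum w k"
  by (simp add: neighbour_sum_def)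

lemma shell_subset_annuli:
  assumes "1/4 \<le> norm x" "norm x < 4"
  shows "\<exists>i\<in>{-1,0,1,2}. x \<in> annulus i"
proof -
  consider "norm x < 1/2" | "1/2 \<le> norm x" "norm x < 1" | "1 \<le> norm x" "norm x < 2" | "2 \<le> norm x"
    by linarith
  then show ?thesis
    by cases (use assms in \<open>auto simp: annulus_def powr_minus\<close>)
qed

text \<open>The shell is covered by four annuli, which gives 4^(1/p). Their indices differ from k by
  at most 2, so the weights change by at most 2^(2|\<alpha>|), and the dilation contributes 2^(-kn).
  The right side is a p-th power so that it can serve directly as the bound P or U of the local
  inequality.\<close>

lemma nn_integral_shell_le:
  fixes \<psi> :: "'a::euclidean_space \<Rightarrow> real"
  assumes [measurable]: "\<psi> \<in> borel_measurable borel" and p: "p > 0" and w: "\<And>k. 0 \<le> w k"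
    and int: "\<And>k. (\<integral>\<^sup>+ x. ennreal (\<bar>\<psi> x\<bar> powr p) * indicator (annulus k) x \<partial>lborel) = ennreal ((2 powr (- real_of_int k * \<alpha>) * w k) powr p)"
  shows "(\<integral>\<^sup>+ x. ennreal (\<bar>\<psi> (2 powr (real_of_int k) *\<^sub>R x)\<bar> powr p) * indicator {x. 1/4 \<le> norm x \<and> norm x < 4} x \<partial>lborel)
    \<le> ennreal ((2 powr (real_of_int k * (- real DIM('a) / p - \<alpha>)) * (4 powr (1 / p) * 2 powr (2 * \<bar>\<alpha>\<bar>)) * neighbour_sum w k) powr p)"
proof -
  define n where "n = real DIM('a)"
  define I where "I = {-1, 0, 1, 2 :: int}"
  define c where "c = 2 powr (- real_of_int k * \<alpha>) * 2 powr (2 * \<bar>\<alpha>\<bar>)"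
  have each: "(\<integral>\<^sup>+ x. ennreal (\<bar>\<psi> (2 powr (real_of_int k) *\<^sub>R x)\<bar> powr p) * indicator (annulus i) x \<partial>lborel)
      \<le> ennreal (2 powr (- real_of_int k * n) * (c * neighbour_sum w k) powr p)" if "i \<in> I" for i
  proof -
    have "(\<integral>\<^sup>+ x. ennreal (\<bar>\<psi> (2 powr (real_of_int k) *\<^sub>R x)\<bar> powr p) * indicator (annulus i) x \<partial>lborel)
      = ennreal (2 powr (- real_of_int k * n)) * ennreal ((2 powr (- real_of_int (i + k) * \<alpha>) * w (i + k)) powr p)"
      unfolding n_def int[symmetric]
      by (rule nn_integral_annulus_scale[where F="\<lambda>x. ennreal (\<bar>\<psi> x\<bar> powr p)"]) auto
    also have "\<dots> = ennreal (2 powr (- real_of_int k * n) * (2 powr (- real_of_int (i + k) * \<alpha>) * w (i + k)) powr p)"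
      by (simp add: ennreal_mult)
    also have "\<dots> \<le> ennreal (2 powr (- real_of_int k * n) * (c * neighbour_sum w k) powr p)"
    proof (intro ennreal_leI mult_left_mono powr_mono2 mult_mono)
      have "\<bar>real_of_int i * \<alpha>\<bar> \<le> 2 * \<bar>\<alpha>\<bar>"
        unfolding abs_mult using that by (intro mult_right_mono) (auto simp: I_def)
      then have "2 powr (- real_of_int (i + k) * \<alpha>) \<le> 2 powr (- real_of_int k * \<alpha> + 2 * \<bar>\<alpha>\<bar>)"
        by (intro powr_mono) (auto simp: algebra_simps)
      then show "2 powr (- real_of_int (i + k) * \<alpha>) \<le> c" unfolding c_def powr_add .
      show "w (i + k) \<le> neighbour_sum w k"
        using that w[of "k - 1"] w[of k] w[of "k + 1"] w[of "k + 2"]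
        by (auto simp: I_def neighbour_sum_def add.commute)
    qed (use w p in \<open>auto simp: c_def\<close>)
    finally show ?thesis .
  qed
  have "(\<integral>\<^sup>+ x. ennreal (\<bar>\<psi> (2 powr (real_of_int k) *\<^sub>R x)\<bar> powr p) * indicator {x. 1/4 \<le> norm x \<and> norm x < 4} x \<partial>lborel)
     \<le> (\<integral>\<^sup>+ x. (\<Sum>i\<in>I. ennreal (\<bar>\<psi> (2 powr (real_of_int k) *\<^sub>R x)\<bar> powr p) * indicator (annulus i) x) \<partial>lborel)"
  proof (rule nn_integral_mono)
    fix x :: 'a
    show "ennreal (\<bar>\<psi> (2 powr (real_of_int k) *\<^sub>R x)\<bar> powr p) * indicator {x. 1/4 \<le> norm x \<and> norm x < 4} x
       \<le> (\<Sum>i\<in>I. ennreal (\<bar>\<psi> (2 powr (real_of_int k) *\<^sub>R x)\<bar> powr p) * indicator (annulus i) x)"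
    proof (cases "1/4 \<le> norm x \<and> norm x < 4")
      case True
      then obtain i where i: "i \<in> I" "x \<in> annulus i" using shell_subset_annuli[of x] unfolding I_def by blast
      then show ?thesis
        using member_le_sum[of i I "\<lambda>i. ennreal (\<bar>\<psi> (2 powr (real_of_int k) *\<^sub>R x)\<bar> powr p) * indicator (annulus i) x"] True
        by (simp add: I_def)
    qed simp
  qed
  also have "\<dots> = (\<Sum>i\<in>I. \<integral>\<^sup>+ x. ennreal (\<bar>\<psi> (2 powr (real_of_int k) *\<^sub>R x)\<bar> powr p) * indicator (annulus i) x \<partial>lborel)"
    by (rule nn_integral_sum) auto
  also have "\<dots> \<le> (\<Sum>i\<in>I. ennreal (2 powr (- real_of_int k * n) * (c * neighbour_sum w k) powr p))"
    by (intro sum_mono each)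
  also have "\<dots> = ennreal (4 * (2 powr (- real_of_int k * n) * (c * neighbour_sum w k) powr p))"
    by (simp add: I_def ennreal_mult)
  also have "4 * (2 powr (- real_of_int k * n) * (c * neighbour_sum w k) powr p)
     = (2 powr (real_of_int k * (- n / p - \<alpha>)) * (4 powr (1 / p) * 2 powr (2 * \<bar>\<alpha>\<bar>)) * neighbour_sum w k) powr p"
  proof -
    have "2 powr (real_of_int k * (- n / p - \<alpha>)) * (4 powr (1 / p) * 2 powr (2 * \<bar>\<alpha>\<bar>)) * neighbour_sum w k
       = 4 powr (1 / p) * 2 powr (real_of_int k * (- n / p)) * (c * neighbour_sum w k)"
      by (simp add: c_def powr_add[symmetric] algebra_simps add_divide_distrib diff_divide_distrib)
    moreover have "(4 powr (1 / p) * 2 powr (real_of_int k * (- n / p)) * (c * neighbour_sum w k)) powr p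
       = 4 * 2 powr (- real_of_int k * n) * (c * neighbour_sum w k) powr p"
      using p neighbour_sum_nonneg[OF w] by (simp add: powr_mult powr_powr c_def)
    ultimately show ?thesis by (simp only: mult.assoc)
  qed
  finally show ?thesis by (simp add: n_def)
qed

text \<open>A finite sum on the right bounds each single increment by a multiple \<tau> of 2^(-je),
  and these bounds form a geometric series. Passing through the largest term makes the argument
  valid for every q > 0.\<close>

lemma ennreal_le_geometric_telescope:
  fixes c :: "nat \<Rightarrow> real"
  assumes lim: "c \<longlonglongrightarrow> 0" and e: "e > 0" and q: "q > 0"
  shows "ennreal (\<bar>c 0\<bar> powr q) \<le> ennreal ((1 / (1 - 2 powr (- e))) powr q)
     * (\<Sum>j. ennreal (2 powr (real j * e * q) * \<bar>c j - c (Suc j)\<bar> powr q))"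
proof (cases "(\<Sum>j. ennreal (2 powr (real j * e * q) * \<bar>c j - c (Suc j)\<bar> powr q))" rule: ennreal_cases)
  case (real T)
  define K where "K = 1 / (1 - 2 powr (- e))"
  have lt1: "2 powr (- e) < 1" using powr_less_one[of 2 "-e"] e by simp
  have K: "K > 0" using lt1 by (simp add: K_def)
  define \<tau> where "\<tau> = T powr (1 / q)"
  have inc: "\<bar>c j - c (Suc j)\<bar> \<le> (2 powr (- e)) ^ j * \<tau>" for j
  proof -
    define a where "a j = 2 powr (real j * e * q) * \<bar>c j - c (Suc j)\<bar> powr q" for j
    have "ennreal (a j) \<le> (\<Sum>j. ennreal (a j))"
      using sum_le_suminf[of "\<lambda>j. ennreal (a j)" "{j}"] by simp
    also have "\<dots> = ennreal T" using real by (simp only: a_def)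
    finally have "ennreal (2 powr (real j * e * q) * \<bar>c j - c (Suc j)\<bar> powr q) \<le> ennreal T"
      by (simp only: a_def)
    then have "2 powr (real j * e * q) * \<bar>c j - c (Suc j)\<bar> powr q \<le> T"
      using real by (simp add: ennreal_le_iff)
    then have "(2 powr (real j * e) * \<bar>c j - c (Suc j)\<bar>) powr q \<le> T"
      by (simp add: powr_mult powr_powr)
    then have "((2 powr (real j * e) * \<bar>c j - c (Suc j)\<bar>) powr q) powr (1 / q) \<le> \<tau>"
      unfolding \<tau>_def using q by (intro powr_mono2) auto
    then have "2 powr (real j * e) * \<bar>c j - c (Suc j)\<bar> \<le> \<tau>"
      using q by (simp add: powr_powr)
    then have "\<bar>c j - c (Suc j)\<bar> \<le> 2 powr (- (real j * e)) * \<tau>"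
      by (simp add: powr_minus field_simps)
    also have "2 powr (- (real j * e)) = (2 powr (- e)) ^ j"
      by (simp add: powr_realpow[symmetric] powr_powr mult.commute)
    finally show ?thesis .
  qed
  have "\<bar>c 0\<bar> - \<bar>c J\<bar> \<le> K * \<tau>" for J
  proof -
    have "c 0 - c J = (\<Sum>j<J. c j - c (Suc j))" by (simp add: sum_lessThan_telescope')
    then have "\<bar>c 0\<bar> - \<bar>c J\<bar> \<le> (\<Sum>j<J. \<bar>c j - c (Suc j)\<bar>)"
      using sum_abs[of "\<lambda>j. c j - c (Suc j)" "{..<J}"] by linarith
    also have "\<dots> \<le> (\<Sum>j<J. (2 powr (- e)) ^ j * \<tau>)" by (intro sum_mono inc)
    also have "\<dots> = (\<Sum>j<J. (2 powr (- e)) ^ j) * \<tau>" by (simp add: sum_distrib_right)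
    also have "\<dots> \<le> K * \<tau>"
    proof (rule mult_right_mono)
      show "(\<Sum>j<J. (2 powr (- e)) ^ j) \<le> K"
        unfolding K_def suminf_geometric[of "2 powr (- e)", symmetric, simplified]
        using lt1 by (subst suminf_geometric[symmetric]) (auto intro!: sum_le_suminf summable_geometric)
    qed (simp add: \<tau>_def)
    finally show ?thesis .
  qed
  moreover have "(\<lambda>J. \<bar>c 0\<bar> - \<bar>c J\<bar>) \<longlonglongrightarrow> \<bar>c 0\<bar> - \<bar>0\<bar>" by (intro tendsto_intros lim)
  ultimately have "\<bar>c 0\<bar> \<le> K * \<tau>" by (auto intro: LIMSEQ_le_const2)
  then have "\<bar>c 0\<bar> powr q \<le> (K * \<tau>) powr q" using q by (intro powr_mono2) auto
  also have "\<dots> = K powr q * T" using K q real by (simp add: powr_mult \<tau>_def powr_powr)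
  finally show ?thesis using real by (simp add: K_def ennreal_mult[symmetric] ennreal_leI)
next
  case top
  have "2 powr (- e) < 1" using powr_less_one[of 2 "-e"] e by simp
  then show ?thesis using top e by (simp add: ennreal_mult_top)
qed

text \<open>Over a fixed annulus the integral of |f(2^J x)|^u is at most a constant times 2^(-JBu)
  with B = n/u + \<alpha> > 0. The sum over J therefore has finite integral, converges almost
  everywhere, and its terms tend to 0.\<close>

lemma AE_tendsto_zero_along_dilations:
  fixes f :: "'a::euclidean_space \<Rightarrow> real"
  assumes [measurable]: "f \<in> borel_measurable borel" and u: "u > 0"
    and w: "\<And>k. 0 \<le> w k" "\<And>k. w k \<le> M"
    and int: "\<And>k. (\<integral>\<^sup>+ x. ennreal (\<bar>f x\<bar> powr u) * indicator (annulus k) x \<partial>lborel) = ennreal ((2 powr (- real_of_int k * \<alpha>) * w k) powr u)"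
    and pos: "real DIM('a) / u + \<alpha> > 0"
  shows "AE x in lborel. x \<in> annulus k \<longrightarrow> (\<lambda>J. f (2 powr (real J) *\<^sub>R x)) \<longlonglongrightarrow> 0"
proof -
  define n where "n = real DIM('a)"
  define B where "B = n / u + \<alpha>"
  have B: "B > 0" using pos by (simp add: B_def n_def)
  have M: "0 \<le> M" using w order_trans by blast
  have "(\<integral>\<^sup>+ x. (\<Sum>J. ennreal (\<bar>f (2 powr (real J) *\<^sub>R x)\<bar> powr u) * indicator (annulus k) x) \<partial>lborel)
     = (\<Sum>J. \<integral>\<^sup>+ x. ennreal (\<bar>f (2 powr (real J) *\<^sub>R x)\<bar> powr u) * indicator (annulus k) x \<partial>lborel)"
    by (rule nn_integral_suminf) measurable
  also have "\<dots> \<le> (\<Sum>J. ennreal ((2 powr (- real_of_int k * \<alpha>) * M) powr u * (2 powr (- B * u)) ^ J))"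
  proof (intro suminf_le summableI)
    fix J :: nat
    have "(\<integral>\<^sup>+ x. ennreal (\<bar>f (2 powr (real J) *\<^sub>R x)\<bar> powr u) * indicator (annulus k) x \<partial>lborel)
       = ennreal (2 powr (- real J * n)) * ennreal ((2 powr (- real_of_int (k + int J) * \<alpha>) * w (k + int J)) powr u)"
      unfolding int[symmetric] n_def
      using nn_integral_annulus_scale[where F="\<lambda>x. ennreal (\<bar>f x\<bar> powr u)" and j="int J" and k=k] by simp
    also have "\<dots> \<le> ennreal (2 powr (- real J * n)) * ennreal ((2 powr (- real_of_int (k + int J) * \<alpha>) * M) powr u)"
      using w M u by (intro mult_left_mono ennreal_leI powr_mono2) auto
    also have "\<dots> = ennreal (2 powr (- real J * n) * (2 powr (- real_of_int (k + int J) * \<alpha>) * M) powr u)"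
      by (simp add: ennreal_mult)
    also have "2 powr (- real J * n) * (2 powr (- real_of_int (k + int J) * \<alpha>) * M) powr u
       = (2 powr (- real_of_int k * \<alpha>) * M) powr u * (2 powr (- B * u)) ^ J"
    proof -
      have "2 powr (- real_of_int (k + int J) * \<alpha>) * M = 2 powr (- real J * \<alpha>) * (2 powr (- real_of_int k * \<alpha>) * M)"
      proof -
        have "- real_of_int (k + int J) * \<alpha> = - real J * \<alpha> + - real_of_int k * \<alpha>" by (simp add: algebra_simps)
        then show ?thesis by (simp only: powr_add mult.assoc)
      qed
      then have "(2 powr (- real_of_int (k + int J) * \<alpha>) * M) powr u = 2 powr (- real J * \<alpha> * u) * (2 powr (- real_of_int k * \<alpha>) * M) powr u"
        using M by (simp only: powr_mult powr_powr mult_nonneg_nonneg powr_ge_zero)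
      moreover have "2 powr (- real J * n) * 2 powr (- real J * \<alpha> * u) = (2 powr (- B * u)) ^ J"
      proof -
        have "- real J * n + - real J * \<alpha> * u = - B * u * real J" using u by (simp add: B_def field_simps)
        then show ?thesis by (simp add: powr_realpow[symmetric] powr_powr powr_add[symmetric])
      qed
      ultimately show ?thesis by (simp add: mult_ac)
    qed
    finally show "(\<integral>\<^sup>+ x. ennreal (\<bar>f (2 powr (real J) *\<^sub>R x)\<bar> powr u) * indicator (annulus k) x \<partial>lborel)
      \<le> ennreal ((2 powr (- real_of_int k * \<alpha>) * M) powr u * (2 powr (- B * u)) ^ J)" .
  qed
  also have "\<dots> < \<infinity>"
  proof -
    have "2 powr (- B * u) < 1" using powr_less_one[of 2 "- B * u"] B u by simp
    then have "summable (\<lambda>J. (2 powr (- real_of_int k * \<alpha>) * M) powr u * (2 powr (- B * u)) ^ J)"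
      by (intro summable_mult summable_geometric) simp
    then show ?thesis by (subst suminf_ennreal2) auto
  qed
  finally have fin: "(\<integral>\<^sup>+ x. (\<Sum>J. ennreal (\<bar>f (2 powr (real J) *\<^sub>R x)\<bar> powr u) * indicator (annulus k) x) \<partial>lborel) \<noteq> \<infinity>"
    by simp
  have "AE x in lborel. (\<Sum>J. ennreal (\<bar>f (2 powr (real J) *\<^sub>R x)\<bar> powr u) * indicator (annulus k) x) \<noteq> \<infinity>"
    by (rule nn_integral_noteq_infinite[OF _ fin]) measurable
  then show ?thesis
  proof eventually_elim
    case (elim x)
    show ?case
    proof
      assume x: "x \<in> annulus k"
      then have "(\<Sum>J. ennreal (\<bar>f (2 powr (real J) *\<^sub>R x)\<bar> powr u)) \<noteq> top" using elim by simp
      then have "summable (\<lambda>J. \<bar>f (2 powr (real J) *\<^sub>R x)\<bar> powr u)"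
        by (intro summable_suminf_not_top) auto
      then have "(\<lambda>J. \<bar>f (2 powr (real J) *\<^sub>R x)\<bar> powr u) \<longlonglongrightarrow> 0" by (rule summable_LIMSEQ_zero)
      from tendsto_zero_powrI[OF this tendsto_const[of "1 / u"]]
      have "(\<lambda>J. (\<bar>f (2 powr (real J) *\<^sub>R x)\<bar> powr u) powr (1 / u)) \<longlonglongrightarrow> 0"
        using u by simp
      then have "(\<lambda>J. \<bar>f (2 powr (real J) *\<^sub>R x)\<bar>) \<longlonglongrightarrow> 0" using u by (simp add: powr_powr)
      then show "(\<lambda>J. f (2 powr (real J) *\<^sub>R x)) \<longlonglongrightarrow> 0" by (rule tendsto_rabs_zero_cancel)
    qed
  qed
qed

subsection \<open>Weighted sequences and Herz norms\<close>

text \<open>Take for w k the l^r norm of b (k + j) with the weight 2^(-ej/2). Each weighted term is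
  at most w k, so half of the decay converts b into w and the other half sums over j. No case
  distinction between q and r is involved, and w inherits the l^r bound by interchanging the two
  sums.\<close>

lemma discrete_hardy:
  fixes b :: "int \<Rightarrow> real"
  assumes b: "\<And>k. 0 \<le> b k" and e: "e > 0" and q: "q > 0" and r: "r > 0" and M: "0 \<le> M"
    and sum: "(\<integral>\<^sup>+ k. ennreal (b k powr r) \<partial>count_space UNIV) \<le> ennreal (M powr r)"
  obtains w where "\<And>k. 0 \<le> w k"
    "\<And>k. (\<Sum>j. ennreal (2 powr (- real j * e * q) * b (k + int j) powr q)) \<le> ennreal (1 / (1 - 2 powr (- e * q / 2)) * w k powr q)"
    "(\<integral>\<^sup>+ k. ennreal (w k powr r) \<partial>count_space UNIV) \<le> ennreal (1 / (1 - 2 powr (- e * r / 2)) * M powr r)"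
proof -
  \<comment> \<open>Half of the decay rate, measured in r-th powers by \<beta> and in q-th powers by
    \<gamma>; they are related by \<open>\<beta> powr (q / r) = \<gamma>\<close>.\<close>
  define \<beta> where "\<beta> = 2 powr (- e * r / 2)"
  have \<beta>: "0 < \<beta>" "\<beta> < 1" using powr_less_one[of 2 "- e * r / 2"] e r by (auto simp: \<beta>_def)
  define \<gamma> where "\<gamma> = 2 powr (- e * q / 2)"
  have \<gamma>: "0 < \<gamma>" "\<gamma> < 1" using powr_less_one[of 2 "- e * q / 2"] e q by (auto simp: \<gamma>_def)
  have bM: "b k powr r \<le> M powr r" for k
  proof -
    have "ennreal (b k powr r) \<le> ennreal (M powr r)"
      by (rule order_trans[OF nn_integral_ge_point[of k UNIV "\<lambda>k. ennreal (b k powr r)"] sum]) simp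
    then show ?thesis by (simp add: ennreal_le_iff)
  qed
  have summ: "summable (\<lambda>j. \<beta> ^ j * b (k + int j) powr r)" for k
  proof (rule summable_comparison_test')
    show "summable (\<lambda>j. \<beta> ^ j * M powr r)" using \<beta> by (intro summable_mult2 summable_geometric) simp
    show "norm (\<beta> ^ j * b (k + int j) powr r) \<le> \<beta> ^ j * M powr r" if "j \<ge> 0" for j
      using bM \<beta> by (simp add: mult_left_mono abs_mult)
  qed
  define w where "w k = (\<Sum>j. \<beta> ^ j * b (k + int j) powr r) powr (1 / r)" for k
  have wr: "w k powr r = (\<Sum>j. \<beta> ^ j * b (k + int j) powr r)" for k
    unfolding w_def using r \<beta> by (intro powr_inverse_powr suminf_nonneg summ) auto
  have le: "2 powr (- real j * e * q) * b (k + int j) powr q \<le> \<gamma> ^ j * w k powr q" for k j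
  proof -
    have "\<beta> ^ j * b (k + int j) powr r \<le> w k powr r"
      unfolding wr using sum_le_suminf[OF summ, of "{j}" k] \<beta> by simp
    then have "(\<beta> ^ j * b (k + int j) powr r) powr (q / r) \<le> (w k powr r) powr (q / r)"
      using \<beta> q r by (intro powr_mono2) auto
    also have "(w k powr r) powr (q / r) = w k powr q" using r by (simp add: powr_powr)
    also have "(\<beta> ^ j * b (k + int j) powr r) powr (q / r) = \<gamma> ^ j * b (k + int j) powr q"
    proof -
      have "(\<beta> ^ j) powr (q / r) = \<gamma> ^ j"
        using r \<beta> by (simp add: \<beta>_def \<gamma>_def powr_realpow[symmetric] powr_powr mult_ac)
      then show ?thesis using r \<beta> by (simp add: powr_mult powr_powr)
    qed
    \<comment> \<open>The full weight is \<gamma>^j \<gamma>^j: one factor was spent on comparison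
      with w, the other survives as the ratio of a geometric series.\<close>
    finally have "\<gamma> ^ j * (\<gamma> ^ j * b (k + int j) powr q) \<le> \<gamma> ^ j * w k powr q"
      using \<gamma> by (intro mult_left_mono) auto
    moreover have "\<gamma> ^ j * \<gamma> ^ j = 2 powr (- real j * e * q)"
      by (simp add: \<gamma>_def powr_realpow[symmetric] powr_powr powr_add[symmetric] algebra_simps)
    ultimately show ?thesis by (simp add: mult.assoc[symmetric])
  qed
  show thesis
  proof (rule that[of w])
    show "0 \<le> w k" for k by (simp add: w_def)
    show "(\<Sum>j. ennreal (2 powr (- real j * e * q) * b (k + int j) powr q)) \<le> ennreal (1 / (1 - 2 powr (- e * q / 2)) * w k powr q)" for k
    proof -
      have "(\<Sum>j. ennreal (2 powr (- real j * e * q) * b (k + int j) powr q)) \<le> (\<Sum>j. ennreal (\<gamma> ^ j * w k powr q))"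
        by (intro suminf_le summableI ennreal_leI le)
      also have "\<dots> = ennreal (1 / (1 - \<gamma>) * w k powr q)"
        using \<gamma> by (intro suminf_ennreal_eq sums_mult2 geometric_sums) auto
      finally show ?thesis by (simp add: \<gamma>_def)
    qed
    have "(\<integral>\<^sup>+ k. ennreal (w k powr r) \<partial>count_space UNIV)
        = (\<integral>\<^sup>+ k. (\<Sum>j. ennreal (\<beta> ^ j * b (k + int j) powr r)) \<partial>count_space UNIV)"
      unfolding wr using summ \<beta> by (intro nn_integral_cong suminf_ennreal2[symmetric]) auto
    also have "\<dots> = (\<Sum>j. \<integral>\<^sup>+ k. ennreal (\<beta> ^ j * b (k + int j) powr r) \<partial>count_space UNIV)"
      by (rule nn_integral_suminf) simp
    also have "\<dots> \<le> (\<Sum>j. ennreal (\<beta> ^ j * M powr r))"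
    proof (intro suminf_le summableI)
      fix j
      have "(\<integral>\<^sup>+ k. ennreal (\<beta> ^ j * b (k + int j) powr r) \<partial>count_space UNIV)
         = ennreal (\<beta> ^ j) * (\<integral>\<^sup>+ k. ennreal (b (k + int j) powr r) \<partial>count_space UNIV)"
        using \<beta> by (subst nn_integral_cmult[symmetric]) (auto simp: ennreal_mult)
      also have "(\<integral>\<^sup>+ k. ennreal (b (k + int j) powr r) \<partial>count_space UNIV) = (\<integral>\<^sup>+ k. ennreal (b k powr r) \<partial>count_space UNIV)"
        by (rule nn_integral_bij_count_space) (auto intro!: bij_betw_byWitness[where f'="\<lambda>k. k - int j"])
      also have "ennreal (\<beta> ^ j) * \<dots> \<le> ennreal (\<beta> ^ j) * ennreal (M powr r)" by (intro mult_left_mono sum) auto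
      also have "\<dots> = ennreal (\<beta> ^ j * M powr r)" using \<beta> by (simp add: ennreal_mult)
      finally show "(\<integral>\<^sup>+ k. ennreal (\<beta> ^ j * b (k + int j) powr r) \<partial>count_space UNIV) \<le> ennreal (\<beta> ^ j * M powr r)" .
    qed
    also have "\<dots> = ennreal (1 / (1 - \<beta>) * M powr r)"
      using \<beta> by (intro suminf_ennreal_eq sums_mult2 geometric_sums) auto
    finally show "(\<integral>\<^sup>+ k. ennreal (w k powr r) \<partial>count_space UNIV) \<le> ennreal (1 / (1 - 2 powr (- e * r / 2)) * M powr r)"
      by (simp add: \<beta>_def)
  qed
qed

text \<open>The window sum is at most four times its largest entry, whose power is one of four
  shifted terms. The factor 4 is the first count and 4^(1/s) the second; s may be below 1.\<close>

lemma neighbour_sum_powr_nn_integral: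
  fixes w :: "int \<Rightarrow> real"
  assumes w: "\<And>k. 0 \<le> w k" and s: "s > 0" and N: "0 \<le> N"
    and sum: "(\<integral>\<^sup>+ k. ennreal (w k powr s) \<partial>count_space UNIV) \<le> ennreal (N powr s)"
  shows "(\<integral>\<^sup>+ k. ennreal (neighbour_sum w k powr s) \<partial>count_space UNIV) \<le> ennreal ((4 * 4 powr (1 / s) * N) powr s)"
proof -
  define I where "I = {-1, 0, 1, 2 :: int}"
  have pt: "neighbour_sum w k powr s \<le> (\<Sum>i\<in>I. 4 powr s * w (k + i) powr s)" for k
  proof -
    have "Max ((\<lambda>i. w (k + i)) ` I) \<in> (\<lambda>i. w (k + i)) ` I" by (rule Max_in) (auto simp: I_def)
    then obtain i where i: "i \<in> I" "w (k + i) = Max ((\<lambda>i. w (k + i)) ` I)" by auto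
    have le: "w (k + j) \<le> w (k + i)" if "j \<in> I" for j
      unfolding i(2) using that by (intro Max_ge) (auto simp: I_def)
    have "neighbour_sum w k \<le> 4 * w (k + i)"
      using le[of "-1"] le[of 0] le[of 1] le[of 2] by (simp add: neighbour_sum_def I_def)
    then have "neighbour_sum w k powr s \<le> (4 * w (k + i)) powr s"
      using s neighbour_sum_nonneg[OF w] by (intro powr_mono2) auto
    also have "\<dots> = 4 powr s * w (k + i) powr s" using w by (simp add: powr_mult)
    also have "\<dots> \<le> (\<Sum>i\<in>I. 4 powr s * w (k + i) powr s)"
      using i(1) by (intro member_le_sum) (auto simp: I_def)
    finally show ?thesis .
  qed
  have shift: "(\<integral>\<^sup>+ k. ennreal (w (k + i) powr s) \<partial>count_space UNIV) = (\<integral>\<^sup>+ k. ennreal (w k powr s) \<partial>count_space UNIV)" for i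
    by (rule nn_integral_bij_count_space) (auto intro!: bij_betw_byWitness[where f'="\<lambda>k. k - i"])
  have "(\<integral>\<^sup>+ k. ennreal (neighbour_sum w k powr s) \<partial>count_space UNIV)
     \<le> (\<integral>\<^sup>+ k. (\<Sum>i\<in>I. ennreal (4 powr s) * ennreal (w (k + i) powr s)) \<partial>count_space UNIV)"
    using pt by (intro nn_integral_mono) (simp add: ennreal_mult[symmetric] ennreal_leI sum_ennreal)
  also have "\<dots> = (\<Sum>i\<in>I. ennreal (4 powr s) * (\<integral>\<^sup>+ k. ennreal (w k powr s) \<partial>count_space UNIV))"
    by (simp add: nn_integral_sum nn_integral_cmult shift)
  also have "\<dots> \<le> (\<Sum>i\<in>I. ennreal (4 powr s) * ennreal (N powr s))"
    by (intro sum_mono mult_left_mono sum) auto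
  also have "\<dots> = ennreal (4 * (4 powr s * N powr s))" by (simp add: I_def ennreal_mult)
  also have "4 * (4 powr s * N powr s) = (4 * 4 powr (1 / s) * N) powr s"
    using s N by (simp add: powr_mult powr_powr)
  finally show ?thesis .
qed

section \<open>Herz norms as weighted sequence norms\<close>

lemma epow_ennreal: "0 \<le> t \<Longrightarrow> epow (ennreal t) a = ennreal (t powr a)"
  by (simp add: epow_def)

lemma epow_mono:
  assumes "x \<le> y" "a > 0" shows "epow x a \<le> epow y a"
proof (cases "y = \<infinity>")
  case False
  then have "x \<noteq> \<infinity>" using assms by (auto simp: top_unique)
  moreover have "enn2real x \<le> enn2real y" using assms False by (intro enn2real_mono) (auto simp: less_top)
  ultimately show ?thesis using False assms by (auto simp: epow_def intro!: ennreal_leI powr_mono2)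
qed (simp add: epow_def)

text \<open>With w k equal to 2^(k\<alpha>) times the L^p norm on the k-th annulus, the Herz norm is
  the l^q norm of w. From here on the argument handles real sequences instead of extended
  reals.\<close>

lemma herz_norm_finite_weights:
  fixes g :: "'a::euclidean_space \<Rightarrow> real"
  assumes fin: "herz_norm \<alpha> p q g < \<infinity>" and p: "p > 0" and q: "q > 0"
  obtains w where "\<And>k. 0 \<le> w k"
    "\<And>k. (\<integral>\<^sup>+ x. ennreal (\<bar>g x\<bar> powr p) * indicator (annulus k) x \<partial>lborel) = ennreal ((2 powr (- real_of_int k * \<alpha>) * w k) powr p)"
    "(\<integral>\<^sup>+ k. ennreal (w k powr q) \<partial>count_space UNIV) = ennreal (enn2real (herz_norm \<alpha> p q g) powr q)"
proof -
  define I where "I k = (\<integral>\<^sup>+ x. ennreal (\<bar>g x\<bar> powr p) * indicator (annulus k) x \<partial>lborel)" for k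
  define T where "T k = ennreal (2 powr (real_of_int k * \<alpha> * q)) * epow (Lp_norm_on p (annulus k) g) q" for k
  define X where "X = (\<integral>\<^sup>+ k. T k \<partial>count_space UNIV)"
  have herz: "herz_norm \<alpha> p q g = epow X (1 / q)" by (simp add: herz_norm_def X_def T_def)
  have X: "X \<noteq> \<infinity>" using fin by (auto simp: herz epow_def split: if_splits)
  have I: "I k \<noteq> \<infinity>" for k
  proof
    \<comment> \<open>One infinite annulus integral stays infinite under \<open>epow\<close> and
      under the positive weight, so it would make the whole norm infinite.\<close>
    assume "I k = \<infinity>"
    then have "T k = \<infinity>" by (simp add: T_def Lp_norm_on_def I_def epow_def ennreal_mult_top)
    then show False
      using X nn_integral_ge_point[of k UNIV T] by (simp add: X_def top_unique)
  qed
  define c where "c k = enn2real (I k)" for k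
  have c: "I k = ennreal (c k)" "0 \<le> c k" for k
    using I[of k] by (simp_all add: c_def less_top)
  define w where "w k = 2 powr (real_of_int k * \<alpha>) * c k powr (1 / p)" for k
  have T: "T k = ennreal (w k powr q)" for k
    using c q by (simp add: T_def Lp_norm_on_def I_def[symmetric] epow_ennreal w_def powr_mult powr_powr ennreal_mult[symmetric])
  show thesis
  proof (rule that[of w])
    show "0 \<le> w k" for k by (simp add: w_def)
    show "(\<integral>\<^sup>+ x. ennreal (\<bar>g x\<bar> powr p) * indicator (annulus k) x \<partial>lborel) = ennreal ((2 powr (- real_of_int k * \<alpha>) * w k) powr p)" for k
    proof -
      have "2 powr (- real_of_int k * \<alpha>) * w k = c k powr (1 / p)"
        by (simp add: w_def mult.assoc[symmetric] powr_add[symmetric])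
      then show ?thesis using c p by (simp add: I_def[symmetric] powr_powr)
    qed
    have "enn2real (herz_norm \<alpha> p q g) powr q = enn2real X"
      unfolding herz using X q by (simp add: epow_def powr_powr)
    then show "(\<integral>\<^sup>+ k. ennreal (w k powr q) \<partial>count_space UNIV) = ennreal (enn2real (herz_norm \<alpha> p q g) powr q)"
      using X by (simp add: T[symmetric] X_def[symmetric] less_top)
  qed
qed

text \<open>The converse passage from sequences to Herz norms. Upper bounds suffice here, and that
  is what the Hardy step supplies.\<close>

lemma herz_norm_le:
  fixes g :: "'a::euclidean_space \<Rightarrow> real"
  assumes w: "\<And>k. 0 \<le> w k" and p: "p > 0" and q: "q > 0" and M: "0 \<le> M"
    and int: "\<And>k. (\<integral>\<^sup>+ x. ennreal (\<bar>g x\<bar> powr p) * indicator (annulus k) x \<partial>lborel) \<le> ennreal ((2 powr (- real_of_int k * \<alpha>) * w k) powr p)"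
    and sum: "(\<integral>\<^sup>+ k. ennreal (w k powr q) \<partial>count_space UNIV) \<le> ennreal (M powr q)"
  shows "herz_norm \<alpha> p q g \<le> ennreal M"
proof -
  have T: "ennreal (2 powr (real_of_int k * \<alpha> * q)) * epow (Lp_norm_on p (annulus k) g) q \<le> ennreal (w k powr q)" for k
  proof -
    have "Lp_norm_on p (annulus k) g \<le> epow (ennreal ((2 powr (- real_of_int k * \<alpha>) * w k) powr p)) (1 / p)"
      unfolding Lp_norm_on_def using p by (intro epow_mono int) auto
    also have "\<dots> = ennreal (2 powr (- real_of_int k * \<alpha>) * w k)"
      using w p by (simp add: epow_ennreal powr_powr)
    finally have "epow (Lp_norm_on p (annulus k) g) q \<le> ennreal ((2 powr (- real_of_int k * \<alpha>) * w k) powr q)"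
      using epow_mono[OF _ q] w by (metis epow_ennreal mult_nonneg_nonneg powr_ge_zero)
    then have "ennreal (2 powr (real_of_int k * \<alpha> * q)) * epow (Lp_norm_on p (annulus k) g) q
        \<le> ennreal (2 powr (real_of_int k * \<alpha> * q)) * ennreal ((2 powr (- real_of_int k * \<alpha>) * w k) powr q)"
      by (intro mult_left_mono) auto
    also have "\<dots> = ennreal (w k powr q)"
      using w by (simp add: ennreal_mult[symmetric] powr_mult powr_powr mult.assoc[symmetric] powr_add[symmetric])
    finally show ?thesis .
  qed
  have "herz_norm \<alpha> p q g \<le> epow (ennreal (M powr q)) (1 / q)"
    unfolding herz_norm_def using q T
    by (intro epow_mono order_trans[OF nn_integral_mono sum]) auto
  also have "\<dots> = ennreal M" using M q by (simp add: epow_ennreal powr_powr)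
  finally show ?thesis .
qed

text \<open>By linearity the derivative is represented by the vector of its values on the basis, and
  continuity of the partial derivatives makes this vector field continuous.\<close>

lemma C1_fun_gradient:
  fixes f :: "'a::euclidean_space \<Rightarrow> real"
  assumes "C1_fun f"
  obtains gr where "continuous_on UNIV gr" "\<And>x. (f has_derivative (\<lambda>y. gr x \<bullet> y)) (at x)" "\<And>x. grad_norm f x = norm (gr x)"
proof
  define gr where "gr x = (\<Sum>b\<in>Basis. frechet_derivative f (at x) b *\<^sub>R b)" for x
  have D: "(f has_derivative frechet_derivative f (at x)) (at x)" for x
    using assms by (simp add: C1_fun_def frechet_derivative_works)
  show "continuous_on UNIV gr"
    unfolding gr_def using assms by (intro continuous_intros) (auto simp: C1_fun_def)
  show "(f has_derivative (\<lambda>y. gr x \<bullet> y)) (at x)" for x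
  proof -
    have "frechet_derivative f (at x) y = gr x \<bullet> y" for y
    proof -
      interpret linear "frechet_derivative f (at x)" using D has_derivative_linear by blast
      have "frechet_derivative f (at x) y = frechet_derivative f (at x) (\<Sum>b\<in>Basis. (y \<bullet> b) *\<^sub>R b)"
        by (simp add: euclidean_representation)
      also have "\<dots> = gr x \<bullet> y" by (simp add: sum scale gr_def inner_sum_left inner_commute[of y] mult.commute)
      finally show ?thesis .
    qed
    then show ?thesis using D[of x] by (simp add: has_derivative_eq_rhs ext)
  qed
  show "grad_norm f x = norm (gr x)" for x by (simp add: grad_norm_def gr_def)
qed

text \<open>The local inequality is applied to f(2^k x). \<open>balance\<close> is what it requires
  at unit scale, while \<open>scaling\<close> collects the powers of 2^k into 2^(-k \<alpha>1 q), so
  B does not depend on k.\<close>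

lemma annulus_increment_le:
  fixes p q u \<theta> \<delta> \<alpha>1 \<alpha>2 \<alpha>3 :: real
  defines "n \<equiv> real DIM('a::euclidean_space)"
  assumes p: "p \<ge> 1" and u: "u > 0" and q: "q > 0" and \<theta>: "0 < \<theta>" "\<theta> \<le> 1" and \<delta>: "0 \<le> \<delta>" "\<delta> \<le> 1"
    and balance: "1 / q = \<theta> * (1 / p - \<delta> / n) + (1 - \<theta>) / u"
    and scaling: "n / q + \<alpha>1 = \<theta> * (n / p + \<alpha>2 - 1) + (n / u + \<alpha>3) * (1 - \<theta>)"
  shows "\<exists>B\<ge>0. \<forall>(f :: 'a \<Rightarrow> real) gr G H k. (\<forall>x. (f has_derivative (\<lambda>y. gr x \<bullet> y)) (at x)) \<longrightarrow>
     continuous_on UNIV gr \<longrightarrow> (\<forall>k. 0 \<le> G k) \<longrightarrow> (\<forall>k. 0 \<le> H k) \<longrightarrow>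
     (\<forall>k. (\<integral>\<^sup>+ x. ennreal (norm (gr x) powr p) * indicator (annulus k) x \<partial>lborel) = ennreal ((2 powr (- real_of_int k * \<alpha>2) * G k) powr p)) \<longrightarrow>
     (\<forall>k. (\<integral>\<^sup>+ x. ennreal (\<bar>f x\<bar> powr u) * indicator (annulus k) x \<partial>lborel) = ennreal ((2 powr (- real_of_int k * \<alpha>3) * H k) powr u)) \<longrightarrow>
     (\<integral>\<^sup>+ x. ennreal (\<bar>f x - f (2 *\<^sub>R x)\<bar> powr q) * indicator (annulus k) x \<partial>lborel)
       \<le> ennreal ((2 powr (- real_of_int k * \<alpha>1) * (B * neighbour_sum G k powr \<theta> * neighbour_sum H k powr (1 - \<theta>))) powr q)"
proof -
  obtain C where C: "C \<ge> 0" and local: "\<And>(f :: 'a \<Rightarrow> real) gr P U. (\<forall>x. (f has_derivative (\<lambda>y. gr x \<bullet> y)) (at x)) \<Longrightarrow>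
     continuous_on UNIV gr \<Longrightarrow> 0 \<le> P \<Longrightarrow> 0 \<le> U \<Longrightarrow>
     (\<integral>\<^sup>+ x. ennreal (norm (gr x) powr p) * indicator {x. 1/4 \<le> norm x \<and> norm x < 4} x \<partial>lborel) \<le> ennreal (P powr p) \<Longrightarrow>
     (\<integral>\<^sup>+ x. ennreal (\<bar>f x\<bar> powr u) * indicator {x. 1/4 \<le> norm x \<and> norm x < 4} x \<partial>lborel) \<le> ennreal (U powr u) \<Longrightarrow>
     (\<integral>\<^sup>+ x. ennreal (\<bar>f x - f (2 *\<^sub>R x)\<bar> powr q) * indicator (annulus 0) x \<partial>lborel)
       \<le> ennreal (C * P powr (\<theta> * q) * U powr ((1 - \<theta>) * q))"
    using local_gagliardo_nirenberg_increment[OF p u q \<theta> \<delta> balance[unfolded n_def]] by auto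
  define cp where "cp = 4 powr (1 / p) * 2 powr (2 * \<bar>\<alpha>2\<bar>)"
  define cu where "cu = 4 powr (1 / u) * 2 powr (2 * \<bar>\<alpha>3\<bar>)"
  have c: "0 \<le> cp" "0 \<le> cu" by (simp_all add: cp_def cu_def)
  define B where "B = C powr (1 / q) * cp powr \<theta> * cu powr (1 - \<theta>)"
  show ?thesis
  proof (intro exI[of _ B] conjI allI impI)
    show "0 \<le> B" by (simp add: B_def)
    fix f :: "'a \<Rightarrow> real" and gr :: "'a \<Rightarrow> 'a" and G H :: "int \<Rightarrow> real" and k :: int
    assume der: "\<forall>x. (f has_derivative (\<lambda>y. gr x \<bullet> y)) (at x)" and cont: "continuous_on UNIV gr"
      and G: "\<forall>k. 0 \<le> G k" and H: "\<forall>k. 0 \<le> H k"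
      and intG: "\<forall>k. (\<integral>\<^sup>+ x. ennreal (norm (gr x) powr p) * indicator (annulus k) x \<partial>lborel) = ennreal ((2 powr (- real_of_int k * \<alpha>2) * G k) powr p)"
      and intH: "\<forall>k. (\<integral>\<^sup>+ x. ennreal (\<bar>f x\<bar> powr u) * indicator (annulus k) x \<partial>lborel) = ennreal ((2 powr (- real_of_int k * \<alpha>3) * H k) powr u)"
    have contf: "continuous_on UNIV f"
      using der has_derivative_continuous continuous_at_imp_continuous_on by blast
    have [measurable]: "f \<in> borel_measurable borel" "gr \<in> borel_measurable borel"
      using contf cont by (auto intro: borel_measurable_continuous_onI)
    define a where "a = 2 powr (real_of_int k)"
    have a: "a > 0" by (simp add: a_def)
    define P0 where "P0 = 2 powr (real_of_int k * (- n / p - \<alpha>2)) * cp * neighbour_sum G k"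
    define U where "U = 2 powr (real_of_int k * (- n / u - \<alpha>3)) * cu * neighbour_sum H k"
    have NG: "0 \<le> neighbour_sum G k" and NH: "0 \<le> neighbour_sum H k"
      using G H by (auto intro: neighbour_sum_nonneg)
    have P0: "0 \<le> P0" and U: "0 \<le> U" using NG NH c by (simp_all add: P0_def U_def)
    have "(\<integral>\<^sup>+ x. ennreal (\<bar>f (a *\<^sub>R x) - f (a *\<^sub>R (2 *\<^sub>R x))\<bar> powr q) * indicator (annulus 0) x \<partial>lborel)
       \<le> ennreal (C * (a * P0) powr (\<theta> * q) * U powr ((1 - \<theta>) * q))"
    proof (rule local[where f="\<lambda>x. f (a *\<^sub>R x)" and gr="\<lambda>x. a *\<^sub>R gr (a *\<^sub>R x)"])
      show "\<forall>x. ((\<lambda>x. f (a *\<^sub>R x)) has_derivative (\<lambda>y. (a *\<^sub>R gr (a *\<^sub>R x)) \<bullet> y)) (at x)"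
      proof
        fix x :: 'a
        have "((\<lambda>x. a *\<^sub>R x) has_derivative (\<lambda>y. a *\<^sub>R y)) (at x)"
          by (auto intro!: derivative_eq_intros)
        then have "((\<lambda>x. f (a *\<^sub>R x)) has_derivative (\<lambda>y. gr (a *\<^sub>R x) \<bullet> (a *\<^sub>R y))) (at x)"
          using has_derivative_compose der by blast
        then show "((\<lambda>x. f (a *\<^sub>R x)) has_derivative (\<lambda>y. (a *\<^sub>R gr (a *\<^sub>R x)) \<bullet> y)) (at x)" by simp
      qed
      show "continuous_on UNIV (\<lambda>x. a *\<^sub>R gr (a *\<^sub>R x))"
        by (intro continuous_intros continuous_on_compose2[OF cont]) auto
      have "(\<integral>\<^sup>+ x. ennreal (norm (a *\<^sub>R gr (a *\<^sub>R x)) powr p) * indicator {x. 1/4 \<le> norm x \<and> norm x < 4} x \<partial>lborel)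
        = (\<integral>\<^sup>+ x. ennreal (a powr p) * (ennreal (\<bar>norm (gr (a *\<^sub>R x))\<bar> powr p) * indicator {x. 1/4 \<le> norm x \<and> norm x < 4} x) \<partial>lborel)"
        using a by (intro nn_integral_cong) (simp add: powr_mult ennreal_mult mult.assoc)
      also have "\<dots> = ennreal (a powr p) * (\<integral>\<^sup>+ x. ennreal (\<bar>norm (gr (a *\<^sub>R x))\<bar> powr p) * indicator {x. 1/4 \<le> norm x \<and> norm x < 4} x \<partial>lborel)"
        by (rule nn_integral_cmult) measurable
      also have "\<dots> \<le> ennreal (a powr p) * ennreal (P0 powr p)"
        unfolding P0_def a_def cp_def n_def using p G intG
        by (intro mult_left_mono nn_integral_shell_le[where \<psi>="\<lambda>x. norm (gr x)"]) auto
      also have "\<dots> = ennreal ((a * P0) powr p)" using a P0 by (simp add: powr_mult ennreal_mult)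
      finally show "(\<integral>\<^sup>+ x. ennreal (norm (a *\<^sub>R gr (a *\<^sub>R x)) powr p) * indicator {x. 1/4 \<le> norm x \<and> norm x < 4} x \<partial>lborel) \<le> ennreal ((a * P0) powr p)" .
      show "(\<integral>\<^sup>+ x. ennreal (\<bar>f (a *\<^sub>R x)\<bar> powr u) * indicator {x. 1/4 \<le> norm x \<and> norm x < 4} x \<partial>lborel) \<le> ennreal (U powr u)"
        unfolding U_def a_def cu_def n_def using u H intH
        by (intro nn_integral_shell_le) auto
    qed (use a P0 U in auto)
    also have "(\<integral>\<^sup>+ x. ennreal (\<bar>f (a *\<^sub>R x) - f (a *\<^sub>R (2 *\<^sub>R x))\<bar> powr q) * indicator (annulus 0) x \<partial>lborel)
       = ennreal (2 powr (- real_of_int k * n)) * (\<integral>\<^sup>+ x. ennreal (\<bar>f x - f (2 *\<^sub>R x)\<bar> powr q) * indicator (annulus k) x \<partial>lborel)"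
      using nn_integral_annulus_scale[where F="\<lambda>x. ennreal (\<bar>f x - f (2 *\<^sub>R x)\<bar> powr q)" and j=k and k=0]
      by (simp add: a_def n_def mult.commute)
    finally have "ennreal (2 powr (real_of_int k * n)) * (ennreal (2 powr (- real_of_int k * n)) * (\<integral>\<^sup>+ x. ennreal (\<bar>f x - f (2 *\<^sub>R x)\<bar> powr q) * indicator (annulus k) x \<partial>lborel))
       \<le> ennreal (2 powr (real_of_int k * n)) * ennreal (C * (a * P0) powr (\<theta> * q) * U powr ((1 - \<theta>) * q))"
      by (rule mult_left_mono) simp
    also have "ennreal (2 powr (real_of_int k * n)) * (ennreal (2 powr (- real_of_int k * n)) * (\<integral>\<^sup>+ x. ennreal (\<bar>f x - f (2 *\<^sub>R x)\<bar> powr q) * indicator (annulus k) x \<partial>lborel))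
       = (\<integral>\<^sup>+ x. ennreal (\<bar>f x - f (2 *\<^sub>R x)\<bar> powr q) * indicator (annulus k) x \<partial>lborel)"
      by (simp add: mult.assoc[symmetric] ennreal_mult[symmetric] powr_add[symmetric])
    also have "ennreal (2 powr (real_of_int k * n)) * ennreal (C * (a * P0) powr (\<theta> * q) * U powr ((1 - \<theta>) * q))
       = ennreal (2 powr (real_of_int k * n) * (C * (a * P0) powr (\<theta> * q) * U powr ((1 - \<theta>) * q)))"
      using C by (simp add: ennreal_mult)
    also have "2 powr (real_of_int k * n) * (C * (a * P0) powr (\<theta> * q) * U powr ((1 - \<theta>) * q))
       = (2 powr (- real_of_int k * \<alpha>1) * (B * neighbour_sum G k powr \<theta> * neighbour_sum H k powr (1 - \<theta>))) powr q"
    proof -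
      \<comment> \<open>e1 and e2 are the exponents of 2^k in the gradient and function bounds; the
        1 in e1 is the factor a from differentiating f (a x).\<close>
      define e1 where "e1 = 1 - n / p - \<alpha>2"
      define e2 where "e2 = - n / u - \<alpha>3"
      have aP: "a * P0 = 2 powr (real_of_int k * e1) * (cp * neighbour_sum G k)"
      proof -
        have "real_of_int k * e1 = real_of_int k + real_of_int k * (- n / p - \<alpha>2)"
          by (simp add: e1_def algebra_simps)
        then show ?thesis by (simp only: a_def P0_def powr_add mult.assoc)
      qed
      have PP: "(a * P0) powr (\<theta> * q) = 2 powr (real_of_int k * e1 * (\<theta> * q)) * (cp powr (\<theta> * q) * neighbour_sum G k powr (\<theta> * q))"
        unfolding aP using c NG by (simp add: powr_mult powr_powr)
      have UU: "U powr ((1 - \<theta>) * q) = 2 powr (real_of_int k * e2 * ((1 - \<theta>) * q)) * (cu powr ((1 - \<theta>) * q) * neighbour_sum H k powr ((1 - \<theta>) * q))"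
        unfolding U_def e2_def[symmetric] using c NH by (simp add: powr_mult powr_powr)
      have "n + e1 * (\<theta> * q) + e2 * ((1 - \<theta>) * q) = - \<alpha>1 * q"
      proof -
        have "n + e1 * (\<theta> * q) + e2 * ((1 - \<theta>) * q) = n - q * (\<theta> * (n / p + \<alpha>2 - 1) + (n / u + \<alpha>3) * (1 - \<theta>))"
          by (simp add: e1_def e2_def algebra_simps diff_divide_distrib)
        also have "\<dots> = - \<alpha>1 * q" unfolding scaling[symmetric] using q by (simp add: field_simps)
        finally show ?thesis .
      qed
      then have "real_of_int k * n + (real_of_int k * e1 * (\<theta> * q) + real_of_int k * e2 * ((1 - \<theta>) * q)) = real_of_int k * (- \<alpha>1 * q)"
        by (simp add: mult.assoc distrib_left[symmetric] add.assoc)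
      then have two: "2 powr (real_of_int k * n) * (2 powr (real_of_int k * e1 * (\<theta> * q)) * 2 powr (real_of_int k * e2 * ((1 - \<theta>) * q))) = 2 powr (real_of_int k * (- \<alpha>1 * q))"
        by (simp only: powr_add[symmetric])
      have "2 powr (real_of_int k * n) * (C * (a * P0) powr (\<theta> * q) * U powr ((1 - \<theta>) * q))
        = (2 powr (real_of_int k * n) * (2 powr (real_of_int k * e1 * (\<theta> * q)) * 2 powr (real_of_int k * e2 * ((1 - \<theta>) * q))))
          * (C * (cp powr (\<theta> * q) * neighbour_sum G k powr (\<theta> * q)) * (cu powr ((1 - \<theta>) * q) * neighbour_sum H k powr ((1 - \<theta>) * q)))"
        unfolding PP UU by (simp only: mult_ac)
      also have "\<dots> = (2 powr (- real_of_int k * \<alpha>1) * (B * neighbour_sum G k powr \<theta> * neighbour_sum H k powr (1 - \<theta>))) powr q"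
        unfolding two B_def using C c NG NH q by (simp add: powr_mult powr_powr mult_ac)
      finally show ?thesis .
    qed
    finally show "(\<integral>\<^sup>+ x. ennreal (\<bar>f x - f (2 *\<^sub>R x)\<bar> powr q) * indicator (annulus k) x \<partial>lborel)
       \<le> ennreal ((2 powr (- real_of_int k * \<alpha>1) * (B * neighbour_sum G k powr \<theta> * neighbour_sum H k powr (1 - \<theta>))) powr q)" .
  qed
qed

text \<open>Almost everywhere f x is the telescoping sum of the increments at 2^j x. Moving the j-th
  increment back to the annulus k + j yields the decay 2^(-j(n + \<alpha> q)) = 2^(-2ejq); the
  telescoping estimate spends 2^(jeq), and the other half is left for the Hardy step.\<close>

lemma annulus_integral_le_increments:
  fixes f :: "'a::euclidean_space \<Rightarrow> real" and b :: "int \<Rightarrow> real"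
  defines "n \<equiv> real DIM('a)"
  assumes [measurable]: "f \<in> borel_measurable borel" and q: "q > 0" and b: "\<And>k. 0 \<le> b k"
    and e: "e > 0" "2 * e = n / q + \<alpha>"
    and lim: "AE x in lborel. x \<in> annulus k \<longrightarrow> (\<lambda>J. f (2 powr (real J) *\<^sub>R x)) \<longlonglongrightarrow> 0"
    and int: "\<And>k. (\<integral>\<^sup>+ x. ennreal (\<bar>f x - f (2 *\<^sub>R x)\<bar> powr q) * indicator (annulus k) x \<partial>lborel)
       \<le> ennreal ((2 powr (- real_of_int k * \<alpha>) * b k) powr q)"
  shows "(\<integral>\<^sup>+ x. ennreal (\<bar>f x\<bar> powr q) * indicator (annulus k) x \<partial>lborel)
    \<le> ennreal ((1 / (1 - 2 powr (- e))) powr q * 2 powr (- real_of_int k * \<alpha> * q)) * (\<Sum>j. ennreal (2 powr (- real j * e * q) * b (k + int j) powr q))"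
proof -
  define K where "K = (1 / (1 - 2 powr (- e))) powr q"
  define g where "g x = \<bar>f x - f (2 *\<^sub>R x)\<bar> powr q" for x
  have [measurable]: "g \<in> borel_measurable borel" unfolding g_def by measurable
  have "(\<integral>\<^sup>+ x. ennreal (\<bar>f x\<bar> powr q) * indicator (annulus k) x \<partial>lborel)
     \<le> (\<integral>\<^sup>+ x. (\<Sum>j. ennreal (K * 2 powr (real j * e * q)) * (ennreal (g (2 powr (real j) *\<^sub>R x)) * indicator (annulus k) x)) \<partial>lborel)"
  proof (rule nn_integral_mono_AE)
    show "AE x in lborel. ennreal (\<bar>f x\<bar> powr q) * indicator (annulus k) x
       \<le> (\<Sum>j. ennreal (K * 2 powr (real j * e * q)) * (ennreal (g (2 powr (real j) *\<^sub>R x)) * indicator (annulus k) x))"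
      using lim
    proof eventually_elim
      case (elim x)
      show ?case
      proof (cases "x \<in> annulus k")
        case True
        have double: "2 powr (real (Suc j)) *\<^sub>R x = 2 *\<^sub>R (2 powr (real j) *\<^sub>R x)" for j
          by (simp add: powr_add)
        have "ennreal (\<bar>f (2 powr (real 0) *\<^sub>R x)\<bar> powr q) \<le> ennreal K
          * (\<Sum>j. ennreal (2 powr (real j * e * q) * \<bar>f (2 powr (real j) *\<^sub>R x) - f (2 powr (real (Suc j)) *\<^sub>R x)\<bar> powr q))"
          unfolding K_def using elim True e q by (intro ennreal_le_geometric_telescope[where c="\<lambda>j. f (2 powr (real j) *\<^sub>R x)"]) auto
        also have "\<dots> = ennreal K * (\<Sum>j. ennreal (2 powr (real j * e * q) * g (2 powr (real j) *\<^sub>R x)))"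
          unfolding double g_def ..
        also have "\<dots> = (\<Sum>j. ennreal K * ennreal (2 powr (real j * e * q) * g (2 powr (real j) *\<^sub>R x)))"
          by (rule ennreal_suminf_cmult[symmetric])
        also have "\<dots> = (\<Sum>j. ennreal (K * 2 powr (real j * e * q)) * (ennreal (g (2 powr (real j) *\<^sub>R x)) * indicator (annulus k) x))"
          using True by (simp add: K_def g_def ennreal_mult mult.assoc)
        finally show ?thesis using True by simp
      qed simp
    qed
  qed
  also have "\<dots> = (\<Sum>j. ennreal (K * 2 powr (real j * e * q)) * (\<integral>\<^sup>+ x. ennreal (g (2 powr (real j) *\<^sub>R x)) * indicator (annulus k) x \<partial>lborel))"
    by (subst nn_integral_suminf) (auto simp: nn_integral_cmult)
  also have "\<dots> \<le> (\<Sum>j. ennreal (K * 2 powr (- real_of_int k * \<alpha> * q)) * ennreal (2 powr (- real j * e * q) * b (k + int j) powr q))"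
  proof (intro suminf_le summableI)
    fix j :: nat
    have "ennreal (K * 2 powr (real j * e * q)) * (\<integral>\<^sup>+ x. ennreal (g (2 powr (real j) *\<^sub>R x)) * indicator (annulus k) x \<partial>lborel)
       = ennreal (K * 2 powr (real j * e * q)) * (ennreal (2 powr (- real j * n)) * (\<integral>\<^sup>+ x. ennreal (g x) * indicator (annulus (k + int j)) x \<partial>lborel))"
      using nn_integral_annulus_scale[where F="\<lambda>x. ennreal (g x)" and j="int j" and k=k] by (simp add: n_def)
    also have "\<dots> \<le> ennreal (K * 2 powr (real j * e * q)) * (ennreal (2 powr (- real j * n)) * ennreal ((2 powr (- real_of_int (k + int j) * \<alpha>) * b (k + int j)) powr q))"
      unfolding g_def by (intro mult_left_mono int) auto
    also have "\<dots> = ennreal (K * 2 powr (real j * e * q) * (2 powr (- real j * n) * (2 powr (- real_of_int (k + int j) * \<alpha>) * b (k + int j)) powr q))"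
      by (simp add: ennreal_mult K_def)
    also have "K * 2 powr (real j * e * q) * (2 powr (- real j * n) * (2 powr (- real_of_int (k + int j) * \<alpha>) * b (k + int j)) powr q)
       = K * 2 powr (- real_of_int k * \<alpha> * q) * (2 powr (- real j * e * q) * b (k + int j) powr q)"
    proof -
      \<comment> \<open>The choice of e as half the gap enters here: Jacobian, weight and
        telescoping factor together leave exactly 2^(-jeq).\<close>
      have n_eq: "n = 2 * e * q - \<alpha> * q" using e q by (simp add: field_simps)
      have "real j * e * q + (- real j * n + - real_of_int (k + int j) * \<alpha> * q) = - real_of_int k * \<alpha> * q + - real j * e * q"
        unfolding n_eq by (simp add: algebra_simps)
      then have two: "2 powr (real j * e * q) * (2 powr (- real j * n) * 2 powr (- real_of_int (k + int j) * \<alpha> * q)) = 2 powr (- real_of_int k * \<alpha> * q) * 2 powr (- real j * e * q)"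
        by (simp only: powr_add[symmetric])
      have "K * 2 powr (real j * e * q) * (2 powr (- real j * n) * (2 powr (- real_of_int (k + int j) * \<alpha>) * b (k + int j)) powr q)
         = K * (2 powr (real j * e * q) * (2 powr (- real j * n) * 2 powr (- real_of_int (k + int j) * \<alpha> * q))) * b (k + int j) powr q"
        using b by (simp only: powr_mult powr_powr powr_ge_zero mult.assoc)
      then show ?thesis unfolding two by (simp only: mult.assoc)
    qed
    also have "ennreal (K * 2 powr (- real_of_int k * \<alpha> * q) * (2 powr (- real j * e * q) * b (k + int j) powr q))
       = ennreal (K * 2 powr (- real_of_int k * \<alpha> * q)) * ennreal (2 powr (- real j * e * q) * b (k + int j) powr q)"
      by (simp add: ennreal_mult K_def)
    finally show "ennreal (K * 2 powr (real j * e * q)) * (\<integral>\<^sup>+ x. ennreal (g (2 powr (real j) *\<^sub>R x)) * indicator (annulus k) x \<partial>lborel)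
       \<le> ennreal (K * 2 powr (- real_of_int k * \<alpha> * q)) * ennreal (2 powr (- real j * e * q) * b (k + int j) powr q)" .
  qed
  also have "\<dots> = ennreal (K * 2 powr (- real_of_int k * \<alpha> * q)) * (\<Sum>j. ennreal (2 powr (- real j * e * q) * b (k + int j) powr q))"
    by (rule ennreal_suminf_cmult)
  finally show ?thesis by (simp add: K_def)
qed

subsection \<open>The inequality in Herz spaces\<close>

text \<open>The sequence estimates follow the convention \<open>0 powr 0 = 0\<close>, whereas
  \<open>rpow\<close> sets the zeroth power to 1. Passing from the former to the latter only
  enlarges the right side.\<close>

lemma powr_le_rpow: "0 \<le> x \<Longrightarrow> x powr a \<le> rpow x a"
  by (simp add: rpow_def)

theorem theorem2p14:
  fixes p u q r v s \<theta> \<alpha>1 \<alpha>2 \<alpha>3 \<sigma> :: real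
  defines "n \<equiv> real DIM('a::euclidean_space)"
  assumes "p \<ge> 1" "u \<ge> 1" "q > 0" "r > 0" "v > 0" "s > 0"
    and "0 \<le> \<theta>" "\<theta> \<le> 1"
    and "n / p + \<alpha>2 > 0" "n / u + \<alpha>3 > 0" "n / q + \<alpha>1 > 0"
    and "\<sigma> \<le> \<alpha>2" "\<alpha>2 \<le> \<sigma> + 1"
    and "\<alpha>1 = \<theta> * \<sigma> + (1 - \<theta>) * \<alpha>3"
    and "n / q + \<alpha>1 = \<theta> * (n / p + \<alpha>2 - 1) + (n / u + \<alpha>3) * (1 - \<theta>)"
    and "1 / r = \<theta> / s + (1 - \<theta>) / v"
  shows "\<exists>c>0. \<forall>f :: 'a \<Rightarrow> real. C1_fun f \<longrightarrow>
           herz_norm \<alpha>2 p s (grad_norm f) < \<infinity> \<longrightarrow> herz_norm \<alpha>3 u v f < \<infinity> \<longrightarrow>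
           herz_norm \<alpha>1 q r f \<le>
             ennreal (c * rpow (enn2real (herz_norm \<alpha>2 p s (grad_norm f))) \<theta>
                        * rpow (enn2real (herz_norm \<alpha>3 u v f)) (1 - \<theta>))"
proof (cases "\<theta> = 0")
  \<comment> \<open>For \<theta> = 0 the relations force \<alpha>1 = \<alpha>3, q = u and r = v, so
    both sides are the same norm.\<close>
  case True
  have n: "n > 0" by (simp add: n_def)
  have a: "\<alpha>1 = \<alpha>3" using assms(15) True by simp
  then have "n / q = n / u" using assms(16) True by simp
  then have "q = u" using n assms(3,4) by (simp add: field_simps)
  moreover have "r = v" using assms(5,6,17) True by simp
  ultimately show ?thesis
    using a True by (intro exI[of _ 1]) (auto simp: rpow_def less_top)
next
  case False
  \<comment> \<open>The part of one derivative that is used for integrability. Its range [0,1]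
    expresses \<sigma> \<le> \<alpha>2 \<le> \<sigma> + 1, and eliminating \<alpha>1 from the
    scaling relation turns it into \<open>balance\<close>.\<close>
  define \<delta> where "\<delta> = \<sigma> + 1 - \<alpha>2"
  have n: "n > 0" by (simp add: n_def)
  have par: "p \<ge> 1" "p > 0" "u > 0" "q > 0" "r > 0" "v > 0" "s > 0" "0 < \<theta>" "\<theta> \<le> 1" "0 \<le> \<delta>" "\<delta> \<le> 1"
    using assms False by (auto simp: \<delta>_def)
  have balance: "1 / q = \<theta> * (1 / p - \<delta> / n) + (1 - \<theta>) / u"
  proof -
    have \<delta>n: "\<delta> = n * (\<delta> / n)" using n by simp
    have "n * (1 / q) = \<theta> * (n * (1 / p)) - \<theta> * \<delta> + (1 - \<theta>) * (n * (1 / u))"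
      using assms(15,16) by (simp add: \<delta>_def algebra_simps)
    also have "\<dots> = \<theta> * (n * (1 / p)) - \<theta> * (n * (\<delta> / n)) + (1 - \<theta>) * (n * (1 / u))"
      by (simp only: \<delta>n[symmetric])
    also have "\<dots> = n * (\<theta> * (1 / p - \<delta> / n) + (1 - \<theta>) * (1 / u))"
      by (simp only: distrib_left right_diff_distrib mult.left_commute)
    finally have "n * (1 / q) = n * (\<theta> * (1 / p - \<delta> / n) + (1 - \<theta>) / u)" by simp
    then show ?thesis using n by (simp only: mult_left_cancel[OF less_imp_neq[OF n, symmetric]])
  qed
  obtain B where B: "B \<ge> 0" and increment: "\<And>(f :: 'a \<Rightarrow> real) gr G H k. (\<forall>x. (f has_derivative (\<lambda>y. gr x \<bullet> y)) (at x)) \<Longrightarrow>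
     continuous_on UNIV gr \<Longrightarrow> (\<forall>k. 0 \<le> G k) \<Longrightarrow> (\<forall>k. 0 \<le> H k) \<Longrightarrow>
     (\<forall>k. (\<integral>\<^sup>+ x. ennreal (norm (gr x) powr p) * indicator (annulus k) x \<partial>lborel) = ennreal ((2 powr (- real_of_int k * \<alpha>2) * G k) powr p)) \<Longrightarrow>
     (\<forall>k. (\<integral>\<^sup>+ x. ennreal (\<bar>f x\<bar> powr u) * indicator (annulus k) x \<partial>lborel) = ennreal ((2 powr (- real_of_int k * \<alpha>3) * H k) powr u)) \<Longrightarrow>
     (\<integral>\<^sup>+ x. ennreal (\<bar>f x - f (2 *\<^sub>R x)\<bar> powr q) * indicator (annulus k) x \<partial>lborel)
       \<le> ennreal ((2 powr (- real_of_int k * \<alpha>1) * (B * neighbour_sum G k powr \<theta> * neighbour_sum H k powr (1 - \<theta>))) powr q)"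
    using annulus_increment_le[where ?'a='a, OF par(1,3,4,8-11), of \<alpha>1 \<alpha>2 \<alpha>3] balance assms(16)
    unfolding n_def by blast
  \<comment> \<open>Half of the positive gap, so that telescoping and the Hardy operator each
    receive a positive decay rate.\<close>
  define e where "e = (n / q + \<alpha>1) / 2"
  have e: "e > 0" "2 * e = n / q + \<alpha>1" using assms(12) by (simp_all add: e_def)
  define K0 where "K0 = (1 / (1 - 2 powr (- e))) powr q"
  define K1 where "K1 = 1 / (1 - 2 powr (- e * q / 2))"
  define K2 where "K2 = 1 / (1 - 2 powr (- e * r / 2))"
  have K: "0 \<le> K0" "0 \<le> K1" "0 \<le> K2"
    using powr_less_one[of 2 "- e * q / 2"] powr_less_one[of 2 "- e * r / 2"] e par
    by (simp_all add: K0_def K1_def K2_def)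
  define L where "L = (K0 * K1) powr (1 / q)"
  have L: "0 \<le> L" by (simp add: L_def)
  define c1 where "c1 = 4 * 4 powr (1 / s)"
  define c2 where "c2 = 4 * 4 powr (1 / v)"
  have c12: "0 \<le> c1" "0 \<le> c2" by (simp_all add: c1_def c2_def)
  define C where "C = L * K2 powr (1 / r) * (B * c1 powr \<theta> * c2 powr (1 - \<theta>))"
  have C: "0 \<le> C" using B L by (simp add: C_def)
  show ?thesis
  \<comment> \<open>C is only known to be nonnegative; adding 1 makes the constant positive.\<close>
  proof (intro exI[of _ "C + 1"] conjI allI impI)
    show "0 < C + 1" using C by simp
    fix f :: "'a \<Rightarrow> real"
    assume f: "C1_fun f" and fin1: "herz_norm \<alpha>2 p s (grad_norm f) < \<infinity>" and fin2: "herz_norm \<alpha>3 u v f < \<infinity>"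
    define N1 where "N1 = enn2real (herz_norm \<alpha>2 p s (grad_norm f))"
    define N2 where "N2 = enn2real (herz_norm \<alpha>3 u v f)"
    have N: "0 \<le> N1" "0 \<le> N2" by (simp_all add: N1_def N2_def)
    obtain gr where cont: "continuous_on UNIV gr" and der: "\<And>x. (f has_derivative (\<lambda>y. gr x \<bullet> y)) (at x)"
      and gr: "\<And>x. grad_norm f x = norm (gr x)"
      using C1_fun_gradient[OF f] by blast
    have contf: "continuous_on UNIV f"
      using der has_derivative_continuous continuous_at_imp_continuous_on by blast
    have [measurable]: "f \<in> borel_measurable borel"
      using contf by (rule borel_measurable_continuous_onI)
    obtain G where G: "\<And>k. 0 \<le> G k"
      "\<And>k. (\<integral>\<^sup>+ x. ennreal (\<bar>grad_norm f x\<bar> powr p) * indicator (annulus k) x \<partial>lborel) = ennreal ((2 powr (- real_of_int k * \<alpha>2) * G k) powr p)"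
      "(\<integral>\<^sup>+ k. ennreal (G k powr s) \<partial>count_space UNIV) = ennreal (N1 powr s)"
      using herz_norm_finite_weights[OF fin1 par(2,7)] unfolding N1_def by blast
    obtain H where H: "\<And>k. 0 \<le> H k"
      "\<And>k. (\<integral>\<^sup>+ x. ennreal (\<bar>f x\<bar> powr u) * indicator (annulus k) x \<partial>lborel) = ennreal ((2 powr (- real_of_int k * \<alpha>3) * H k) powr u)"
      "(\<integral>\<^sup>+ k. ennreal (H k powr v) \<partial>count_space UNIV) = ennreal (N2 powr v)"
      using herz_norm_finite_weights[OF fin2 par(3,6)] unfolding N2_def by blast
    define b where "b k = B * neighbour_sum G k powr \<theta> * neighbour_sum H k powr (1 - \<theta>)" for k
    have NG: "0 \<le> neighbour_sum G k" and NH: "0 \<le> neighbour_sum H k" for k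
      using G(1) H(1) by (auto intro: neighbour_sum_nonneg)
    have b: "0 \<le> b k" for k using B by (simp add: b_def)
    have inc: "(\<integral>\<^sup>+ x. ennreal (\<bar>f x - f (2 *\<^sub>R x)\<bar> powr q) * indicator (annulus k) x \<partial>lborel)
        \<le> ennreal ((2 powr (- real_of_int k * \<alpha>1) * b k) powr q)" for k
      unfolding b_def using der cont G(1) H(1) G(2)[unfolded gr abs_norm_cancel] H(2)
      by (intro increment allI)
    define M where "M = B * (c1 * N1) powr \<theta> * (c2 * N2) powr (1 - \<theta>)"
    have M: "0 \<le> M" using B by (simp add: M_def)
    have bM: "(\<integral>\<^sup>+ k. ennreal (b k powr r) \<partial>count_space UNIV) \<le> ennreal (M powr r)"
    proof -
      \<comment> \<open>Two-factor Hoelder is obtained from the three-factor form by repeating the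
        H-sequence with exponent 0. The repetition is harmless since
        \<open>t powr a * t powr 0 = t powr a\<close> holds at t = 0 as well. The relation for 1/r
        makes the exponents add up to exactly 1.\<close>
      have "(\<integral>\<^sup>+ k. ennreal ((neighbour_sum G k powr s) powr (\<theta> * r / s) * (neighbour_sum H k powr v) powr ((1 - \<theta>) * r / v)
           * (neighbour_sum H k powr v) powr 0) \<partial>count_space UNIV)
         \<le> ennreal (((c1 * N1) powr s) powr (\<theta> * r / s) * ((c2 * N2) powr v) powr ((1 - \<theta>) * r / v) * ((c2 * N2) powr v) powr 0)"
      proof (rule nn_integral_count_space_Holder3)
        show "(\<integral>\<^sup>+ k. ennreal (neighbour_sum G k powr s) \<partial>count_space UNIV) \<le> ennreal ((c1 * N1) powr s)"
          unfolding c1_def using G par N by (intro neighbour_sum_powr_nn_integral) auto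
        show "(\<integral>\<^sup>+ k. ennreal (neighbour_sum H k powr v) \<partial>count_space UNIV) \<le> ennreal ((c2 * N2) powr v)"
          unfolding c2_def using H par N by (intro neighbour_sum_powr_nn_integral) auto
        then show "(\<integral>\<^sup>+ k. ennreal (neighbour_sum H k powr v) \<partial>count_space UNIV) \<le> ennreal ((c2 * N2) powr v)" .
        have "\<theta> * r / s + (1 - \<theta>) * r / v = r * (1 / r)"
          unfolding assms(17) by (simp add: algebra_simps)
        then show "1 \<le> \<theta> * r / s + (1 - \<theta>) * r / v + 0" using par by simp
      qed (use par in auto)
      note * = this
      have **: "(\<integral>\<^sup>+ k. ennreal (neighbour_sum G k powr (\<theta> * r) * neighbour_sum H k powr ((1 - \<theta>) * r)) \<partial>count_space UNIV)
         \<le> ennreal ((c1 * N1) powr (\<theta> * r) * (c2 * N2) powr ((1 - \<theta>) * r))"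
      proof -
        have "t powr a * t powr 0 = t powr a" for t a :: real by simp
        moreover have "s * (\<theta> * r / s) = \<theta> * r" "v * ((1 - \<theta>) * r / v) = (1 - \<theta>) * r" using par by auto
        ultimately show ?thesis using * by (simp only: powr_powr mult.assoc[of "_ powr _" "_ powr _" "_ powr _"] mult_zero_right)
      qed
      have "(\<integral>\<^sup>+ k. ennreal (b k powr r) \<partial>count_space UNIV)
         = ennreal (B powr r) * (\<integral>\<^sup>+ k. ennreal (neighbour_sum G k powr (\<theta> * r) * neighbour_sum H k powr ((1 - \<theta>) * r)) \<partial>count_space UNIV)"
        using B NG NH
        by (subst nn_integral_cmult[symmetric]) (auto intro!: nn_integral_cong simp: b_def powr_mult powr_powr ennreal_mult[symmetric] mult.assoc)
      also have "\<dots> \<le> ennreal (B powr r) * ennreal ((c1 * N1) powr (\<theta> * r) * (c2 * N2) powr ((1 - \<theta>) * r))"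
        by (intro mult_left_mono **) auto
      also have "\<dots> = ennreal (M powr r)"
        using B c12 N by (simp add: M_def powr_mult powr_powr ennreal_mult[symmetric] mult.assoc)
      finally show ?thesis .
    qed
    obtain w where w: "\<And>k. 0 \<le> w k"
      "\<And>k. (\<Sum>j. ennreal (2 powr (- real j * e * q) * b (k + int j) powr q)) \<le> ennreal (K1 * w k powr q)"
      "(\<integral>\<^sup>+ k. ennreal (w k powr r) \<partial>count_space UNIV) \<le> ennreal (K2 * M powr r)"
      using discrete_hardy[OF b e(1) par(4,5) M bM] unfolding K1_def K2_def by blast
    \<comment> \<open>A sequence in l^v is bounded by its norm, and this uniform bound is what the
      decay along dilations requires.\<close>
    have HN: "H k \<le> N2" for k
    proof (rule ccontr)
      assume "\<not> H k \<le> N2"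
      then have "N2 powr v < H k powr v" using N par by (intro powr_less_mono2) auto
      moreover have "ennreal (H k powr v) \<le> ennreal (N2 powr v)"
        unfolding H(3)[symmetric] by (rule nn_integral_ge_point[of k UNIV "\<lambda>k. ennreal (H k powr v)"]) simp
      ultimately show False by (simp add: ennreal_le_iff)
    qed
    have "herz_norm \<alpha>1 q r f \<le> ennreal (L * K2 powr (1 / r) * M)"
    proof (rule herz_norm_le[where w="\<lambda>k. L * w k"])
      show "(\<integral>\<^sup>+ x. ennreal (\<bar>f x\<bar> powr q) * indicator (annulus k) x \<partial>lborel)
          \<le> ennreal ((2 powr (- real_of_int k * \<alpha>1) * (L * w k)) powr q)" for k
      proof -
        have lim: "AE x in lborel. x \<in> annulus k \<longrightarrow> (\<lambda>J. f (2 powr (real J) *\<^sub>R x)) \<longlonglongrightarrow> 0"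
          using assms(11) by (intro AE_tendsto_zero_along_dilations[OF _ par(3) H(1) HN H(2)]) (auto simp: n_def)
        have "(\<integral>\<^sup>+ x. ennreal (\<bar>f x\<bar> powr q) * indicator (annulus k) x \<partial>lborel)
           \<le> ennreal (K0 * 2 powr (- real_of_int k * \<alpha>1 * q)) * (\<Sum>j. ennreal (2 powr (- real j * e * q) * b (k + int j) powr q))"
          unfolding K0_def using b e inc par lim
          by (intro annulus_integral_le_increments) (auto simp: n_def)
        also have "\<dots> \<le> ennreal (K0 * 2 powr (- real_of_int k * \<alpha>1 * q)) * ennreal (K1 * w k powr q)"
          by (intro mult_left_mono w) auto
        also have "\<dots> = ennreal (2 powr (- real_of_int k * \<alpha>1 * q) * ((K0 * K1) * w k powr q))"
          using K by (simp add: ennreal_mult[symmetric] mult_ac)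
        also have "K0 * K1 = L powr q" unfolding L_def using K par by (simp add: powr_powr)
        also have "2 powr (- real_of_int k * \<alpha>1 * q) * (L powr q * w k powr q) = (2 powr (- real_of_int k * \<alpha>1) * (L * w k)) powr q"
          using L w(1) by (simp add: powr_mult powr_powr)
        finally show ?thesis .
      qed
      have "(\<integral>\<^sup>+ k. ennreal ((L * w k) powr r) \<partial>count_space UNIV) = ennreal (L powr r) * (\<integral>\<^sup>+ k. ennreal (w k powr r) \<partial>count_space UNIV)"
        using L w(1) by (subst nn_integral_cmult[symmetric]) (auto simp: powr_mult ennreal_mult)
      also have "\<dots> \<le> ennreal (L powr r) * ennreal (K2 * M powr r)" by (intro mult_left_mono w) auto
      also have "\<dots> = ennreal ((L * K2 powr (1 / r) * M) powr r)"
        using L K M par by (simp add: powr_mult powr_powr ennreal_mult[symmetric] mult.assoc)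
      finally show "(\<integral>\<^sup>+ k. ennreal ((L * w k) powr r) \<partial>count_space UNIV) \<le> ennreal ((L * K2 powr (1 / r) * M) powr r)" .
    qed (use L w(1) par M in auto)
    also have "\<dots> \<le> ennreal ((C + 1) * rpow N1 \<theta> * rpow N2 (1 - \<theta>))"
    proof (rule ennreal_leI)
      have "L * K2 powr (1 / r) * M = C * N1 powr \<theta> * N2 powr (1 - \<theta>)"
        using c12 N by (simp add: C_def M_def powr_mult mult_ac)
      also have "\<dots> \<le> (C + 1) * rpow N1 \<theta> * rpow N2 (1 - \<theta>)"
        using C N by (intro mult_mono powr_le_rpow) (auto simp: rpow_def)
      finally show "L * K2 powr (1 / r) * M \<le> (C + 1) * rpow N1 \<theta> * rpow N2 (1 - \<theta>)" .
    qed
    finally show "herz_norm \<alpha>1 q r f \<le> ennreal ((C + 1) * rpow (enn2real (herz_norm \<alpha>2 p s (grad_norm f))) \<theta>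
                        * rpow (enn2real (herz_norm \<alpha>3 u v f)) (1 - \<theta>))"
      by (simp add: N1_def N2_def)
  qed
qed

end
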